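(* Let $d\ge 2$, $1\le q<d$, $0<\delta<1$, $\nu\in(0,1]$. Let $a^{ij}=a^{ji}$ ($i,j=1,\dots,d$) be bounded measurable functions on $\mathbb{R}^d$ depending only on $x''$ (i.e. $a^{ij}(x)=a^{ij}(x'')$), continuous on $\mathbb{R}^d$, and satisfying $\nu|\xi|^2\le a^{ij}(x)\xi^i\xi^j\le \nu^{-1}|\xi|^2$ for all $x,\xi\in\mathbb{R}^d$. Let $Lu:=a^{ij}(x'')D_{ij}u$. Let $f\in C^{\delta}_{x'}(\mathbb{R}^d)$ and let $u$ be a bounded strong solution of $Lu=f$ in $\mathbb{R}^d$, i.e. $u\in W^2_{d,\mathrm{loc}}(\mathbb{R}^d)$ and $Lu=f$ a.e. in $\mathbb{R}^d$. Then $u\in C^{2+\delta}_{x'}(\mathbb{R}^d)$ and there is a constant $N=N(d,q,\delta,\nu)$ such that \[ [u]_{x',2+\delta}\le N[f]_{x',\delta}. \]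
   Context: Points of $\mathbb{R}^d$ are written $x=(x',x'')$ with $x'=(x^1,\dots,x^q)\in\mathbb{R}^q$, $x''=(x^{q+1},\dots,x^d)\in\mathbb{R}^{d-q}$; summation over repeated indices is used. The partial Hölder semi-norm is $[u]_{x',\delta}:=\sup_{x''\in\mathbb{R}^{d-q}}\sup_{x'\neq y'}\frac{|u(x',x'')-u(y',x'')|}{|x'-y'|^\delta}$, and for $k\ge 0$, $[u]_{x',k+\delta}:=\max_{\alpha\in\mathbb{Z}_+^q,|\alpha|=k}[\tilde D^\alpha u]_{x',\delta}$, where $\tilde D^\alpha=D_1^{\alpha_1}\cdots D_q^{\alpha_q}$ (derivatives only in the $x'$ variables). $C^k_{x'}(\mathbb{R}^d)$ is the set of bounded measurable $u$ such that $\tilde D^\alpha u$ for $\alpha\in\mathbb{Z}_+^q$, $|\alpha|\le k$, are continuous and bounded on $\mathbb{R}^d$; $C^{k+\delta}_{x'}(\mathbb{R}^d)$ is the set of $u\in C^k_{x'}(\mathbb{R}^d)$ with $[u]_{x',k+\delta}<\infty$. *)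

theory Defs
  imports "HOL-Analysis.Analysis"
begin

text \<open>Points of R^d are vectors indexed by the sum type 'q + 'r:
  coordinates Inl k (k :: 'q) are the x' variables (q = CARD('q)),
  coordinates Inr k (k :: 'r) are the x'' variables (d - q = CARD('r)).\<close>

type_synonym ('q, 'r) pt = "real ^ ('q + 'r)"

definition same_xpp :: "('q::finite, 'r::finite) pt \<Rightarrow> ('q, 'r) pt \<Rightarrow> bool" where
  "same_xpp x y \<longleftrightarrow> (\<forall>k. x $ Inr k = y $ Inr k)"

definition has_partial :: "('q::finite + 'r::finite) \<Rightarrow> (('q, 'r) pt \<Rightarrow> real) \<Rightarrow> bool" where
  "has_partial i u \<longleftrightarrow> (\<forall>x. (\<lambda>t. u (x + t *\<^sub>R axis i 1)) differentiable (at 0))"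

definition partial :: "('q::finite + 'r::finite) \<Rightarrow> (('q, 'r) pt \<Rightarrow> real) \<Rightarrow> ('q, 'r) pt \<Rightarrow> real" where
  "partial i u x = deriv (\<lambda>t. u (x + t *\<^sub>R axis i 1)) 0"

definition cont_bdd :: "(('q::finite, 'r::finite) pt \<Rightarrow> real) \<Rightarrow> bool" where
  "cont_bdd g \<longleftrightarrow> g \<in> borel_measurable lborel \<and> continuous_on UNIV g \<and> bounded (range g)"

definition C0_xp :: "(('q::finite, 'r::finite) pt \<Rightarrow> real) \<Rightarrow> bool" where
  "C0_xp u \<longleftrightarrow> cont_bdd u"

definition C2_xp :: "(('q::finite, 'r::finite) pt \<Rightarrow> real) \<Rightarrow> bool" where
  "C2_xp u \<longleftrightarrow> cont_bdd u \<and>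
     (\<forall>i::'q. has_partial (Inl i) u \<and> cont_bdd (partial (Inl i) u) \<and>
       (\<forall>j::'q. has_partial (Inl j) (partial (Inl i) u) \<and>
                cont_bdd (partial (Inl j) (partial (Inl i) u))))"

text \<open>Partial Hoelder semi-norm [u]_{x',delta} (as an extended real).  For x, y with
  the same x'' part, norm (x - y) = |x' - y'|.\<close>
definition holder_xp :: "real \<Rightarrow> (('q::finite, 'r::finite) pt \<Rightarrow> real) \<Rightarrow> ereal" where
  "holder_xp \<delta> u = (SUP p \<in> {(x, y). same_xpp x y \<and> x \<noteq> y}.
      ereal (\<bar>u (fst p) - u (snd p)\<bar> / norm (fst p - snd p) powr \<delta>))"

definition holder2_xp :: "real \<Rightarrow> (('q::finite, 'r::finite) pt \<Rightarrow> real) \<Rightarrow> ereal" where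
  "holder2_xp \<delta> u = (SUP p \<in> (UNIV :: ('q \<times> 'q) set).
      holder_xp \<delta> (partial (Inl (snd p)) (partial (Inl (fst p)) u)))"

definition C_delta_xp :: "real \<Rightarrow> (('q::finite, 'r::finite) pt \<Rightarrow> real) \<Rightarrow> bool" where
  "C_delta_xp \<delta> u \<longleftrightarrow> C0_xp u \<and> holder_xp \<delta> u < \<infinity>"

definition C2_delta_xp :: "real \<Rightarrow> (('q::finite, 'r::finite) pt \<Rightarrow> real) \<Rightarrow> bool" where
  "C2_delta_xp \<delta> u \<longleftrightarrow> C2_xp u \<and> holder2_xp \<delta> u < \<infinity>"

fun Ck :: "nat \<Rightarrow> (('q::finite, 'r::finite) pt \<Rightarrow> real) \<Rightarrow> bool" where
  "Ck 0 \<phi> \<longleftrightarrow> continuous_on UNIV \<phi>"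
| "Ck (Suc k) \<phi> \<longleftrightarrow> continuous_on UNIV \<phi> \<and> (\<forall>i. has_partial i \<phi> \<and> Ck k (partial i \<phi>))"

definition test_fun :: "(('q::finite, 'r::finite) pt \<Rightarrow> real) \<Rightarrow> bool" where
  "test_fun \<phi> \<longleftrightarrow> (\<forall>k. Ck k \<phi>) \<and> compact (closure {x. \<phi> x \<noteq> 0})"

definition Lp_loc :: "real \<Rightarrow> (('q::finite, 'r::finite) pt \<Rightarrow> real) \<Rightarrow> bool" where
  "Lp_loc p g \<longleftrightarrow> g \<in> borel_measurable lborel \<and>
     (\<forall>K. compact K \<longrightarrow> (\<integral>\<^sup>+ x. ennreal (indicator K x * \<bar>g x\<bar> powr p) \<partial>lborel) < \<infinity>)"

definition weak_partial :: "('q::finite + 'r::finite) \<Rightarrow> (('q, 'r) pt \<Rightarrow> real) \<Rightarrow> (('q, 'r) pt \<Rightarrow> real) \<Rightarrow> bool" where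
  "weak_partial i u g \<longleftrightarrow> Lp_loc 1 u \<and> Lp_loc 1 g \<and>
     (\<forall>\<phi>. test_fun \<phi> \<longrightarrow>
        (\<integral>x. u x * partial i \<phi> x \<partial>lborel) = - (\<integral>x. g x * \<phi> x \<partial>lborel))"

definition strong_solution ::
  "(('q::finite + 'r::finite) \<Rightarrow> ('q + 'r) \<Rightarrow> ('q, 'r) pt \<Rightarrow> real) \<Rightarrow>
   (('q, 'r) pt \<Rightarrow> real) \<Rightarrow> (('q, 'r) pt \<Rightarrow> real) \<Rightarrow> bool" where
  "strong_solution a f u \<longleftrightarrow>
     (let d = real (CARD('q + 'r)) in
      \<exists>g1 g2. Lp_loc d u \<and>
        (\<forall>i. weak_partial i u (g1 i) \<and> Lp_loc d (g1 i)) \<and>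
        (\<forall>i j. weak_partial j (g1 i) (g2 i j) \<and> Lp_loc d (g2 i j)) \<and>
        (AE x in lborel. (\<Sum>i\<in>UNIV. \<Sum>j\<in>UNIV. a i j x * g2 i j x) = f x))"

end

theory Submission
  imports Defs "HOL-Computational_Algebra.Polynomial"
begin

text \<open>The coefficients do not depend on \<open>x'\<close>, so finite differences of \<open>u\<close> in \<open>x'\<close> are again
  solutions, and the whole estimate can be run on third differences, with the maximum principle as the
  only PDE input; no existence theory and no Krylov--Safonov estimate is needed.

  Bernstein's method applied to \<open>w = |\<delta>\<^sub>h z|\<^sup>2 / |h|\<^sup>2 + A \<zeta>\<^sup>2\<close>, where \<open>\<zeta>\<close> is the mean of \<open>z\<close> over the
  segment from \<open>x\<close> to \<open>x + h\<close> (so that the derivative of \<open>\<zeta>\<close> along \<open>h\<close> is \<open>\<delta>\<^sub>h z\<close>), gives for bounded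
  entire solutions of \<open>L z = g\<close> and every \<open>K \<ge> 1\<close> the interpolation inequality
  \<open>|\<delta>\<^sub>h z| \<le> 2 sup |z| / K + 3 K\<^sup>2 |h|\<^sup>2 sup |g| / \<nu>\<close>. Let \<open>M\<close> be the supremum of
  \<open>|\<delta>\<^sub>k \<delta>\<^sub>h\<^sup>2 u| / (|h|\<^sup>2 |k|\<^sup>\<delta>)\<close> over \<open>|h|, |k| \<ge> \<eta>\<close>. It is finite because \<open>u\<close> is bounded. For \<open>|h|\<close>
  comparable to \<open>|k|\<close>, apply the inequality to \<open>\<delta>\<^sub>h\<^sup>2 u / |h|\<^sup>2\<close> minus its mean over the
  translates by \<open>0, k, ..., (m - 1) k\<close>; smaller \<open>h\<close> are reached by doubling. This yields
  \<open>M \<le> N [f] + M / 2\<close>, uniformly in \<open>\<eta>\<close>. Since \<open>u\<close> is only a strong solution, everything is carried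
  out on mollifications, whose errors tend to zero in \<open>L\<^sup>d\<close> locally and are absorbed by Aleksandrov's
  maximum principle.\<close>

section \<open>An area-formula estimate\<close>

text \<open>Scaling shapes the argument: for |h| comparable to |k| the source term |k|^2 sup
  |\<open>diff2 h f\<close>| / |h|^2 is of size [f] |k|^\<delta>, but for much smaller |h| its bound
  degenerates like |h|^(\<delta> - 2), which is why small h needs the doubling. Second differences
  divided by |h|^2 are not bounded in terms of M, only their increments are; subtracting the mean
  over m translates leaves a function bounded by M (m |k|)^\<delta>. The increment of the mean
  itself telescopes to 1/m times one increment of length m |k|, hence is small because \<delta> < 1.
  So m is fixed first, then K against m^\<delta>, and separately the scale ratio \<mu> against
  2^\<delta> - 1.

  In the auxiliary function \<zeta> takes the place that Bernstein's method gives to the solution: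
  ellipticity, applied to the gradient of \<zeta> along h / |h|, returns the square of the
  difference quotient, which is the good term. Replacing the segment by Riemann nodes makes the
  error in w a finite combination of translates of the residual of z, so smallness in L^d passes
  from one to the other.\<close>

lemma emeasure_UN_le_count_space:
  assumes I: "countable I" and A: "\<And>i. i \<in> I \<Longrightarrow> A i \<in> sets M"
  shows "emeasure M (\<Union>i\<in>I. A i) \<le> (\<integral>\<^sup>+ i. emeasure M (A i) \<partial>count_space I)"
proof -
  have "(\<Union>i\<in>I. A i) \<in> sets M" using I A by (intro sets.countable_UN') auto
  then have "emeasure M (\<Union>i\<in>I. A i) = (\<integral>\<^sup>+ x. indicator (\<Union>i\<in>I. A i) x \<partial>M)" by simp
  also have "\<dots> \<le> (\<integral>\<^sup>+ x. (\<integral>\<^sup>+ i. indicator (A i) x \<partial>count_space I) \<partial>M)"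
  proof (rule nn_integral_mono)
    fix x
    show "indicator (\<Union>i\<in>I. A i) x \<le> (\<integral>\<^sup>+ i. (indicator (A i) x :: ennreal) \<partial>count_space I)"
    proof (cases "x \<in> (\<Union>i\<in>I. A i)")
      case True
      then obtain j where j: "j \<in> I" "x \<in> A j" by auto
      have "(1::ennreal) = (\<integral>\<^sup>+ i. indicator {j} i \<partial>count_space I)" using j by simp
      also have "\<dots> \<le> (\<integral>\<^sup>+ i. indicator (A i) x \<partial>count_space I)"
        using j by (intro nn_integral_mono) (auto simp: indicator_def)
      finally show ?thesis using True by simp
    qed simp
  qed
  also have "\<dots> = (\<integral>\<^sup>+ i. (\<integral>\<^sup>+ x. indicator (A i) x \<partial>M) \<partial>count_space I)"
    using I A by (intro nn_integral_count_space_nn_integral) auto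
  also have "\<dots> = (\<integral>\<^sup>+ i. emeasure M (A i) \<partial>count_space I)"
    using A by (intro nn_integral_cong) auto
  finally show ?thesis .
qed

text \<open>An area-formula estimate with a non-sharp constant. It needs no determinant, and no
  well-ordered index type as the library's change of variables does.\<close>
lemma ball_in_image_le:
  fixes g :: "'a::euclidean_space \<Rightarrow> 'a"
  assumes E: "E \<subseteq> ball x0 \<rho>" and r: "continuous_on UNIV r" and r0: "\<And>x. 0 \<le> r x"
    and s: "0 < \<sigma>"
    and loc: "\<And>x. x \<in> E \<Longrightarrow> \<exists>d>0. \<forall>y. norm (y - x) < d \<longrightarrow> norm (g y - g x) \<le> (r x + \<sigma>) * norm (y - x)"
    and im: "ball 0 t \<subseteq> g ` E" and t: "0 \<le> t"
  shows "ennreal (t ^ DIM('a)) \<le> ennreal (real DIM('a) ^ DIM('a)) *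
     (\<integral>\<^sup>+ x. ennreal ((r x + 2 * \<sigma>) ^ DIM('a)) * indicator (ball x0 \<rho>) x \<partial>lborel)"
    (is "_ \<le> _ * ?I")
proof (cases "t = 0")
  case True
  then show ?thesis by (simp add: power_0_left)
next
  case False
  let ?n = "DIM('a)"
  have "0 \<in> g ` E" using im False t by force
  then have rho: "0 < \<rho>" using E by (metis all_not_in_conv ball_eq_empty image_is_empty not_le subset_empty)
  \<comment> \<open>Three demands on one radius: the Lipschitz bound, containment in the big ball,
    and oscillation of \<open>r\<close> at most \<open>\<sigma>\<close>. The last one allows
    \<open>r x\<close> at the tag to be replaced by \<open>r y\<close> under the integral and
    accounts for the second \<open>\<sigma>\<close> in the conclusion.\<close>
  have "\<exists>d>0. (\<forall>y. norm (y - x) < d \<longrightarrow> norm (g y - g x) \<le> (r x + \<sigma>) * norm (y - x)) \<and>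
      ball x d \<subseteq> ball x0 \<rho> \<and> (\<forall>y\<in>ball x d. r x - \<sigma> \<le> r y)" if x: "x \<in> E" for x
  proof -
    obtain d1 where d1: "d1 > 0" "\<forall>y. norm (y - x) < d1 \<longrightarrow> norm (g y - g x) \<le> (r x + \<sigma>) * norm (y - x)"
      using loc[OF x] by blast
    obtain d2 where d2: "d2 > 0" "ball x d2 \<subseteq> ball x0 \<rho>"
      using x E by (meson open_ball open_contains_ball subsetD)
    obtain d3 where d3: "d3 > 0" "\<forall>y. dist y x < d3 \<longrightarrow> dist (r y) (r x) < \<sigma>"
      using r s unfolding continuous_on_iff by (metis UNIV_I)
    show ?thesis
    proof (intro exI[of _ "min d1 (min d2 d3)"] conjI)
      show "\<forall>y\<in>ball x (min d1 (min d2 d3)). r x - \<sigma> \<le> r y"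
        using d3 by (force simp: dist_real_def dist_commute)
    qed (use d1 d2 d3 in auto)
  qed
  then obtain d where d: "\<And>x. x \<in> E \<Longrightarrow> d x > 0"
      "\<And>x y. x \<in> E \<Longrightarrow> norm (y - x) < d x \<Longrightarrow> norm (g y - g x) \<le> (r x + \<sigma>) * norm (y - x)"
      "\<And>x. x \<in> E \<Longrightarrow> ball x (d x) \<subseteq> ball x0 \<rho>"
      "\<And>x y. x \<in> E \<Longrightarrow> y \<in> ball x (d x) \<Longrightarrow> r x - \<sigma> \<le> r y"
    by metis
  \<comment> \<open>A gauge needs a value at every point; the covering lemma picks its tags in
    \<open>E\<close>, so the radius 1 elsewhere is a dummy.\<close>
  define \<gamma> where "\<gamma> x = (if x \<in> E then ball x (d x) else ball x 1)" for x
  have gauge: "gauge \<gamma>" using d(1) by (auto simp: gauge_def \<gamma>_def)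
  define a b :: 'a where "a = x0 - \<rho> *\<^sub>R One" and "b = x0 + \<rho> *\<^sub>R One"
  have ba: "b \<bullet> i - a \<bullet> i = 2 * \<rho>" if "i \<in> Basis" for i
    using that by (simp add: a_def b_def inner_diff_left inner_add_left)
  have Eab: "E \<subseteq> cbox a b"
  proof
    fix x assume "x \<in> E"
    then have "norm (x - x0) < \<rho>" using E by (auto simp: dist_norm norm_minus_commute)
    then have "\<bar>(x - x0) \<bullet> i\<bar> \<le> \<rho>" if "i \<in> Basis" for i
      using Basis_le_norm[OF that, of "x - x0"] by linarith
    then show "x \<in> cbox a b"
      by (auto simp: mem_box a_def b_def inner_diff_left inner_add_left abs_le_iff algebra_simps)
  qed
  have box: "box a b \<noteq> {}" using rho by (simp add: box_ne_empty a_def b_def inner_diff_left inner_add_left)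
  obtain D where D: "countable D"
    "\<And>K. K \<in> D \<Longrightarrow> interior K \<noteq> {} \<and> (\<exists>c d. K = cbox c d)"
    "pairwise (\<lambda>A B. interior A \<inter> interior B = {}) D"
    "\<And>K. K \<in> D \<Longrightarrow> \<exists>x \<in> E \<inter> K. K \<subseteq> \<gamma> x"
    "\<And>u v. cbox u v \<in> D \<Longrightarrow> \<exists>n. \<forall>i \<in> Basis. v \<bullet> i - u \<bullet> i = (b \<bullet> i - a \<bullet> i) / 2^n"
    "E \<subseteq> \<Union>D"
    using covering_lemma[OF Eab box gauge] by metis
  \<comment> \<open>Centre, radius and all their properties are packed into one predicate, so that a
    single choice selects them for every cube.\<close>
  define Q where "Q K z p \<longleftrightarrow> 0 \<le> p \<and> g ` K \<subseteq> cball z p \<and> K \<subseteq> ball x0 \<rho> \<and>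
      ennreal (p ^ ?n) \<le> ennreal (real ?n ^ ?n) *
        (\<integral>\<^sup>+ y. ennreal ((r y + 2 * \<sigma>) ^ ?n) * indicator (interior K) y \<partial>lborel)" for K z p
  have "\<exists>z p. Q K z p"
    if K: "K \<in> D" for K
  proof -
    obtain x where x: "x \<in> E" "x \<in> K" "K \<subseteq> ball x (d x)"
      using D(4)[OF K] by (auto simp: \<gamma>_def)
    obtain u v where uv: "K = cbox u v" using D(2)[OF K] by blast
    \<comment> \<open>The starting box is a cube and the covering lemma halves all coordinates
      equally often, so each piece is a cube with one side length \<open>s\<close>.\<close>
    obtain m where m: "\<And>i. i \<in> Basis \<Longrightarrow> v \<bullet> i - u \<bullet> i = 2 * \<rho> / 2^m"
      using D(5) K uv ba by metis
    define s where "s = 2 * \<rho> / 2 ^ m"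
    have s0: "0 < s" using rho by (simp add: s_def)
    have nyx: "norm (y - x) \<le> real ?n * s" if "y \<in> K" for y
    proof -
      have "norm (y - x) \<le> (\<Sum>i\<in>Basis. \<bar>(y - x) \<bullet> i\<bar>)" by (rule norm_le_l1)
      also have "\<dots> \<le> (\<Sum>i\<in>(Basis::'a set). s)"
      proof (rule sum_mono)
        fix i :: 'a assume i: "i \<in> Basis"
        have "u \<bullet> i \<le> y \<bullet> i" "y \<bullet> i \<le> v \<bullet> i" "u \<bullet> i \<le> x \<bullet> i" "x \<bullet> i \<le> v \<bullet> i"
          using i that x(2) uv by (auto simp: mem_box)
        then show "\<bar>(y - x) \<bullet> i\<bar> \<le> s" using m[OF i] by (auto simp: inner_diff_left s_def)
      qed
      finally show ?thesis by simp
    qed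
    let ?p = "(r x + \<sigma>) * (real ?n * s)"
    have p0: "0 \<le> ?p" using r0[of x] \<open>0 < \<sigma>\<close> s0 by simp
    have "g ` K \<subseteq> cball (g x) ?p"
    proof clarify
      fix y assume y: "y \<in> K"
      then have "norm (y - x) < d x" using x(3) by (auto simp: dist_norm norm_minus_commute)
      then have "norm (g y - g x) \<le> (r x + \<sigma>) * norm (y - x)" using d(2) x(1) by blast
      also have "\<dots> \<le> ?p" using nyx[OF y] r0[of x] \<open>0 < \<sigma>\<close> by (intro mult_left_mono) auto
      finally show "g y \<in> cball (g x) ?p" by (simp add: dist_norm norm_minus_commute)
    qed
    moreover have "K \<subseteq> ball x0 \<rho>" using x d(3) by blast
    moreover have "ennreal (?p ^ ?n) \<le> ennreal (real ?n ^ ?n) *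
        (\<integral>\<^sup>+ y. ennreal ((r y + 2 * \<sigma>) ^ ?n) * indicator (interior K) y \<partial>lborel)"
    proof -
      have "emeasure lborel (interior K) = ennreal (s ^ ?n)"
      proof -
        have "emeasure lborel (box u v) = ennreal (\<Prod>i\<in>Basis. (v - u) \<bullet> i)"
        proof (rule emeasure_lborel_box)
          fix i :: 'a assume "i \<in> Basis"
          then show "u \<bullet> i \<le> v \<bullet> i" using m[of i] rho by (smt (verit) divide_nonneg_nonneg zero_le_power)
        qed
        also have "(\<Prod>i\<in>Basis. (v - u) \<bullet> i) = (\<Prod>i\<in>(Basis::'a set). s)"
          using m by (intro prod.cong) (auto simp: inner_diff_left s_def)
        finally show ?thesis by (simp add: uv)
      qed
      then have "ennreal ((r x + \<sigma>) ^ ?n) * ennreal (s ^ ?n) =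
          (\<integral>\<^sup>+ y. ennreal ((r x + \<sigma>) ^ ?n) * indicator (interior K) y \<partial>lborel)"
        by (simp add: nn_integral_cmult_indicator)
      also have "\<dots> \<le> (\<integral>\<^sup>+ y. ennreal ((r y + 2 * \<sigma>) ^ ?n) * indicator (interior K) y \<partial>lborel)"
      proof (rule nn_integral_mono)
        fix y
        show "ennreal ((r x + \<sigma>) ^ ?n) * indicator (interior K) y
            \<le> ennreal ((r y + 2 * \<sigma>) ^ ?n) * indicator (interior K) y"
        proof (cases "y \<in> interior K")
          case True
          then have "y \<in> ball x (d x)" using x(3) interior_subset by blast
          then have "r x + \<sigma> \<le> r y + 2 * \<sigma>" using d(4)[OF x(1)] by force
          then show ?thesis using r0[of x] \<open>0 < \<sigma>\<close>
            by (intro mult_right_mono ennreal_leI power_mono) auto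
        qed simp
      qed
      finally have *: "ennreal ((r x + \<sigma>) ^ ?n) * ennreal (s ^ ?n) \<le> \<dots>" .
      have "ennreal (?p ^ ?n) = ennreal (real ?n ^ ?n) * (ennreal ((r x + \<sigma>) ^ ?n) * ennreal (s ^ ?n))"
        using r0[of x] \<open>0 < \<sigma>\<close> s0 by (simp add: power_mult_distrib ennreal_mult'[symmetric] mult_ac)
      also have "\<dots> \<le> ennreal (real ?n ^ ?n) *
        (\<integral>\<^sup>+ y. ennreal ((r y + 2 * \<sigma>) ^ ?n) * indicator (interior K) y \<partial>lborel)"
        using * by (rule mult_left_mono) simp
      finally show ?thesis .
    qed
    ultimately show ?thesis using p0 unfolding Q_def by (intro exI[of _ "g x"] exI[of _ ?p] conjI)
  qed
  then obtain z p where Q: "\<And>K. K \<in> D \<Longrightarrow> Q K (z K) (p K)" by metis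
  have zp: "\<And>K. K \<in> D \<Longrightarrow> 0 \<le> p K" "\<And>K. K \<in> D \<Longrightarrow> g ` K \<subseteq> cball (z K) (p K)"
     "\<And>K. K \<in> D \<Longrightarrow> K \<subseteq> ball x0 \<rho>"
     "\<And>K. K \<in> D \<Longrightarrow> ennreal (p K ^ ?n) \<le> ennreal (real ?n ^ ?n) *
        (\<integral>\<^sup>+ y. ennreal ((r y + 2 * \<sigma>) ^ ?n) * indicator (interior K) y \<partial>lborel)"
    using Q unfolding Q_def by auto
  let ?c = "unit_ball_vol (real ?n)"
  have c0: "0 < ?c" by simp
  let ?M = "density lborel (\<lambda>y. ennreal ((r y + 2 * \<sigma>) ^ ?n))"
  have rm [measurable]: "r \<in> borel_measurable borel" using r by (rule borel_measurable_continuous_onI)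
  have M: "emeasure ?M S = (\<integral>\<^sup>+ y. ennreal ((r y + 2 * \<sigma>) ^ ?n) * indicator S y \<partial>lborel)"
    if "S \<in> sets borel" for S
    using that by (subst emeasure_density) (auto simp: rm)
  have "ball 0 t \<subseteq> (\<Union>K\<in>D. cball (z K) (p K))"
  proof
    fix y :: 'a assume "y \<in> ball 0 t"
    then obtain x where x: "x \<in> E" "y = g x" using im by auto
    then obtain K where "K \<in> D" "x \<in> K" using D(6) by auto
    then show "y \<in> (\<Union>K\<in>D. cball (z K) (p K))" using zp(2)[of K] x(2) by (intro UN_I[of K]) auto
  qed
  then have "emeasure lborel (ball (0::'a) t) \<le> emeasure lborel (\<Union>K\<in>D. cball (z K) (p K))"
    using D(1) by (intro emeasure_mono) (auto intro!: sets.countable_UN')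
  also have "\<dots> \<le> (\<integral>\<^sup>+ K. emeasure lborel (cball (z K) (p K)) \<partial>count_space D)"
    by (rule emeasure_UN_le_count_space[OF D(1)]) auto
  also have "\<dots> \<le> (\<integral>\<^sup>+ K. ennreal (?c * real ?n ^ ?n) * emeasure ?M (interior K) \<partial>count_space D)"
  proof (rule nn_integral_mono)
    fix K assume "K \<in> space (count_space D)"
    then have K: "K \<in> D" by simp
    have "emeasure lborel (cball (z K) (p K)) = ennreal ?c * ennreal (p K ^ ?n)"
      using zp(1)[OF K] c0 by (simp add: emeasure_cball ennreal_mult')
    also have "\<dots> \<le> ennreal ?c * (ennreal (real ?n ^ ?n) * emeasure ?M (interior K))"
      using zp(4)[OF K] M[of "interior K"] by (intro mult_left_mono) auto
    finally show "emeasure lborel (cball (z K) (p K)) \<le> ennreal (?c * real ?n ^ ?n) * emeasure ?M (interior K)"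
      using c0 by (simp add: ennreal_mult' mult_ac)
  qed
  also have "\<dots> = ennreal (?c * real ?n ^ ?n) * (\<integral>\<^sup>+ K. emeasure ?M (interior K) \<partial>count_space D)"
    by (simp add: nn_integral_cmult)
  \<comment> \<open>The cubes meet only along their boundaries. Interiors are disjoint, which turns
    the sum into the measure of a union.\<close>
  also have "(\<integral>\<^sup>+ K. emeasure ?M (interior K) \<partial>count_space D) = emeasure ?M (\<Union>K\<in>D. interior K)"
    using D(1,3) by (intro emeasure_UN_countable[symmetric]) (auto simp: disjoint_family_on_def pairwise_def)
  also have "\<dots> \<le> emeasure ?M (ball x0 \<rho>)"
    by (intro emeasure_mono UN_least order.trans[OF interior_subset zp(3)]) auto
  also have "\<dots> = ?I" using M by simp
  finally have "emeasure lborel (ball (0::'a) t) \<le> ennreal (?c * real ?n ^ ?n) * ?I"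
    by (simp add: mult_left_mono)
  moreover have "emeasure lborel (ball (0::'a) t) = ennreal ?c * ennreal (t ^ ?n)"
    using c0 t by (simp add: emeasure_ball ennreal_mult')
  moreover have "ennreal (?c * real ?n ^ ?n) = ennreal ?c * ennreal (real ?n ^ ?n)"
    using c0 by (simp add: ennreal_mult')
  ultimately have "ennreal ?c * ennreal (t ^ ?n) \<le> ennreal ?c * (ennreal (real ?n ^ ?n) * ?I)"
    by (simp only: mult.assoc)
  then show ?thesis
    using c0 by (subst (asm) ennreal_mult_le_mult_iff) (auto simp: ennreal_eq_0_iff not_le)
qed

section \<open>The Aleksandrov maximum principle\<close>

text \<open>Gradient and Hessian travel as explicit functions, and symmetry of the Hessian is part
  of the data. Every constructor below supplies formulas for both, so that \<open>Lop\<close> of a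
  composite function can be computed by rewriting.\<close>

definition C2_data :: "(real^'n \<Rightarrow> real) \<Rightarrow> (real^'n \<Rightarrow> real^'n) \<Rightarrow> (real^'n \<Rightarrow> real^'n^'n) \<Rightarrow> bool" where
  "C2_data u G H \<longleftrightarrow> (\<forall>x. (u has_derivative (\<lambda>v. G x \<bullet> v)) (at x)) \<and>
     (\<forall>x. (G has_derivative (\<lambda>v. H x *v v)) (at x)) \<and> continuous_on UNIV H \<and>
     (\<forall>x i j. H x $ i $ j = H x $ j $ i)"

definition nsd :: "real^'n^'n \<Rightarrow> bool" where
  "nsd A \<longleftrightarrow> (\<forall>v. v \<bullet> (A *v v) \<le> 0)"

section \<open>First and second order conditions at an interior maximum\<close>

lemma has_derivative_along_line:
  fixes u :: "real^'n \<Rightarrow> 'b::real_normed_vector"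
  assumes "\<And>x. (u has_derivative D x) (at x)"
  shows "((\<lambda>t. u (z + t *\<^sub>R v)) has_vector_derivative D (z + t *\<^sub>R v) v) (at t)"
proof -
  have "((\<lambda>t. z + t *\<^sub>R v) has_derivative (\<lambda>s. s *\<^sub>R v)) (at t)"
    by (auto intro!: derivative_eq_intros)
  from has_derivative_compose[OF this assms] show ?thesis
    unfolding has_vector_derivative_def
    using linear_scale[OF has_derivative_linear[OF assms]] by simp
qed

text \<open>This turns a slope \<open>p\<close> into a value of the gradient map at a point of
  negative semidefinite Hessian. The second-order part is one-dimensional: a positive second
  derivative along \<open>v\<close> makes the first derivative positive just to the right of 0, and
  the mean value theorem then contradicts maximality.\<close>

lemma interior_max_C2:
  assumes C2: "C2_data u G H" and z: "z \<in> S" "open S"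
    and max: "\<And>y. y \<in> S \<Longrightarrow> u y - p \<bullet> y \<le> u z - p \<bullet> z"
  shows "G z = p" "nsd (H z)"
proof -
  have du: "(u has_derivative (\<lambda>v. G x \<bullet> v)) (at x)" and dG: "(G has_derivative (\<lambda>v. H x *v v)) (at x)" for x
    using C2 by (auto simp: C2_data_def)
  have d: "((\<lambda>y. u y - p \<bullet> y) has_derivative (\<lambda>v. (G x - p) \<bullet> v)) (at x)" for x
    by (auto intro!: derivative_eq_intros du simp: inner_diff_left)
  have "(\<lambda>v. (G z - p) \<bullet> v) = (\<lambda>v. 0)"
    using differential_zero_maxmin[OF z d] max by blast
  then show Gz: "G z = p" by (metis eq_iff_diff_eq_0 inner_eq_zero_iff)
  show "nsd (H z)" unfolding nsd_def
  proof (rule allI, rule ccontr)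
    fix v assume "\<not> v \<bullet> (H z *v v) \<le> 0"
    then have pos: "0 < (H z *v v) \<bullet> v" by (simp add: inner_commute)
    define \<phi> where "\<phi> t = (G (z + t *\<^sub>R v) - p) \<bullet> v" for t
    define \<psi> where "\<psi> t = u (z + t *\<^sub>R v) - p \<bullet> (z + t *\<^sub>R v)" for t
    have "((\<lambda>y. (G y - p) \<bullet> v) has_derivative (\<lambda>w. (H x *v w) \<bullet> v)) (at x)" for x
      by (auto intro!: derivative_eq_intros dG)
    from has_derivative_along_line[OF this, of z v 0]
    have "DERIV \<phi> 0 :> (H z *v v) \<bullet> v"
      by (simp add: \<phi>_def[abs_def] has_real_derivative_iff_has_vector_derivative)
    from DERIV_pos_inc_right[OF this pos] obtain d where
      d0: "d > 0" and phi: "\<And>h. 0 < h \<Longrightarrow> h < d \<Longrightarrow> 0 < \<phi> h"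
      by (auto simp: \<phi>_def Gz)
    have psi: "DERIV \<psi> t :> \<phi> t" for t
      using has_derivative_along_line[OF d, of z v t]
      by (simp add: \<phi>_def \<psi>_def[abs_def] has_real_derivative_iff_has_vector_derivative)
    obtain e where e: "e > 0" "ball z e \<subseteq> S" using z open_contains_ball by blast
    define t where "t = min (d/2) (e / (2 * (norm v + 1)))"
    have t: "0 < t" "t < d" using d0 e by (auto simp: t_def intro!: divide_pos_pos add_nonneg_pos)
    have nz: "0 < norm v + 1" using norm_ge_zero[of v] by linarith
    have "t * norm v \<le> e / (2 * (norm v + 1)) * (norm v + 1)"
      using t e nz by (intro mult_mono) (auto simp: t_def)
    also have "\<dots> = e / 2" using nz by (simp add: field_simps)
    also have "\<dots> < e" using e by simp
    finally have "z + t *\<^sub>R v \<in> S" using e t by (auto simp: dist_norm intro!: subsetD[OF e(2)])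
    then have "\<psi> t \<le> \<psi> 0" using max by (simp add: \<psi>_def)
    moreover obtain c where "0 < c" "c < t" "\<psi> t - \<psi> 0 = (t - 0) * \<phi> c"
      using MVT2[OF t(1), of \<psi> \<phi>] psi by blast
    ultimately show False using phi[of c] t by (smt (verit) mult_pos_pos)
  qed
qed

text \<open>Testing with e_i + e_j and e_i - e_j bounds twice an off-diagonal entry by two diagonal
  ones, and no diagonal entry exceeds the trace in size because they all have the same sign.\<close>

lemma nsd_entry_bound:
  fixes A :: "real^'n^'n"
  assumes A: "nsd A" and sym: "\<And>i j. A $ i $ j = A $ j $ i"
  shows "\<bar>A $ i $ j\<bar> \<le> - trace A" "0 \<le> - trace A"
proof -
  have q: "v \<bullet> (A *v v) \<le> 0" for v using A by (simp add: nsd_def)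
  have diag: "A $ k $ k \<le> 0" for k
    using q[of "axis k 1"] by (simp add: inner_axis' matrix_vector_mul_component inner_axis)
  have le: "- (A $ k $ k) \<le> - trace A" for k
  proof -
    have "(\<Sum>l\<in>{k}. - (A $ l $ l)) \<le> (\<Sum>l\<in>UNIV. - (A $ l $ l))"
      by (rule sum_mono2) (use diag in auto)
    then show ?thesis by (simp add: trace_def sum_negf)
  qed
  show "0 \<le> - trace A" using le[of undefined] diag[of undefined] by linarith
  have q2: "(axis i 1 + c *\<^sub>R axis j 1) \<bullet> (A *v (axis i 1 + c *\<^sub>R axis j 1)) =
      A $ i $ i + c * A $ i $ j + c * A $ j $ i + c * c * A $ j $ j" for c
    by (simp add: matrix_vector_right_distrib matrix_vector_mult_scaleR inner_add_left inner_add_right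
      inner_axis' matrix_vector_mul_component inner_axis algebra_simps)
  from q[of "axis i 1 + 1 *\<^sub>R axis j 1"] q[of "axis i 1 + (-1) *\<^sub>R axis j 1"]
  have "A $ i $ i + 2 * A $ i $ j + A $ j $ j \<le> 0" "A $ i $ i - 2 * A $ i $ j + A $ j $ j \<le> 0"
    unfolding q2 using sym[of i j] by auto
  then show "\<bar>A $ i $ j\<bar> \<le> - trace A" using le[of i] le[of j] by linarith
qed

text \<open>Stands in for the determinant of the usual argument: on the contact set the gradient map
  is locally Lipschitz with a constant controlled by the trace alone.\<close>

lemma nsd_norm_bound:
  fixes A :: "real^'n^'n"
  assumes A: "nsd A" and sym: "\<And>i j. A $ i $ j = A $ j $ i"
  shows "norm (A *v v) \<le> real CARD('n) ^ 2 * (- trace A) * norm v"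
proof -
  have "norm (A *v v) \<le> (\<Sum>i\<in>UNIV. \<bar>(A *v v) $ i\<bar>)" by (rule norm_le_l1_cart)
  also have "\<dots> \<le> (\<Sum>i\<in>(UNIV::'n set). \<Sum>j\<in>(UNIV::'n set). (- trace A) * norm v)"
  proof (rule sum_mono)
    fix i :: 'n
    have "\<bar>(A *v v) $ i\<bar> \<le> (\<Sum>j\<in>UNIV. \<bar>A $ i $ j * v $ j\<bar>)"
      by (simp add: matrix_vector_mult_def sum_abs)
    also have "\<dots> \<le> (\<Sum>j\<in>(UNIV::'n set). (- trace A) * norm v)"
    proof (rule sum_mono)
      fix j :: 'n
      show "\<bar>A $ i $ j * v $ j\<bar> \<le> (- trace A) * norm v"
        unfolding abs_mult using nsd_entry_bound[OF A sym] component_le_norm_cart[of v j]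
        by (intro mult_mono) auto
    qed
    finally show "\<bar>(A *v v) $ i\<bar> \<le> (\<Sum>j\<in>(UNIV::'n set). (- trace A) * norm v)" .
  qed
  also have "\<dots> = real CARD('n) ^ 2 * (- trace A) * norm v"
    by (simp add: power2_eq_square mult_ac)
  finally show ?thesis .
qed

text \<open>Every slope \<open>p\<close> shorter than u(x1) / (2 \<rho>) is a gradient at a contact
  point: since p.y varies by less than u(x1) across the ball, u is positive where u - p.y attains
  its maximum over the closed ball, so that point is interior. The gradient image of the contact set
  therefore contains a ball, whose radius the area estimate controls.\<close>

lemma ABP_aux:
  fixes u :: "real^'n \<Rightarrow> real"
  assumes C2: "C2_data u G H" and rho: "0 < \<rho>" and bd: "\<And>x. dist x0 x = \<rho> \<Longrightarrow> u x \<le> 0"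
    and r: "continuous_on UNIV r" and r0: "\<And>x. 0 \<le> r x"
    and le: "\<And>x. dist x0 x < \<rho> \<Longrightarrow> 0 < u x \<Longrightarrow> nsd (H x) \<Longrightarrow> - trace (H x) \<le> r x"
    and x1: "dist x0 x1 < \<rho>" and u1: "0 \<le> u x1" and s: "0 < \<sigma>"
  shows "ennreal ((u x1 / (2 * \<rho>)) ^ CARD('n)) \<le> ennreal (real CARD('n) ^ CARD('n)) *
     (\<integral>\<^sup>+ x. ennreal ((real CARD('n) ^ 2 * r x + 2 * \<sigma>) ^ CARD('n)) * indicator (ball x0 \<rho>) x \<partial>lborel)"
proof -
  let ?t = "u x1 / (2 * \<rho>)"
  define E where "E = {x \<in> ball x0 \<rho>. 0 < u x \<and> nsd (H x)}"
  have du: "(u has_derivative (\<lambda>v. G x \<bullet> v)) (at x)" and dG: "(G has_derivative (\<lambda>v. H x *v v)) (at x)"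
    and sym: "H x $ i $ j = H x $ j $ i" for x i j
    using C2 by (auto simp: C2_data_def)
  have cu: "continuous_on UNIV u" using du by (meson continuous_at_imp_continuous_on has_derivative_continuous)
  have im: "ball 0 ?t \<subseteq> G ` E"
  proof
    fix p :: "real^'n" assume "p \<in> ball 0 ?t"
    then have p: "norm p < ?t" by simp
    have "continuous_on (cball x0 \<rho>) (\<lambda>y. u y - p \<bullet> y)"
      by (intro continuous_intros continuous_on_subset[OF cu]) auto
    then obtain z where z: "z \<in> cball x0 \<rho>" "\<And>y. y \<in> cball x0 \<rho> \<Longrightarrow> u y - p \<bullet> y \<le> u z - p \<bullet> z"
      using continuous_attains_sup[of "cball x0 \<rho>" "\<lambda>y. u y - p \<bullet> y"] rho by auto
    have "u x1 - p \<bullet> x1 \<le> u z - p \<bullet> z" using z(2)[of x1] x1 by simp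
    then have 1: "u x1 \<le> u z - p \<bullet> (z - x1)" by (simp add: inner_diff_right)
    have "\<bar>p \<bullet> (z - x1)\<bar> \<le> norm p * norm (z - x1)" by (rule Cauchy_Schwarz_ineq2)
    also have "norm (z - x1) \<le> 2 * \<rho>"
      using z(1) x1 by (metis (no_types, lifting) add_mono dist_commute dist_norm dist_triangle_le less_imp_le mem_cball mult_2)
    then have "norm p * norm (z - x1) \<le> norm p * (2 * \<rho>)" by (simp add: mult_left_mono)
    also have "\<dots> < u x1" using p rho by (simp add: field_simps)
    finally have uz: "0 < u z" using 1 by linarith
    then have zb: "z \<in> ball x0 \<rho>" using z(1) bd[of z] by (force simp: le_less)
    have "G z = p" "nsd (H z)"
      using interior_max_C2[OF C2 zb open_ball, of p] z(2) by auto
    then show "p \<in> G ` E" using uz zb by (auto simp: E_def)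
  qed
  have loc: "\<exists>d>0. \<forall>y. norm (y - x) < d \<longrightarrow>
      norm (G y - G x) \<le> (real CARD('n) ^ 2 * r x + \<sigma>) * norm (y - x)" if x: "x \<in> E" for x
  proof -
    obtain d where d: "d > 0" "\<And>y. norm (y - x) < d \<Longrightarrow> norm (G y - G x - H x *v (y - x)) \<le> \<sigma> * norm (y - x)"
      using dG[of x] s unfolding has_derivative_at_alt by blast
    show ?thesis
    proof (intro exI[of _ d] conjI allI impI)
      fix y assume "norm (y - x) < d"
      then have "norm (G y - G x) \<le> norm (H x *v (y - x)) + \<sigma> * norm (y - x)"
        using d(2)[of y] norm_triangle_ineq[of "G y - G x - H x *v (y - x)" "H x *v (y - x)"] by simp
      also have "norm (H x *v (y - x)) \<le> real CARD('n) ^ 2 * (- trace (H x)) * norm (y - x)"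
        using x by (intro nsd_norm_bound sym) (auto simp: E_def)
      also have "\<dots> \<le> real CARD('n) ^ 2 * r x * norm (y - x)"
        using x le[of x] by (intro mult_right_mono mult_left_mono) (auto simp: E_def)
      finally show "norm (G y - G x) \<le> (real CARD('n) ^ 2 * r x + \<sigma>) * norm (y - x)"
        by (simp add: algebra_simps)
    qed (use d in auto)
  qed
  have "ennreal (?t ^ DIM(real^'n)) \<le> ennreal (real DIM(real^'n) ^ DIM(real^'n)) *
     (\<integral>\<^sup>+ x. ennreal ((real CARD('n) ^ 2 * r x + 2 * \<sigma>) ^ DIM(real^'n)) * indicator (ball x0 \<rho>) x \<partial>lborel)"
  proof (rule ball_in_image_le[OF _ _ _ s loc im])
    show "E \<subseteq> ball x0 \<rho>" by (auto simp: E_def)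
    show "continuous_on UNIV (\<lambda>x. real CARD('n) ^ 2 * r x)" using r by (intro continuous_intros)
    show "0 \<le> real CARD('n) ^ 2 * r x" for x using r0 by simp
    show "0 \<le> ?t" using u1 rho by simp
  qed
  then show ?thesis by simp
qed

lemma add_power_le:
  fixes a b :: real
  assumes "0 \<le> a" "0 \<le> b"
  shows "(a + b) ^ n \<le> 2 ^ n * (a ^ n + b ^ n)"
proof -
  have "(a + b) ^ n \<le> (2 * max a b) ^ n" using assms by (intro power_mono) auto
  also have "\<dots> = 2 ^ n * (max a b) ^ n" by (simp add: power_mult_distrib)
  also have "(max a b) ^ n \<le> a ^ n + b ^ n" using assms by (cases "a \<le> b") (auto simp: max_def)
  finally show ?thesis by simp
qed

text \<open>The factors of the proof: 2 from the diameter 2 \<rho> (the power of \<rho> is kept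
  apart), n^n from the area estimate, (n^2)^n from \<open>nsd_norm_bound\<close>, and 2^n from
  separating the main term from the vanishing slack \<open>\<sigma>\<close>.\<close>

definition ABP_const :: "nat \<Rightarrow> real" where
  "ABP_const n = (2 * real n) ^ n * (2 ^ n * (real n ^ 2) ^ n)"

lemma ABP_const_nonneg: "0 \<le> ABP_const n"
  by (simp add: ABP_const_def)

lemma ABP:
  fixes u :: "real^'n \<Rightarrow> real"
  assumes C2: "C2_data u G H" and rho: "0 < \<rho>" and bd: "\<And>x. dist x0 x = \<rho> \<Longrightarrow> u x \<le> 0"
    and r: "continuous_on UNIV r" and r0: "\<And>x. 0 \<le> r x"
    and le: "\<And>x. dist x0 x < \<rho> \<Longrightarrow> 0 < u x \<Longrightarrow> nsd (H x) \<Longrightarrow> - trace (H x) \<le> r x"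
    and x1: "dist x0 x1 < \<rho>" and u1: "0 \<le> u x1"
  shows "ennreal (u x1 ^ CARD('n)) \<le> ennreal (ABP_const CARD('n) * \<rho> ^ CARD('n)) *
     (\<integral>\<^sup>+ x. ennreal (r x ^ CARD('n)) * indicator (ball x0 \<rho>) x \<partial>lborel)"
proof -
  let ?n = "CARD('n)"
  define C where C0: "C = ABP_const ?n"
  have C_def: "C = (2 * real ?n) ^ ?n * (2 ^ ?n * (real ?n ^ 2) ^ ?n)" by (simp only: C0 ABP_const_def)
  let ?I = "\<integral>\<^sup>+ x. ennreal (r x ^ ?n) * indicator (ball x0 \<rho>) x \<partial>lborel"
  have [measurable]: "r \<in> borel_measurable borel" using r by (rule borel_measurable_continuous_onI)
  have m1: "(\<lambda>x. ennreal (r x ^ ?n) * indicator (ball x0 \<rho>) x) \<in> borel_measurable lborel"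
  proof -
    have "(\<lambda>x. ennreal (r x ^ ?n)) \<in> borel_measurable lborel" by measurable
    then show ?thesis by (intro borel_measurable_times_ennreal borel_measurable_indicator) auto
  qed
  have m2: "(\<lambda>x. c * indicator (ball x0 \<rho>) x) \<in> borel_measurable lborel" for c :: ennreal
    by (intro borel_measurable_times_ennreal borel_measurable_indicator) auto
  have "ennreal (u x1 ^ ?n) \<le> ennreal (C * \<rho> ^ ?n) * ?I"
  proof (cases "?I = \<infinity>")
    case True
    then show ?thesis using rho by (simp add: C_def ennreal_mult_top ennreal_top_mult)
  next
    case False
    then obtain I where I: "?I = ennreal I" "0 \<le> I" by (cases ?I) auto
    define V where "V = measure lborel (ball x0 \<rho>)"
    have V: "emeasure lborel (ball x0 \<rho>) = ennreal V" unfolding V_def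
      by (intro emeasure_eq_ennreal_measure) (use emeasure_lborel_ball_finite[of x0 \<rho>] in auto)
    have V0: "0 \<le> V" by (simp add: V_def)
    have "u x1 ^ ?n \<le> C * \<rho> ^ ?n * I + \<epsilon>" if "\<epsilon> > 0" for \<epsilon>
    proof -
      \<comment> \<open>The coefficient of the error: as \<open>2 * \<sigma> \<le> 1\<close>, the
        n-th power of \<open>2 * \<sigma>\<close> is at most \<open>2 * \<sigma>\<close>, so the
        error is at most \<open>W\<close> times that.\<close>
      define W where "W = (2 * \<rho>) ^ ?n * real ?n ^ ?n * (2 ^ ?n * V)"
      have W0: "0 \<le> W" using rho V0 by (simp add: W_def)
      define \<sigma> where "\<sigma> = min 1 (\<epsilon> / (W + 1)) / 2"
      have s: "0 < \<sigma>" "2 * \<sigma> \<le> 1" "2 * \<sigma> \<le> \<epsilon> / (W + 1)" using that W0 by (auto simp: \<sigma>_def)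
      have "ennreal ((u x1 / (2 * \<rho>)) ^ ?n) \<le> ennreal (real ?n ^ ?n) *
        (\<integral>\<^sup>+ x. ennreal ((real ?n ^ 2 * r x + 2 * \<sigma>) ^ ?n) * indicator (ball x0 \<rho>) x \<partial>lborel)"
        by (rule ABP_aux[OF C2 rho _ r _ _ x1 u1 s(1)]) (use bd r0 le in auto)
      also have "(\<integral>\<^sup>+ x. ennreal ((real ?n ^ 2 * r x + 2 * \<sigma>) ^ ?n) * indicator (ball x0 \<rho>) x \<partial>lborel)
         \<le> (\<integral>\<^sup>+ x. ennreal (2 ^ ?n * (real ?n ^ 2) ^ ?n) * (ennreal (r x ^ ?n) * indicator (ball x0 \<rho>) x)
              + ennreal (2 ^ ?n * (2 * \<sigma>)) * indicator (ball x0 \<rho>) x \<partial>lborel)"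
      proof (rule nn_integral_mono)
        fix x
        have "(real ?n ^ 2 * r x + 2 * \<sigma>) ^ ?n \<le> 2 ^ ?n * ((real ?n ^ 2 * r x) ^ ?n + (2 * \<sigma>) ^ ?n)"
          using r0 s by (intro add_power_le) auto
        also have "(2 * \<sigma>) ^ ?n \<le> 2 * \<sigma>" using s power_decreasing[of 1 ?n "2 * \<sigma>"] by simp
        finally have "(real ?n ^ 2 * r x + 2 * \<sigma>) ^ ?n \<le> 2 ^ ?n * (real ?n ^ 2) ^ ?n * r x ^ ?n + 2 ^ ?n * (2 * \<sigma>)"
          by (simp add: power_mult_distrib algebra_simps)
        then have "ennreal ((real ?n ^ 2 * r x + 2 * \<sigma>) ^ ?n) \<le>
            ennreal (2 ^ ?n * (real ?n ^ 2) ^ ?n * r x ^ ?n + 2 ^ ?n * (2 * \<sigma>))" by (rule ennreal_leI)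
        also have "\<dots> = ennreal (2 ^ ?n * (real ?n ^ 2) ^ ?n) * ennreal (r x ^ ?n) + ennreal (2 ^ ?n * (2 * \<sigma>))"
          using r0 s by (subst ennreal_mult[symmetric]) (auto simp: ennreal_plus[symmetric] simp del: ennreal_plus)
        finally show "ennreal ((real ?n ^ 2 * r x + 2 * \<sigma>) ^ ?n) * indicator (ball x0 \<rho>) x \<le>
            ennreal (2 ^ ?n * (real ?n ^ 2) ^ ?n) * (ennreal (r x ^ ?n) * indicator (ball x0 \<rho>) x)
              + ennreal (2 ^ ?n * (2 * \<sigma>)) * indicator (ball x0 \<rho>) x"
          by (auto simp: indicator_def)
      qed
      also have "\<dots> = ennreal (2 ^ ?n * (real ?n ^ 2) ^ ?n) * ?I + ennreal (2 ^ ?n * (2 * \<sigma>)) * ennreal V"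
        using m1 m2 V by (simp add: nn_integral_add nn_integral_cmult nn_integral_cmult_indicator)
      also have "\<dots> = ennreal (2 ^ ?n * (real ?n ^ 2) ^ ?n * I + 2 ^ ?n * (2 * \<sigma>) * V)"
        using I V0 s by (simp add: ennreal_mult)
      finally have le1: "ennreal ((u x1 / (2 * \<rho>)) ^ ?n) \<le> ennreal (real ?n ^ ?n) * ennreal (2 ^ ?n * (real ?n ^ 2) ^ ?n * I + 2 ^ ?n * (2 * \<sigma>) * V)"
        by (simp add: mult_left_mono)
      have "ennreal (real ?n ^ ?n) * ennreal (2 ^ ?n * (real ?n ^ 2) ^ ?n * I + 2 ^ ?n * (2 * \<sigma>) * V) = ennreal (real ?n ^ ?n * (2 ^ ?n * (real ?n ^ 2) ^ ?n * I + 2 ^ ?n * (2 * \<sigma>) * V))"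
        using I V0 s by (intro ennreal_mult[symmetric]) simp_all
      with le1 have "ennreal ((u x1 / (2 * \<rho>)) ^ ?n) \<le> ennreal (real ?n ^ ?n * (2 ^ ?n * (real ?n ^ 2) ^ ?n * I + 2 ^ ?n * (2 * \<sigma>) * V))"
        by (simp only:)
      then have "(u x1 / (2 * \<rho>)) ^ ?n \<le> real ?n ^ ?n * (2 ^ ?n * (real ?n ^ 2) ^ ?n * I + 2 ^ ?n * (2 * \<sigma>) * V)"
        by (rule iffD1[OF ennreal_le_iff, rotated]) (use I V0 s in simp)
      then have "(2 * \<rho>) ^ ?n * (u x1 / (2 * \<rho>)) ^ ?n \<le>
          (2 * \<rho>) ^ ?n * (real ?n ^ ?n * (2 ^ ?n * (real ?n ^ 2) ^ ?n * I + 2 ^ ?n * (2 * \<sigma>) * V))"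
        using rho by (intro mult_left_mono) auto
      moreover have "(2 * \<rho>) ^ ?n * (u x1 / (2 * \<rho>)) ^ ?n = u x1 ^ ?n"
        using rho by (subst power_mult_distrib[symmetric]) simp
      moreover have "(2 * \<rho>) ^ ?n * (real ?n ^ ?n * (2 ^ ?n * (real ?n ^ 2) ^ ?n * I + 2 ^ ?n * (2 * \<sigma>) * V))
          = C * \<rho> ^ ?n * I + W * (2 * \<sigma>)"
      proof -
        have gen: "P * (N * (M * I + T * (2 * s) * V)) = P * N * M * I + P * N * (T * V) * (2 * s)"
          for P N M T s :: real by (simp add: algebra_simps)
        have e: "(2 * real ?n) ^ ?n * \<rho> ^ ?n = (2 * \<rho>) ^ ?n * real ?n ^ ?n"
          by (simp add: power_mult_distrib)
        have "C * \<rho> ^ ?n * I = ((2 * real ?n) ^ ?n * \<rho> ^ ?n) * (2 ^ ?n * (real ?n ^ 2) ^ ?n) * I"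
          unfolding C_def by (simp only: mult_ac)
        then show ?thesis unfolding gen W_def e by (simp only:)
      qed
      moreover have "W * (2 * \<sigma>) \<le> \<epsilon>"
      proof -
        have "W * (2 * \<sigma>) \<le> (W + 1) * (\<epsilon> / (W + 1))" using s W0 by (intro mult_mono) auto
        then show ?thesis using W0 by simp
      qed
      ultimately show ?thesis by linarith
    qed
    then have "u x1 ^ ?n \<le> C * \<rho> ^ ?n * I" by (rule field_le_epsilon)
    then show ?thesis using I rho
      by (simp add: ennreal_mult[symmetric] ennreal_leI C_def)
  qed
  then show ?thesis unfolding C0 .
qed

section \<open>Algebra of second derivatives\<close>

lemma quadratic_form_add_axis:
  fixes M :: "'n::finite \<Rightarrow> 'n \<Rightarrow> real"
  assumes "\<And>i j. M i j = M j i"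
  shows "(\<Sum>i\<in>UNIV. \<Sum>j\<in>UNIV. M i j * (v i + t * of_bool (i = k)) * (v j + t * of_bool (j = k))) =
     (\<Sum>i\<in>UNIV. \<Sum>j\<in>UNIV. M i j * v i * v j) + 2 * t * (\<Sum>j\<in>UNIV. M k j * v j) + t * t * M k k"
proof -
  have d: "(\<Sum>i\<in>UNIV. f i * of_bool (i = k)) = f k" for f :: "'n \<Rightarrow> real"
    by (simp add: of_bool_def if_distrib cong: if_cong)
  have dd: "(\<Sum>j\<in>UNIV. c * (c' * (f j * of_bool (j = k)))) = c * (c' * f k)" for c c' and f :: "'n \<Rightarrow> real"
    by (simp add: sum_distrib_left[symmetric] d)
  have "(\<Sum>i\<in>UNIV. \<Sum>j\<in>UNIV. M i j * (v i + t * of_bool (i = k)) * (v j + t * of_bool (j = k))) =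
    (\<Sum>i\<in>UNIV. (\<Sum>j\<in>UNIV. M i j * v i * v j) + t * ((\<Sum>j\<in>UNIV. M i j * v j) * of_bool (i = k))
      + (t * v i) * (\<Sum>j\<in>UNIV. M i j * of_bool (j = k)) + t * t * ((\<Sum>j\<in>UNIV. M i j * of_bool (j = k)) * of_bool (i = k)))"
    by (intro sum.cong) (auto simp: algebra_simps sum.distrib sum_distrib_left dd)
  also have "\<dots> = (\<Sum>i\<in>UNIV. \<Sum>j\<in>UNIV. M i j * v i * v j) + t * (\<Sum>j\<in>UNIV. M k j * v j)
      + t * (\<Sum>i\<in>UNIV. M i k * v i) + t * t * M k k"
    by (simp add: sum.distrib d sum_distrib_left[symmetric] mult.assoc mult.commute)
      (simp add: sum_distrib_left mult_ac)
  also have "(\<Sum>i\<in>UNIV. M i k * v i) = (\<Sum>j\<in>UNIV. M k j * v j)"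
    using assms by simp
  finally show ?thesis by simp
qed

text \<open>Gaussian elimination on \<open>M\<close>, one index of the support at a time. The
  rank-one part built from row k, divided by the pivot \<open>M k k\<close>, pairs with
  \<open>b\<close> to a value of the form \<open>b\<close>; the Schur complement that remains is
  again positive semidefinite. A vanishing pivot forces its whole row to vanish.\<close>

lemma psd_product_trace:
  fixes b M :: "'n::finite \<Rightarrow> 'n \<Rightarrow> real"
  assumes b: "\<And>v. 0 \<le> (\<Sum>i\<in>UNIV. \<Sum>j\<in>UNIV. b i j * v i * v j)"
    and "finite S" "\<And>i j. M i j = M j i" "\<And>i j. i \<notin> S \<Longrightarrow> M i j = 0"
    and "\<And>v. 0 \<le> (\<Sum>i\<in>UNIV. \<Sum>j\<in>UNIV. M i j * v i * v j)"
  shows "0 \<le> (\<Sum>i\<in>UNIV. \<Sum>j\<in>UNIV. b i j * M i j)"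
  using assms(2-)
proof (induction S arbitrary: M rule: finite_induct)
  case empty
  then show ?case by simp
next
  case (insert k S M)
  note sym = insert.prems(1) and supp = insert.prems(2) and psd = insert.prems(3)
  have q: "0 \<le> (\<Sum>i\<in>UNIV. \<Sum>j\<in>UNIV. M i j * v i * v j) + 2 * t * (\<Sum>j\<in>UNIV. M k j * v j) + t * t * M k k" for v t
    using psd[of "\<lambda>i. v i + t * of_bool (i = k)"] quadratic_form_add_axis[where M = M and v = v and t = t and k = k, OF sym] by simp
  have kk: "0 \<le> M k k" using q[of "\<lambda>_. 0" 1] by simp
  show ?case
  proof (cases "M k k = 0")
    case True
    have "M k j = 0" for j
    proof (rule ccontr)
      assume nz: "M k j \<noteq> 0"
      let ?v = "\<lambda>i. of_bool (i = j) :: real"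
      have lin: "(\<Sum>l\<in>UNIV. M k l * ?v l) = M k j"
        by (simp add: of_bool_def if_distrib cong: if_cong)
      define c where "c = (\<Sum>i\<in>UNIV. \<Sum>l\<in>UNIV. M i l * ?v i * ?v l)"
      \<comment> \<open>With a zero pivot the form is affine in t, and this t gives it the value
        -1.\<close>
      have "0 \<le> c + 2 * (- (c + 1) / (2 * M k j)) * M k j"
        using q[of ?v "- (c + 1) / (2 * M k j)"] True unfolding lin c_def[symmetric] by simp
      then show False using nz by (simp add: field_simps)
    qed
    then have "M i j = 0" if "i \<notin> S" for i j using supp that by (cases "i = k") auto
    then show ?thesis using insert.IH sym psd by blast
  next
    case False
    then have pos: "0 < M k k" using kk by simp
    define M' where "M' i j = M i j - M k i * M k j / M k k" for i j
    have "0 \<le> (\<Sum>i\<in>UNIV. \<Sum>j\<in>UNIV. b i j * M' i j)"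
    proof (rule insert.IH)
      show "M' i j = M' j i" for i j using sym[of i j] by (simp add: M'_def)
      show "M' i j = 0" if "i \<notin> S" for i j
      proof (cases "i = k")
        case True then show ?thesis using pos by (simp add: M'_def)
      next
        case False
        then have "M i j = 0" "M k i = 0" using supp[of i] that sym[of k i] by auto
        then show ?thesis by (simp add: M'_def)
      qed
      fix v
      let ?s = "\<Sum>j\<in>UNIV. M k j * v j"
      have "(\<Sum>i\<in>UNIV. \<Sum>j\<in>UNIV. M' i j * v i * v j) =
          (\<Sum>i\<in>UNIV. \<Sum>j\<in>UNIV. M i j * v i * v j) - (\<Sum>i\<in>UNIV. \<Sum>j\<in>UNIV. (M k i * v i) * (M k j * v j)) / M k k"
        by (simp add: M'_def sum_subtractf[symmetric] sum_divide_distrib algebra_simps)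
      also have "(\<Sum>i\<in>UNIV. \<Sum>j\<in>UNIV. (M k i * v i) * (M k j * v j)) = ?s * ?s"
        by (simp add: sum_product)
      \<comment> \<open>t = - ?s / M k k minimises the quadratic in t; the minimum is the value of
        the Schur complement.\<close>
      also have "(\<Sum>i\<in>UNIV. \<Sum>j\<in>UNIV. M i j * v i * v j) - ?s * ?s / M k k =
          (\<Sum>i\<in>UNIV. \<Sum>j\<in>UNIV. M i j * v i * v j) + 2 * (- ?s / M k k) * ?s + (- ?s / M k k) * (- ?s / M k k) * M k k"
        using pos by (simp add: field_simps)
      finally show "0 \<le> (\<Sum>i\<in>UNIV. \<Sum>j\<in>UNIV. M' i j * v i * v j)"
        using q[of v "- ?s / M k k"] by simp
    qed
    also have "(\<Sum>i\<in>UNIV. \<Sum>j\<in>UNIV. b i j * M' i j) = (\<Sum>i\<in>UNIV. \<Sum>j\<in>UNIV. b i j * M i j)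
         - (\<Sum>i\<in>UNIV. \<Sum>j\<in>UNIV. b i j * M k i * M k j) / M k k"
      by (simp add: M'_def sum_subtractf[symmetric] sum_divide_distrib algebra_simps)
    finally show ?thesis using b[of "M k"] pos by (smt (verit) divide_nonneg_pos)
  qed
qed

text \<open>The operator takes a matrix instead of a function. It is then linear by plain algebra
  and also applies to matrices that are no Hessians, such as the outer products that a product rule
  creates.\<close>

definition Lop :: "('n \<Rightarrow> 'n \<Rightarrow> real^'n \<Rightarrow> real) \<Rightarrow> real^'n^'n \<Rightarrow> real^'n \<Rightarrow> real" where
  "Lop a A x = (\<Sum>i\<in>UNIV. \<Sum>j\<in>UNIV. a i j x * A $ i $ j)"

definition outer :: "real^'n \<Rightarrow> real^'n \<Rightarrow> real^'n^'n" where
  "outer p q = (\<chi> i j. p $ i * q $ j)"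

lemma Lop_add: "Lop a (A + B) x = Lop a A x + Lop a B x"
  and Lop_diff: "Lop a (A - B) x = Lop a A x - Lop a B x"
  and Lop_scaleR: "Lop a (c *\<^sub>R A) x = c * Lop a A x"
  by (simp_all add: Lop_def sum.distrib sum_subtractf sum_distrib_left algebra_simps)

lemma Lop_zero: "Lop a 0 x = 0"
  by (simp add: Lop_def)

lemma Lop_sum: "Lop a (\<Sum>j\<in>I. A j) x = (\<Sum>j\<in>I. Lop a (A j) x)"
  by (induction I rule: infinite_finite_induct) (simp_all add: Lop_add Lop_zero)

lemma Lop_outer: "Lop a (outer p p) x = (\<Sum>i\<in>UNIV. \<Sum>j\<in>UNIV. a i j x * p $ i * p $ j)"
  by (simp add: Lop_def outer_def mult_ac)

lemma Lop_mat: "Lop a (mat 1) x = (\<Sum>i\<in>UNIV. a i i x)"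
  by (simp add: Lop_def mat_def if_distrib cong: if_cong)

lemma outer_mult_vec: "outer p q *v v = (q \<bullet> v) *\<^sub>R p"
  by (simp add: vec_eq_iff matrix_vector_mult_def outer_def inner_vec_def sum_distrib_left sum_distrib_right mult_ac)

section \<open>Calculus of gradient and Hessian data\<close>

lemma C2_dataI:
  assumes "\<And>x. (u has_derivative (\<lambda>v. G x \<bullet> v)) (at x)" "\<And>x. (G has_derivative (\<lambda>v. H x *v v)) (at x)"
    "continuous_on UNIV H" "\<And>x i j. H x $ i $ j = H x $ j $ i"
  shows "C2_data u G H"
  using assms by (simp add: C2_data_def)

lemma C2_dataD:
  assumes "C2_data u G H"
  shows "(u has_derivative (\<lambda>v. G x \<bullet> v)) (at x)" "(G has_derivative (\<lambda>v. H x *v v)) (at x)"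
    "continuous_on S H" "H x $ i $ j = H x $ j $ i" "continuous_on S u" "continuous_on S G"
proof -
  show 1: "(u has_derivative (\<lambda>v. G x \<bullet> v)) (at x)" "(G has_derivative (\<lambda>v. H x *v v)) (at x)" for x
    using assms by (auto simp: C2_data_def)
  show "continuous_on S H" "H x $ i $ j = H x $ j $ i"
    using assms by (auto simp: C2_data_def intro: continuous_on_subset)
  show "continuous_on S u" "continuous_on S G"
    using 1 by (meson continuous_at_imp_continuous_on has_derivative_continuous)+
qed

lemma continuous_on_outer [continuous_intros]:
  fixes p q :: "'a::topological_space \<Rightarrow> real^'n"
  assumes "continuous_on S p" "continuous_on S q"
  shows "continuous_on S (\<lambda>x. outer (p x) (q x))"
  unfolding outer_def using assms by (intro continuous_intros continuous_on_vec_lambda)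

lemma C2_data_translate:
  assumes "C2_data u G H"
  shows "C2_data (\<lambda>x. u (x + h)) (\<lambda>x. G (x + h)) (\<lambda>x. H (x + h))"
proof (rule C2_dataI)
  fix x
  have s: "((\<lambda>x. x + h) has_derivative (\<lambda>v. v)) (at x)" by (auto intro!: derivative_eq_intros)
  show "((\<lambda>x. u (x + h)) has_derivative (\<lambda>v. G (x + h) \<bullet> v)) (at x)"
    using has_derivative_compose[OF s C2_dataD(1)[OF assms]] by simp
  show "((\<lambda>x. G (x + h)) has_derivative (\<lambda>v. H (x + h) *v v)) (at x)"
    using has_derivative_compose[OF s C2_dataD(2)[OF assms]] by simp
  show "H (x + h) $ i $ j = H (x + h) $ j $ i" for i j by (rule C2_dataD(4)[OF assms])
next
  show "continuous_on UNIV (\<lambda>x. H (x + h))"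
    by (rule continuous_on_compose2[OF C2_dataD(3)[OF assms, of UNIV]]) (auto intro!: continuous_intros)
qed

lemma C2_data_lincomb:
  assumes "C2_data u G H" "C2_data u' G' H'"
  shows "C2_data (\<lambda>x. c * u x + c' * u' x) (\<lambda>x. c *\<^sub>R G x + c' *\<^sub>R G' x) (\<lambda>x. c *\<^sub>R H x + c' *\<^sub>R H' x)"
proof (rule C2_dataI)
  fix x
  show "((\<lambda>x. c * u x + c' * u' x) has_derivative (\<lambda>v. (c *\<^sub>R G x + c' *\<^sub>R G' x) \<bullet> v)) (at x)"
    by (auto intro!: derivative_eq_intros C2_dataD[OF assms(1)] C2_dataD[OF assms(2)] simp: inner_add_left)
  show "((\<lambda>x. c *\<^sub>R G x + c' *\<^sub>R G' x) has_derivative (\<lambda>v. (c *\<^sub>R H x + c' *\<^sub>R H' x) *v v)) (at x)"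
    by (auto intro!: derivative_eq_intros C2_dataD[OF assms(1)] C2_dataD[OF assms(2)]
        simp: matrix_vector_mult_add_rdistrib scaleR_matrix_vector_assoc)
  show "(c *\<^sub>R H x + c' *\<^sub>R H' x) $ i $ j = (c *\<^sub>R H x + c' *\<^sub>R H' x) $ j $ i" for i j
    using C2_dataD(4)[OF assms(1), of x i j] C2_dataD(4)[OF assms(2), of x i j] by simp
qed (intro continuous_intros C2_dataD[OF assms(1)] C2_dataD[OF assms(2)])

lemma C2_data_mult:
  assumes "C2_data u G H" "C2_data u' G' H'"
  shows "C2_data (\<lambda>x. u x * u' x) (\<lambda>x. u x *\<^sub>R G' x + u' x *\<^sub>R G x)
     (\<lambda>x. u x *\<^sub>R H' x + u' x *\<^sub>R H x + outer (G x) (G' x) + outer (G' x) (G x))"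
proof (rule C2_dataI)
  fix x
  show "((\<lambda>x. u x * u' x) has_derivative (\<lambda>v. (u x *\<^sub>R G' x + u' x *\<^sub>R G x) \<bullet> v)) (at x)"
    by (auto intro!: derivative_eq_intros C2_dataD[OF assms(1)] C2_dataD[OF assms(2)] simp: inner_add_left)
  show "((\<lambda>x. u x *\<^sub>R G' x + u' x *\<^sub>R G x) has_derivative
      (\<lambda>v. (u x *\<^sub>R H' x + u' x *\<^sub>R H x + outer (G x) (G' x) + outer (G' x) (G x)) *v v)) (at x)"
    by (auto intro!: derivative_eq_intros C2_dataD[OF assms(1)] C2_dataD[OF assms(2)]
        simp: matrix_vector_mult_add_rdistrib scaleR_matrix_vector_assoc outer_mult_vec)
  show "(u x *\<^sub>R H' x + u' x *\<^sub>R H x + outer (G x) (G' x) + outer (G' x) (G x)) $ i $ j =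
      (u x *\<^sub>R H' x + u' x *\<^sub>R H x + outer (G x) (G' x) + outer (G' x) (G x)) $ j $ i" for i j
    using C2_dataD(4)[OF assms(1), of x i j] C2_dataD(4)[OF assms(2), of x i j] by (simp add: outer_def)
qed (intro continuous_intros C2_dataD[OF assms(1)] C2_dataD[OF assms(2)])

lemma C2_data_const: "C2_data (\<lambda>x. c) (\<lambda>x. 0) (\<lambda>x. 0)"
  by (rule C2_dataI) auto

lemma C2_data_sum:
  assumes "\<And>j. j \<in> I \<Longrightarrow> C2_data (u j) (G j) (H j)"
  shows "C2_data (\<lambda>x. \<Sum>j\<in>I. u j x) (\<lambda>x. \<Sum>j\<in>I. G j x) (\<lambda>x. \<Sum>j\<in>I. H j x)"
  using assms
proof (induction I rule: infinite_finite_induct)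
  case (insert k I)
  have "C2_data (\<lambda>x. 1 * u k x + 1 * (\<Sum>j\<in>I. u j x)) (\<lambda>x. 1 *\<^sub>R G k x + 1 *\<^sub>R (\<Sum>j\<in>I. G j x))
     (\<lambda>x. 1 *\<^sub>R H k x + 1 *\<^sub>R (\<Sum>j\<in>I. H j x))"
    using insert by (intro C2_data_lincomb) auto
  then show ?case using insert by simp
qed (simp_all add: C2_data_const)

lemma C2_data_norm_sq: "C2_data (\<lambda>x. (norm (x - x0 :: real^'n))\<^sup>2) (\<lambda>x. 2 *\<^sub>R (x - x0)) (\<lambda>x. 2 *\<^sub>R mat 1)"
proof (rule C2_dataI)
  fix x :: "real^'n"
  show "((\<lambda>x. (norm (x - x0))\<^sup>2) has_derivative (\<lambda>v. (2 *\<^sub>R (x - x0)) \<bullet> v)) (at x)"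
    unfolding power2_norm_eq_inner
    by (auto intro!: derivative_eq_intros simp: inner_commute)
  show "((\<lambda>x. 2 *\<^sub>R (x - x0)) has_derivative (\<lambda>v. (2 *\<^sub>R mat 1 :: real^'n^'n) *v v)) (at x)"
    by (auto intro!: derivative_eq_intros simp: scaleR_matrix_vector_assoc[symmetric])
  show "(2 *\<^sub>R mat 1 :: real^'n^'n) $ i $ j = (2 *\<^sub>R mat 1 :: real^'n^'n) $ j $ i" for i j
    by (simp add: mat_def)
qed auto

text \<open>Subtracting \<nu> times the identity from the coefficients leaves a positive
  semidefinite matrix, which pairs nonnegatively with -H.\<close>

lemma elliptic_trace_le:
  fixes a :: "'n::finite \<Rightarrow> 'n \<Rightarrow> real^'n \<Rightarrow> real"
  assumes ell: "\<And>\<xi>. \<nu> * (norm \<xi>)\<^sup>2 \<le> (\<Sum>i\<in>UNIV. \<Sum>j\<in>UNIV. a i j x * \<xi> $ i * \<xi> $ j)"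
    and H: "nsd H" and sym: "\<And>i j. H $ i $ j = H $ j $ i"
  shows "Lop a H x \<le> \<nu> * trace H"
proof -
  have nrm: "(norm \<xi>)\<^sup>2 = (\<Sum>i\<in>UNIV. \<xi> $ i * \<xi> $ i)" for \<xi> :: "real^'n"
    by (simp add: power2_norm_eq_inner inner_vec_def)
  define b where "b i j = a i j x - (if i = j then \<nu> else 0)" for i j
  define M where "M i j = - H $ i $ j" for i j
  have "0 \<le> (\<Sum>i\<in>UNIV. \<Sum>j\<in>UNIV. b i j * M i j)"
  proof (rule psd_product_trace[where S = UNIV])
    fix v :: "'n \<Rightarrow> real"
    let ?\<xi> = "(\<chi> i. v i) :: real^'n"
    have "(\<Sum>i\<in>UNIV. \<Sum>j\<in>UNIV. b i j * v i * v j) =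
       (\<Sum>i\<in>UNIV. \<Sum>j\<in>UNIV. a i j x * ?\<xi> $ i * ?\<xi> $ j) - (\<Sum>i\<in>UNIV. \<Sum>j\<in>UNIV. (if i = j then \<nu> else 0) * v i * v j)"
      by (simp add: b_def sum_subtractf[symmetric] algebra_simps)
    also have "(\<Sum>i\<in>UNIV. \<Sum>j\<in>UNIV. (if i = j then \<nu> else 0) * v i * v j) = \<nu> * (norm ?\<xi>)\<^sup>2"
      by (simp add: nrm if_distrib[of "\<lambda>c. c * _"] sum_distrib_left mult.assoc cong: if_cong)
    finally show "0 \<le> (\<Sum>i\<in>UNIV. \<Sum>j\<in>UNIV. b i j * v i * v j)" using ell[of ?\<xi>] by simp
    have "?\<xi> \<bullet> (H *v ?\<xi>) = (\<Sum>i\<in>UNIV. \<Sum>j\<in>UNIV. H $ i $ j * v i * v j)"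
      by (simp add: inner_vec_def matrix_vector_mult_def sum_distrib_left mult_ac)
    moreover have "(\<Sum>i\<in>UNIV. \<Sum>j\<in>UNIV. M i j * v i * v j) = - (\<Sum>i\<in>UNIV. \<Sum>j\<in>UNIV. H $ i $ j * v i * v j)"
      by (simp add: M_def sum_negf)
    ultimately show "0 \<le> (\<Sum>i\<in>UNIV. \<Sum>j\<in>UNIV. M i j * v i * v j)"
      using H unfolding nsd_def by (smt (verit))
  next
    show "M i j = M j i" for i j using sym[of i j] by (simp add: M_def)
  qed auto
  also have "(\<Sum>i\<in>UNIV. \<Sum>j\<in>UNIV. b i j * M i j) =
      (\<Sum>i\<in>UNIV. \<Sum>j\<in>UNIV. (if i = j then \<nu> else 0) * H $ i $ j) - Lop a H x"
    by (simp add: b_def M_def Lop_def sum_subtractf[symmetric] algebra_simps)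
  also have "(\<Sum>i\<in>UNIV. \<Sum>j\<in>UNIV. (if i = j then \<nu> else 0) * H $ i $ j) = \<nu> * trace H"
    by (simp add: trace_def if_distrib[of "\<lambda>c. c * _"] sum_distrib_left cong: if_cong)
  finally show ?thesis by simp
qed

section \<open>Bernstein's method\<close>

lemma convex_on_power: "convex_on {0::real..} (\<lambda>x. x ^ n)"
proof (cases "even n")
  case True
  then show ?thesis using convex_power_even[of n] convex_on_subset by blast
qed (rule convex_power_odd)

lemma sum_power_le:
  fixes c y :: "'k \<Rightarrow> real"
  assumes I: "finite I" and c: "\<And>k. k \<in> I \<Longrightarrow> 0 \<le> c k" and y: "\<And>k. k \<in> I \<Longrightarrow> 0 \<le> y k"
    and S: "(\<Sum>k\<in>I. c k) = S" "0 < S"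
  shows "(\<Sum>k\<in>I. c k * y k) ^ n \<le> S ^ n * (\<Sum>k\<in>I. c k / S * y k ^ n)"
proof -
  have "I \<noteq> {}" using S by auto
  have "(\<Sum>k\<in>I. (c k / S) *\<^sub>R y k) ^ n \<le> (\<Sum>k\<in>I. c k / S * y k ^ n)"
  proof (rule convex_on_sum[OF I \<open>I \<noteq> {}\<close> convex_on_power])
    show "(\<Sum>k\<in>I. c k / S) = 1" using S by (simp add: sum_divide_distrib[symmetric])
  qed (use c y S in auto)
  moreover have "(\<Sum>k\<in>I. c k * y k) = S * (\<Sum>k\<in>I. (c k / S) *\<^sub>R y k)"
    using S by (simp add: sum_distrib_left)
  ultimately show ?thesis using S by (simp add: power_mult_distrib mult_left_mono)
qed

lemma nn_integral_lborel_translate: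
  fixes f :: "'a::euclidean_space \<Rightarrow> ennreal"
  assumes [measurable]: "f \<in> borel_measurable borel"
  shows "(\<integral>\<^sup>+ x. f (x + v) \<partial>lborel) = (\<integral>\<^sup>+ x. f x \<partial>lborel)"
proof -
  have "(\<integral>\<^sup>+ x. f x \<partial>lborel) = (\<integral>\<^sup>+ x. f x \<partial>distr lborel borel ((+) v))"
    using lborel_distr_plus[of v] by simp
  also have "\<dots> = (\<integral>\<^sup>+ x. f (v + x) \<partial>lborel)"
    by (subst nn_integral_distr) auto
  finally show ?thesis by (simp add: add.commute)
qed

text \<open>Jensen's inequality in the role of Minkowski's. The error of the Bernstein function is
  bounded by a weighted sum of translates of a single residual; the larger set \<open>B'\<close>
  absorbs the shifts.\<close>

lemma nn_integral_sum_translates_le: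
  fixes r :: "'a::euclidean_space \<Rightarrow> real" and v :: "'k \<Rightarrow> 'a"
  assumes r: "continuous_on UNIV r" and r0: "\<And>x. 0 \<le> r x"
    and I: "finite I" and c: "\<And>k. k \<in> I \<Longrightarrow> 0 \<le> c k" and S: "(\<Sum>k\<in>I. c k) = S" "0 < S"
    and v: "\<And>k x. k \<in> I \<Longrightarrow> x \<in> B \<Longrightarrow> x + v k \<in> B'" and B: "B' \<in> sets borel" "B \<in> sets borel"
  shows "(\<integral>\<^sup>+ x. ennreal ((\<Sum>k\<in>I. c k * r (x + v k)) ^ n) * indicator B x \<partial>lborel)
    \<le> ennreal (S ^ n) * (\<integral>\<^sup>+ x. ennreal (r x ^ n) * indicator B' x \<partial>lborel)"
proof -
  have rm [measurable]: "r \<in> borel_measurable borel" using r by (rule borel_measurable_continuous_onI)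
  note [measurable] = B
  have m: "(\<lambda>x. ennreal (r x ^ n) * indicator B' x) \<in> borel_measurable borel"
    by measurable
  have "(\<integral>\<^sup>+ x. ennreal ((\<Sum>k\<in>I. c k * r (x + v k)) ^ n) * indicator B x \<partial>lborel)
     \<le> (\<integral>\<^sup>+ x. ennreal (S ^ n) * (\<Sum>k\<in>I. ennreal (c k / S) * (ennreal (r (x + v k) ^ n) * indicator B' (x + v k))) \<partial>lborel)"
  proof (rule nn_integral_mono)
    fix x
    show "ennreal ((\<Sum>k\<in>I. c k * r (x + v k)) ^ n) * indicator B x \<le>
       ennreal (S ^ n) * (\<Sum>k\<in>I. ennreal (c k / S) * (ennreal (r (x + v k) ^ n) * indicator B' (x + v k)))"
    proof (cases "x \<in> B")
      case True
      have "ennreal ((\<Sum>k\<in>I. c k * r (x + v k)) ^ n) \<le> ennreal (S ^ n * (\<Sum>k\<in>I. c k / S * r (x + v k) ^ n))"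
        using I c r0 S by (intro ennreal_leI sum_power_le) auto
      also have "\<dots> = ennreal (S ^ n) * ennreal (\<Sum>k\<in>I. c k / S * r (x + v k) ^ n)"
        using S c r0 by (intro ennreal_mult sum_nonneg) auto
      also have "ennreal (\<Sum>k\<in>I. c k / S * r (x + v k) ^ n) = (\<Sum>k\<in>I. ennreal (c k / S * r (x + v k) ^ n))"
        using S c r0 by (intro sum_ennreal[symmetric]) auto
      also have "\<dots> = (\<Sum>k\<in>I. ennreal (c k / S) * (ennreal (r (x + v k) ^ n) * indicator B' (x + v k)))"
      proof (rule sum.cong)
        fix k assume "k \<in> I"
        then show "ennreal (c k / S * r (x + v k) ^ n) = ennreal (c k / S) * (ennreal (r (x + v k) ^ n) * indicator B' (x + v k))"
          using v[of k x] True c[of k] S r0 by (simp add: ennreal_mult[symmetric])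
      qed simp
      finally show ?thesis using True by simp
    qed simp
  qed
  also have "\<dots> = ennreal (S ^ n) * (\<Sum>k\<in>I. ennreal (c k / S) * (\<integral>\<^sup>+ x. ennreal (r (x + v k) ^ n) * indicator B' (x + v k) \<partial>lborel))"
  proof -
    have m': "(\<lambda>x. ennreal (r (x + v k) ^ n) * indicator B' (x + v k)) \<in> borel_measurable lborel" for k
      using measurable_compose[OF _ m, of "\<lambda>x. x + v k" lborel] by simp
    show ?thesis
      using m' by (simp add: nn_integral_cmult nn_integral_sum)
  qed
  also have "(\<Sum>k\<in>I. ennreal (c k / S) * (\<integral>\<^sup>+ x. ennreal (r (x + v k) ^ n) * indicator B' (x + v k) \<partial>lborel))
     = (\<Sum>k\<in>I. ennreal (c k / S)) * (\<integral>\<^sup>+ x. ennreal (r x ^ n) * indicator B' x \<partial>lborel)"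
    using nn_integral_lborel_translate[OF m] by (simp add: sum_distrib_right)
  also have "(\<Sum>k\<in>I. ennreal (c k / S)) = 1"
    using S c by (subst sum_ennreal) (auto simp: sum_divide_distrib[symmetric])
  finally show ?thesis by simp
qed

text \<open>The vector sum is the gradient of the Riemann mean of u over the segment from x to x +
  h, so its product with h is nearly the increment of u. A finite mean inherits
  \<open>C2_data\<close> from \<open>C2_data_sum\<close>, with no differentiation under an integral,
  and uniform continuity of \<open>G\<close> makes one m serve the whole ball.\<close>

lemma riemann_sum_derivative:
  assumes C2: "C2_data u G H" and s: "0 < \<sigma>"
  shows "\<exists>m>0. \<forall>x\<in>cball x0 \<rho>. \<bar>u (x + h) - u x - (\<Sum>j<m. (1 / real m) *\<^sub>R G (x + (real j / real m) *\<^sub>R h)) \<bullet> h\<bar> \<le> \<sigma>"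
proof -
  let ?K = "cball x0 (\<rho> + norm h)"
  have "uniformly_continuous_on ?K G"
    by (intro compact_uniformly_continuous C2_dataD(6)[OF C2]) auto
  moreover have "0 < \<sigma> / (norm h + 1)" using s by (simp add: add_nonneg_pos)
  ultimately obtain d where d: "d > 0"
    "\<And>x y. x \<in> ?K \<Longrightarrow> y \<in> ?K \<Longrightarrow> dist x y < d \<Longrightarrow> dist (G x) (G y) < \<sigma> / (norm h + 1)"
    unfolding uniformly_continuous_on_def by metis
  obtain m :: nat where m: "norm h / d < real m" using reals_Archimedean2 by blast
  have m0: "0 < real m" using m d by (smt (verit) divide_nonneg_pos norm_ge_zero)
  have md: "norm h / real m < d" using m m0 d by (simp add: field_simps)
  have "\<bar>u (x + h) - u x - (\<Sum>j<m. (1 / real m) *\<^sub>R G (x + (real j / real m) *\<^sub>R h)) \<bullet> h\<bar> \<le> \<sigma>"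
    if x: "x \<in> cball x0 \<rho>" for x
  proof -
    define \<phi> where "\<phi> s = u (x + s *\<^sub>R h)" for s
    have der: "DERIV \<phi> s :> G (x + s *\<^sub>R h) \<bullet> h" for s
      using has_derivative_along_line[OF C2_dataD(1)[OF C2], of x h s]
      by (simp add: \<phi>_def[abs_def] has_real_derivative_iff_has_vector_derivative)
    have inK: "x + s *\<^sub>R h \<in> ?K" if "0 \<le> s" "s \<le> 1" for s
    proof -
      have "norm (s *\<^sub>R h) \<le> norm h" using that by (simp add: mult_left_le_one_le)
      moreover have "dist x0 (x + s *\<^sub>R h) \<le> dist x0 x + norm (s *\<^sub>R h)"
        by (metis add_diff_cancel_left' dist_norm dist_triangle norm_minus_commute)
      ultimately show ?thesis using x by simp
    qed
    have step: "\<bar>\<phi> (real (Suc j) / real m) - \<phi> (real j / real m) - (1 / real m) * (G (x + (real j / real m) *\<^sub>R h) \<bullet> h)\<bar>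
        \<le> \<sigma> / real m" if j: "j < m" for j
    proof -
      have lt: "real j / real m < real (Suc j) / real m" using m0 by (simp add: divide_strict_right_mono)
      obtain \<xi> where xi: "real j / real m < \<xi>" "\<xi> < real (Suc j) / real m"
        "\<phi> (real (Suc j) / real m) - \<phi> (real j / real m) =
          (real (Suc j) / real m - real j / real m) * (G (x + \<xi> *\<^sub>R h) \<bullet> h)"
        using MVT2[OF lt der] by blast
      have le1: "real (Suc j) / real m \<le> 1" using j m0 by (simp add: divide_le_eq_1)
      have e1: "real (Suc j) / real m - real j / real m = 1 / real m" using m0 by (simp add: field_simps)
      have j0: "0 \<le> real j / real m" by simp
      have bds: "0 \<le> \<xi>" "\<xi> \<le> 1" "real j / real m \<le> 1" using xi j0 le1 lt by linarith+
      have dd: "dist (x + \<xi> *\<^sub>R h) (x + (real j / real m) *\<^sub>R h) < d"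
      proof -
        have "dist (x + \<xi> *\<^sub>R h) (x + (real j / real m) *\<^sub>R h) = \<bar>\<xi> - real j / real m\<bar> * norm h"
          by (simp add: dist_norm scaleR_left_diff_distrib[symmetric] del: scaleR_left_diff_distrib)
        also have "\<dots> \<le> (1 / real m) * norm h" using xi e1 by (intro mult_right_mono) auto
        finally show ?thesis using md by simp
      qed
      have "\<bar>G (x + \<xi> *\<^sub>R h) \<bullet> h - G (x + (real j / real m) *\<^sub>R h) \<bullet> h\<bar>
          \<le> norm (G (x + \<xi> *\<^sub>R h) - G (x + (real j / real m) *\<^sub>R h)) * norm h"
        by (metis Cauchy_Schwarz_ineq2 inner_diff_left)
      also have "\<dots> \<le> (\<sigma> / (norm h + 1)) * norm h"
      proof (rule mult_right_mono)
        have "dist (G (x + \<xi> *\<^sub>R h)) (G (x + (real j / real m) *\<^sub>R h)) < \<sigma> / (norm h + 1)"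
          by (rule d(2)[OF inK[OF bds(1,2)] inK[OF j0 bds(3)] dd])
        then show "norm (G (x + \<xi> *\<^sub>R h) - G (x + (real j / real m) *\<^sub>R h)) \<le> \<sigma> / (norm h + 1)"
          by (simp add: dist_norm)
      qed simp
      also have "\<dots> \<le> \<sigma> / (norm h + 1) * (norm h + 1)"
        using s by (intro mult_left_mono divide_nonneg_nonneg) auto
      also have "\<dots> = \<sigma>" using norm_ge_zero[of h] by (simp add: add_nonneg_eq_0_iff)
      finally have "\<bar>G (x + \<xi> *\<^sub>R h) \<bullet> h - G (x + (real j / real m) *\<^sub>R h) \<bullet> h\<bar> \<le> \<sigma>" .
      then have "(1 / real m) * \<bar>G (x + \<xi> *\<^sub>R h) \<bullet> h - G (x + (real j / real m) *\<^sub>R h) \<bullet> h\<bar> \<le> (1 / real m) * \<sigma>"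
        using m0 by (intro mult_left_mono) auto
      moreover have "\<phi> (real (Suc j) / real m) - \<phi> (real j / real m) - (1 / real m) * (G (x + (real j / real m) *\<^sub>R h) \<bullet> h)
         = (1 / real m) * (G (x + \<xi> *\<^sub>R h) \<bullet> h - G (x + (real j / real m) *\<^sub>R h) \<bullet> h)"
        unfolding xi(3) e1 by (simp add: right_diff_distrib)
      ultimately show ?thesis using m0 by (simp add: abs_mult)
    qed
    have "u (x + h) - u x = (\<Sum>j<m. \<phi> (real (Suc j) / real m) - \<phi> (real j / real m))"
      using sum_lessThan_telescope[of "\<lambda>j. \<phi> (real j / real m)" m] m0 by (simp add: \<phi>_def)
    then have "u (x + h) - u x - (\<Sum>j<m. (1 / real m) *\<^sub>R G (x + (real j / real m) *\<^sub>R h)) \<bullet> h =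
       (\<Sum>j<m. \<phi> (real (Suc j) / real m) - \<phi> (real j / real m) - (1 / real m) * (G (x + (real j / real m) *\<^sub>R h) \<bullet> h))"
      by (simp add: inner_sum_left sum_subtractf)
    also have "\<bar>\<dots>\<bar> \<le> (\<Sum>j<m. \<sigma> / real m)"
      using step by (intro order.trans[OF sum_abs] sum_mono) auto
    also have "\<dots> = \<sigma>" using m0 by simp
    finally show ?thesis .
  qed
  then show ?thesis using m0 by (intro exI[of _ m]) auto
qed

lemma abs_le_imp_power2_le: "\<bar>x\<bar> \<le> X \<Longrightarrow> x\<^sup>2 \<le> X\<^sup>2" for x X :: real
  using power_mono[of "\<bar>x\<bar>" X 2] by simp

lemma neg_mult_le:
  fixes x y X Y :: real
  assumes "\<bar>x\<bar> \<le> X" "\<bar>y\<bar> \<le> Y"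
  shows "- (x * y) \<le> X * Y"
proof -
  have "- (x * y) \<le> \<bar>x\<bar> * \<bar>y\<bar>" unfolding abs_mult[symmetric] by simp
  also have "\<dots> \<le> X * Y" using assms by (intro mult_mono) auto
  finally show ?thesis .
qed

text \<open>Steps in the x' directions, along which the coefficients do not change.\<close>

definition hor :: "('q::finite, 'r::finite) pt \<Rightarrow> bool" where
  "hor h \<longleftrightarrow> (\<forall>k. h $ Inr k = 0)"

locale coeffs =
  fixes a :: "('q::finite + 'r::finite) \<Rightarrow> ('q + 'r) \<Rightarrow> ('q, 'r) pt \<Rightarrow> real" and \<nu> :: real
  assumes nu: "0 < \<nu>"
    and a_cont: "continuous_on UNIV (a i j)"
    and a_xpp: "same_xpp x y \<Longrightarrow> a i j x = a i j y"
    and ell_lower: "\<nu> * (norm \<xi>)\<^sup>2 \<le> (\<Sum>i\<in>UNIV. \<Sum>j\<in>UNIV. a i j x * \<xi> $ i * \<xi> $ j)"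
    and ell_upper: "(\<Sum>i\<in>UNIV. \<Sum>j\<in>UNIV. a i j x * \<xi> $ i * \<xi> $ j) \<le> (norm \<xi>)\<^sup>2 / \<nu>"
begin

lemma Lop_shift: "hor h \<Longrightarrow> Lop a A (x + h) = Lop a A x"
proof -
  assume "hor h"
  then have "a i j (x + h) = a i j x" for i j
    by (intro a_xpp) (simp add: same_xpp_def hor_def)
  then show ?thesis by (simp add: Lop_def)
qed

lemma Lop_outer_ge: "\<nu> * (norm p)\<^sup>2 \<le> Lop a (outer p p) x"
  using ell_lower[of p x] by (simp add: Lop_outer)

lemma Lop_mat_le: "Lop a (mat 1) x \<le> real CARD('q + 'r) / \<nu>"
proof -
  have "a i i x \<le> 1 / \<nu>" for i
  proof -
    have "(\<Sum>k\<in>UNIV. \<Sum>j\<in>UNIV. a k j x * (axis i 1 :: ('q,'r) pt) $ k * (axis i 1 :: ('q,'r) pt) $ j) =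
       (\<Sum>k\<in>UNIV. if k = i then (\<Sum>j\<in>UNIV. if j = i then a k j x else 0) else 0)"
      by (intro sum.cong refl) (auto simp: axis_def if_distrib cong: if_cong)
    also have "\<dots> = a i i x" by simp
    finally show ?thesis using ell_upper[of x "axis i 1"] by simp
  qed
  then have "(\<Sum>i\<in>UNIV. a i i x) \<le> (\<Sum>i\<in>(UNIV::('q+'r) set). 1 / \<nu>)" by (rule sum_mono)
  then show ?thesis by (simp add: Lop_mat)
qed

text \<open>\<open>V\<close> and \<open>Y\<close> are the difference quotient and the segment mean
  at one point. The good term 2 A a(GY, GY) is almost 2 A \<nu> V^2, because the derivative of the
  mean along \<open>e\<close> is almost \<open>V\<close>. One half of it absorbs the mixed term V gV
  by Young's inequality; the other half is large because the auxiliary function is positive, which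
  is the hypothesis \<open>W1 \<le> V * V + A * (Y * Y)\<close>. The hypothesis \<open>par\<close>
  says that this half beats everything except the residuals \<open>rV\<close> and
  \<open>rY\<close>.\<close>

lemma bernstein_pointwise:
  assumes ns: "nsd Hw" and sym: "\<And>i j. Hw $ i $ j = Hw $ j $ i"
    and Hw: "Hw = (V *\<^sub>R HV + V *\<^sub>R HV + outer GV GV + outer GV GV)
        + A *\<^sub>R (Y *\<^sub>R HY + Y *\<^sub>R HY + outer GY GY + outer GY GY) - (2 * \<theta>) *\<^sub>R mat 1"
    and e: "norm e = 1" "\<bar>GY \<bullet> e - V\<bar> \<le> \<sigma>" and b: "\<bar>V\<bar> \<le> Vb" "\<bar>Y\<bar> \<le> Yb" "W1 \<le> V * V + A * (Y * Y)"
    and L: "Lop a HV x = gV + rV" "\<bar>gV\<bar> \<le> G'" "Lop a HY x = gY + rY" "\<bar>gY\<bar> \<le> G"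
    and pos: "0 < A" "0 \<le> \<theta>"
    and par: "G'\<^sup>2 / (A * \<nu>) + 2 * A * Yb * G + A\<^sup>2 * \<nu> * Yb\<^sup>2 + 4 * A * \<nu> * \<sigma> * Vb + 2 * \<theta> * real CARD('q + 'r) / \<nu> \<le> A * \<nu> * W1"
  shows "- trace Hw \<le> (2 * Vb * \<bar>rV\<bar> + 2 * A * Yb * \<bar>rY\<bar>) / \<nu>"
proof -
  have Y0: "0 \<le> Yb" "0 \<le> Vb" using b by auto
  have L1: "Lop a Hw x \<le> \<nu> * trace Hw"
    by (rule elliptic_trace_le[OF ell_lower ns sym])
  have L2: "Lop a Hw x = 2 * V * (gV + rV) + 2 * Lop a (outer GV GV) x
     + A * (2 * Y * (gY + rY) + 2 * Lop a (outer GY GY) x) - 2 * \<theta> * Lop a (mat 1) x"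
    unfolding Hw Lop_add Lop_diff Lop_scaleR L by (simp add: algebra_simps)
  have o1: "0 \<le> Lop a (outer GV GV) x" using Lop_outer_ge[of GV x] nu by (smt (verit) mult_nonneg_nonneg zero_le_power2)
  \<comment> \<open>The square of \<open>GY \<bullet> e - V\<close> is dropped and the cross term
    kept, hence an error linear in \<open>\<sigma>\<close>.\<close>
  have o2: "\<nu> * (V\<^sup>2 - 2 * \<sigma> * Vb) \<le> Lop a (outer GY GY) x"
  proof -
    have "V\<^sup>2 - 2 * \<sigma> * Vb \<le> (GY \<bullet> e)\<^sup>2"
    proof -
      have "\<bar>V * (GY \<bullet> e - V)\<bar> \<le> Vb * \<sigma>" unfolding abs_mult using b e by (intro mult_mono) auto
      then have "- (Vb * \<sigma>) \<le> V * (GY \<bullet> e - V)" by linarith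
      moreover have "(GY \<bullet> e)\<^sup>2 = V\<^sup>2 + 2 * (V * (GY \<bullet> e - V)) + (GY \<bullet> e - V)\<^sup>2"
        by (simp add: power2_eq_square algebra_simps)
      moreover have "0 \<le> (GY \<bullet> e - V)\<^sup>2" "2 * \<sigma> * Vb = 2 * (Vb * \<sigma>)" by simp_all
      ultimately show ?thesis by linarith
    qed
    also have "\<dots> \<le> (norm GY * norm e)\<^sup>2"
      using Cauchy_Schwarz_ineq2[of GY e] by (rule abs_le_imp_power2_le)
    finally have "\<nu> * (V\<^sup>2 - 2 * \<sigma> * Vb) \<le> \<nu> * (norm GY)\<^sup>2" using e nu by (simp add: mult_left_mono)
    then show ?thesis using Lop_outer_ge[of GY x] by linarith
  qed
  have t1: "- (2 * V * gV) \<le> A * \<nu> * V\<^sup>2 + G'\<^sup>2 / (A * \<nu>)"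
  proof -
    have "0 \<le> (A * \<nu> * V + gV)\<^sup>2" by simp
    then have "- (2 * V * gV) * (A * \<nu>) \<le> (A * \<nu> * V)\<^sup>2 + gV\<^sup>2"
      by (simp add: power2_eq_square algebra_simps)
    also have "gV\<^sup>2 \<le> G'\<^sup>2" using L(2) by (rule abs_le_imp_power2_le)
    finally have "- (2 * V * gV) \<le> ((A * \<nu> * V)\<^sup>2 + G'\<^sup>2) / (A * \<nu>)"
      using pos nu by (simp add: pos_le_divide_eq)
    also have "\<dots> = A * \<nu> * V\<^sup>2 + G'\<^sup>2 / (A * \<nu>)"
      using pos nu by (simp add: field_simps power2_eq_square)
    finally show ?thesis .
  qed
  have t2: "- (V * rV) \<le> Vb * \<bar>rV\<bar>"
    by (rule neg_mult_le[OF b(1) order_refl])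
  have t3: "- (Y * gY) \<le> Yb * G"
    by (rule neg_mult_le[OF b(2) L(4)])
  have t4: "- (Y * rY) \<le> Yb * \<bar>rY\<bar>"
    by (rule neg_mult_le[OF b(2) order_refl])
  have t34: "A * (- (2 * Y * (gY + rY))) \<le> 2 * A * Yb * G + 2 * A * Yb * \<bar>rY\<bar>"
  proof -
    have "- (2 * Y * (gY + rY)) \<le> 2 * Yb * G + 2 * Yb * \<bar>rY\<bar>" using t3 t4 by (simp add: algebra_simps)
    then have "A * (- (2 * Y * (gY + rY))) \<le> A * (2 * Yb * G + 2 * Yb * \<bar>rY\<bar>)" using pos by (intro mult_left_mono) auto
    then show ?thesis by (simp add: algebra_simps)
  qed
  have t5: "A * (2 * (\<nu> * (V\<^sup>2 - 2 * \<sigma> * Vb))) \<le> A * (2 * Lop a (outer GY GY) x)"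
    using o2 pos by (intro mult_left_mono) auto
  have t6: "2 * \<theta> * Lop a (mat 1) x \<le> 2 * \<theta> * (real CARD('q + 'r) / \<nu>)"
    using Lop_mat_le pos by (intro mult_left_mono) auto
  \<comment> \<open>Positivity of the auxiliary function enters here, as the lower bound
    \<open>W1 - A * Yb\<^sup>2\<close> for the square of \<open>V\<close>.\<close>
  have t7: "A * \<nu> * (W1 - A * Yb\<^sup>2) \<le> A * \<nu> * V\<^sup>2"
  proof (rule mult_left_mono)
    have "Y * Y \<le> Yb\<^sup>2" using abs_le_imp_power2_le[OF b(2)] by (simp add: power2_eq_square)
    then have "A * (Y * Y) \<le> A * Yb\<^sup>2" using pos by (intro mult_left_mono) auto
    then show "W1 - A * Yb\<^sup>2 \<le> V\<^sup>2" using b(3) by (simp add: power2_eq_square)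
  qed (use pos nu in auto)
  have "- (\<nu> * trace Hw) \<le> - Lop a Hw x" using L1 by simp
  also have "\<dots> \<le> - (2 * V * gV) + 2 * (- (V * rV)) + A * (- (2 * Y * (gY + rY))) - A * (2 * Lop a (outer GY GY) x)
      + 2 * \<theta> * Lop a (mat 1) x"
    unfolding L2 using o1 by (simp add: algebra_simps)
  also have "\<dots> \<le> A * \<nu> * V\<^sup>2 + G'\<^sup>2 / (A * \<nu>) + 2 * (Vb * \<bar>rV\<bar>) + (2 * A * Yb * G + 2 * A * Yb * \<bar>rY\<bar>)
      - A * (2 * (\<nu> * (V\<^sup>2 - 2 * \<sigma> * Vb))) + 2 * \<theta> * (real CARD('q + 'r) / \<nu>)"
    using t1 t2 t34 t5 t6 by linarith
  also have "\<dots> = (G'\<^sup>2 / (A * \<nu>) + 2 * A * Yb * G + 4 * A * \<nu> * \<sigma> * Vb + 2 * \<theta> * real CARD('q + 'r) / \<nu>)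
       - A * \<nu> * V\<^sup>2 + (2 * Vb * \<bar>rV\<bar> + 2 * A * Yb * \<bar>rY\<bar>)"
    by (simp add: algebra_simps)
  also have "\<dots> \<le> 2 * Vb * \<bar>rV\<bar> + 2 * A * Yb * \<bar>rY\<bar>"
    using par t7 by (simp add: algebra_simps power2_eq_square)
  finally show ?thesis using nu by (simp add: pos_le_divide_eq mult.commute)
qed

end

lemma C2_data_scale:
  assumes "C2_data u G H"
  shows "C2_data (\<lambda>x. c * u x) (\<lambda>x. c *\<^sub>R G x) (\<lambda>x. c *\<^sub>R H x)"
  using C2_data_lincomb[OF assms assms, of c 0] by simp

context coeffs
begin

text \<open>A notion of generalised solution made for the maximum principle: locally uniform limits
  of C^2 functions whose residuals tend to zero in L^d on balls (the integral is the d-th power of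
  the norm). It is stable under horizontal translations and linear combinations, so every difference
  operator in x' can be applied to a solution.\<close>

definition gsol :: "(('q, 'r) pt \<Rightarrow> real) \<Rightarrow> (('q, 'r) pt \<Rightarrow> real) \<Rightarrow> bool" where
  "gsol z g \<longleftrightarrow> continuous_on UNIV z \<and> continuous_on UNIV g \<and>
     (\<forall>R>0. \<forall>\<epsilon>>0. \<exists>U G H. C2_data U G H \<and> (\<forall>x\<in>ball 0 R. \<bar>U x - z x\<bar> \<le> \<epsilon>) \<and>
        (\<integral>\<^sup>+ x. ennreal (\<bar>Lop a (H x) x - g x\<bar> ^ CARD('q + 'r)) * indicator (ball 0 R) x \<partial>lborel) \<le> ennreal \<epsilon>)"

text \<open>\<open>ABP\<close> asks for a continuous bound on the right; continuity of the
  coefficients supplies it.\<close>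

lemma continuous_on_residual:
  assumes "C2_data U G H" "continuous_on UNIV g"
  shows "continuous_on UNIV (\<lambda>x. Lop a (H x) x - g x)"
  unfolding Lop_def by (intro continuous_intros a_cont assms C2_dataD(3)[OF assms(1)])

text \<open>As h is horizontal, \<open>Lop_shift\<close> lets the approximants be translated
  together with their residuals.\<close>

lemma gsol_translate:
  assumes gs: "gsol z g" and h: "hor h"
  shows "gsol (\<lambda>x. z (x + h)) (\<lambda>x. g (x + h))"
  unfolding gsol_def
proof (intro conjI allI impI)
  have c: "continuous_on UNIV z" "continuous_on UNIV g" using gs by (auto simp: gsol_def)
  show "continuous_on UNIV (\<lambda>x. z (x + h))" "continuous_on UNIV (\<lambda>x. g (x + h))"
    by (rule continuous_on_compose2[OF c(1)] continuous_on_compose2[OF c(2)]; auto intro!: continuous_intros)+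
  fix R \<epsilon> :: real assume R: "0 < R" and e: "0 < \<epsilon>"
  have "0 < R + norm h" using R by (simp add: add_pos_nonneg)
  then obtain U G H where U: "C2_data U G H" "\<forall>x\<in>ball 0 (R + norm h). \<bar>U x - z x\<bar> \<le> \<epsilon>"
    "(\<integral>\<^sup>+ x. ennreal (\<bar>Lop a (H x) x - g x\<bar> ^ CARD('q + 'r)) * indicator (ball 0 (R + norm h)) x \<partial>lborel) \<le> ennreal \<epsilon>"
    using gs e unfolding gsol_def by meson
  have sub: "x + h \<in> ball 0 (R + norm h)" if "x \<in> ball 0 R" for x
    using that norm_triangle_ineq[of x h] by simp
  have "continuous_on UNIV (\<lambda>x. \<bar>Lop a (H x) x - g x\<bar>)"
    by (intro continuous_on_rabs continuous_on_residual[OF U(1) c(2)])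
  from nn_integral_sum_translates_le[OF this, of "{0::nat}" "\<lambda>_. 1" 1 "ball 0 R" "\<lambda>_. h" "ball 0 (R + norm h)" "CARD('q + 'r)"]
  have "(\<integral>\<^sup>+ x. ennreal (\<bar>Lop a (H (x + h)) (x + h) - g (x + h)\<bar> ^ CARD('q + 'r)) * indicator (ball 0 R) x \<partial>lborel) \<le> ennreal \<epsilon>"
    using sub U(3) by (auto intro: order.trans)
  then show "\<exists>U G H. C2_data U G H \<and> (\<forall>x\<in>ball 0 R. \<bar>U x - z (x + h)\<bar> \<le> \<epsilon>) \<and>
    (\<integral>\<^sup>+ x. ennreal (\<bar>Lop a (H x) x - g (x + h)\<bar> ^ CARD('q + 'r)) * indicator (ball 0 R) x \<partial>lborel) \<le> ennreal \<epsilon>"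
    using C2_data_translate[OF U(1), of h] U(2) sub Lop_shift[OF h]
    by (intro exI[of _ "\<lambda>x. U (x + h)"] exI[of _ "\<lambda>x. G (x + h)"] exI[of _ "\<lambda>x. H (x + h)"]) auto
qed

lemma gsol_lincomb:
  assumes gs: "gsol z g" and gs': "gsol z' g'"
  shows "gsol (\<lambda>x. c * z x + c' * z' x) (\<lambda>x. c * g x + c' * g' x)"
  unfolding gsol_def
proof (intro conjI allI impI)
  let ?n = "CARD('q + 'r)"
  have cz: "continuous_on UNIV z" "continuous_on UNIV z'" and cg: "continuous_on UNIV g" "continuous_on UNIV g'"
    using gs gs' by (auto simp: gsol_def)
  show "continuous_on UNIV (\<lambda>x. c * z x + c' * z' x)" "continuous_on UNIV (\<lambda>x. c * g x + c' * g' x)"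
    by (intro continuous_intros cz cg)+
  fix R \<epsilon> :: real assume R: "0 < R" and e: "0 < \<epsilon>"
  \<comment> \<open>\<open>S\<close> dominates both the loss in the uniform estimate and the loss in
    the integral, so a single \<open>\<eta>\<close> works for both.\<close>
  define S where "S = 2 ^ ?n * (\<bar>c\<bar> ^ ?n + \<bar>c'\<bar> ^ ?n) + \<bar>c\<bar> + \<bar>c'\<bar> + 1"
  have S: "0 < S" "\<bar>c\<bar> + \<bar>c'\<bar> \<le> S" "2 ^ ?n * (\<bar>c\<bar> ^ ?n + \<bar>c'\<bar> ^ ?n) \<le> S"
    by (auto simp: S_def intro!: add_nonneg_pos add_nonneg_nonneg)
  define \<eta> where "\<eta> = \<epsilon> / S"
  have eta: "0 < \<eta>" "S * \<eta> = \<epsilon>" using S e by (auto simp: \<eta>_def)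
  obtain U G H where U: "C2_data U G H" "\<forall>x\<in>ball 0 R. \<bar>U x - z x\<bar> \<le> \<eta>"
    "(\<integral>\<^sup>+ x. ennreal (\<bar>Lop a (H x) x - g x\<bar> ^ ?n) * indicator (ball 0 R) x \<partial>lborel) \<le> ennreal \<eta>"
    using gs R eta unfolding gsol_def by meson
  obtain U' G' H' where U': "C2_data U' G' H'" "\<forall>x\<in>ball 0 R. \<bar>U' x - z' x\<bar> \<le> \<eta>"
    "(\<integral>\<^sup>+ x. ennreal (\<bar>Lop a (H' x) x - g' x\<bar> ^ ?n) * indicator (ball 0 R) x \<partial>lborel) \<le> ennreal \<eta>"
    using gs' R eta unfolding gsol_def by meson
  define r where "r x = \<bar>Lop a (H x) x - g x\<bar>" for x
  define r' where "r' x = \<bar>Lop a (H' x) x - g' x\<bar>" for x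
  have cr: "continuous_on UNIV r" "continuous_on UNIV r'" unfolding r_def r'_def
    by (intro continuous_on_rabs continuous_on_residual[OF U(1) cg(1)] continuous_on_residual[OF U'(1) cg(2)])+
  have mr [measurable]: "r \<in> borel_measurable borel" "r' \<in> borel_measurable borel"
    using cr by (auto intro: borel_measurable_continuous_onI)
  have bd: "\<bar>c * U x + c' * U' x - (c * z x + c' * z' x)\<bar> \<le> \<epsilon>" if "x \<in> ball 0 R" for x
  proof -
    have "\<bar>c * U x + c' * U' x - (c * z x + c' * z' x)\<bar> \<le> \<bar>c\<bar> * \<bar>U x - z x\<bar> + \<bar>c'\<bar> * \<bar>U' x - z' x\<bar>"
      unfolding abs_mult[symmetric] by (simp add: right_diff_distrib)
    also have "\<dots> \<le> \<bar>c\<bar> * \<eta> + \<bar>c'\<bar> * \<eta>" using U(2) U'(2) that by (intro add_mono mult_left_mono) auto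
    also have "\<dots> = (\<bar>c\<bar> + \<bar>c'\<bar>) * \<eta>" by (simp add: distrib_right)
    also have "\<dots> \<le> S * \<eta>" using S eta by (intro mult_right_mono) auto
    finally show ?thesis using eta by simp
  qed
  have pt: "\<bar>Lop a (c *\<^sub>R H x + c' *\<^sub>R H' x) x - (c * g x + c' * g' x)\<bar> ^ ?n
      \<le> 2 ^ ?n * \<bar>c\<bar> ^ ?n * r x ^ ?n + 2 ^ ?n * \<bar>c'\<bar> ^ ?n * r' x ^ ?n" for x
  proof -
    have "\<bar>Lop a (c *\<^sub>R H x + c' *\<^sub>R H' x) x - (c * g x + c' * g' x)\<bar> \<le> \<bar>c\<bar> * r x + \<bar>c'\<bar> * r' x"
      unfolding abs_mult[symmetric] r_def r'_def by (simp add: Lop_add Lop_scaleR right_diff_distrib)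
    then have "\<bar>Lop a (c *\<^sub>R H x + c' *\<^sub>R H' x) x - (c * g x + c' * g' x)\<bar> ^ ?n \<le> (\<bar>c\<bar> * r x + \<bar>c'\<bar> * r' x) ^ ?n"
      by (intro power_mono) auto
    also have "\<dots> \<le> 2 ^ ?n * ((\<bar>c\<bar> * r x) ^ ?n + (\<bar>c'\<bar> * r' x) ^ ?n)"
      by (intro add_power_le) (auto simp: r_def r'_def)
    finally show ?thesis by (simp add: power_mult_distrib algebra_simps)
  qed
  have r0: "0 \<le> r x" "0 \<le> r' x" for x by (auto simp: r_def r'_def)
  have "(\<integral>\<^sup>+ x. ennreal (\<bar>Lop a (c *\<^sub>R H x + c' *\<^sub>R H' x) x - (c * g x + c' * g' x)\<bar> ^ ?n) * indicator (ball 0 R) x \<partial>lborel)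
     \<le> (\<integral>\<^sup>+ x. ennreal (2 ^ ?n * \<bar>c\<bar> ^ ?n) * (ennreal (r x ^ ?n) * indicator (ball 0 R) x)
           + ennreal (2 ^ ?n * \<bar>c'\<bar> ^ ?n) * (ennreal (r' x ^ ?n) * indicator (ball 0 R) x) \<partial>lborel)"
  proof (rule nn_integral_mono)
    fix x
    have "ennreal (\<bar>Lop a (c *\<^sub>R H x + c' *\<^sub>R H' x) x - (c * g x + c' * g' x)\<bar> ^ ?n) \<le>
       ennreal (2 ^ ?n * \<bar>c\<bar> ^ ?n * r x ^ ?n + 2 ^ ?n * \<bar>c'\<bar> ^ ?n * r' x ^ ?n)" using pt by (rule ennreal_leI)
    also have "\<dots> = ennreal (2 ^ ?n * \<bar>c\<bar> ^ ?n) * ennreal (r x ^ ?n) + ennreal (2 ^ ?n * \<bar>c'\<bar> ^ ?n) * ennreal (r' x ^ ?n)"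
      using r0 by (simp add: ennreal_mult)
    finally show "ennreal (\<bar>Lop a (c *\<^sub>R H x + c' *\<^sub>R H' x) x - (c * g x + c' * g' x)\<bar> ^ ?n) * indicator (ball 0 R) x \<le>
       ennreal (2 ^ ?n * \<bar>c\<bar> ^ ?n) * (ennreal (r x ^ ?n) * indicator (ball 0 R) x)
           + ennreal (2 ^ ?n * \<bar>c'\<bar> ^ ?n) * (ennreal (r' x ^ ?n) * indicator (ball 0 R) x)"
      by (auto simp: indicator_def)
  qed
  also have "\<dots> = ennreal (2 ^ ?n * \<bar>c\<bar> ^ ?n) * (\<integral>\<^sup>+ x. ennreal (r x ^ ?n) * indicator (ball 0 R) x \<partial>lborel)
      + ennreal (2 ^ ?n * \<bar>c'\<bar> ^ ?n) * (\<integral>\<^sup>+ x. ennreal (r' x ^ ?n) * indicator (ball 0 R) x \<partial>lborel)"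
  proof -
    have "(\<lambda>x. ennreal (r x ^ ?n)) \<in> borel_measurable lborel" "(\<lambda>x. ennreal (r' x ^ ?n)) \<in> borel_measurable lborel"
      by measurable
    then have "(\<lambda>x. ennreal (r x ^ ?n) * indicator (ball 0 R) x) \<in> borel_measurable lborel"
      "(\<lambda>x. ennreal (r' x ^ ?n) * indicator (ball 0 R) x) \<in> borel_measurable lborel"
      by (intro borel_measurable_times_ennreal borel_measurable_indicator; simp)+
    then show ?thesis by (simp add: nn_integral_add nn_integral_cmult)
  qed
  also have "\<dots> \<le> ennreal (2 ^ ?n * \<bar>c\<bar> ^ ?n) * ennreal \<eta> + ennreal (2 ^ ?n * \<bar>c'\<bar> ^ ?n) * ennreal \<eta>"
    using U(3) U'(3) by (intro add_mono mult_left_mono) (auto simp: r_def r'_def)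
  also have "\<dots> = ennreal ((2 ^ ?n * (\<bar>c\<bar> ^ ?n + \<bar>c'\<bar> ^ ?n)) * \<eta>)"
    using eta by (simp add: ennreal_mult[symmetric] ennreal_plus[symmetric] algebra_simps del: ennreal_plus)
  also have "\<dots> \<le> ennreal (S * \<eta>)"
    using S eta by (intro ennreal_leI mult_right_mono) auto
  finally show "\<exists>U G H. C2_data U G H \<and> (\<forall>x\<in>ball 0 R. \<bar>U x - (c * z x + c' * z' x)\<bar> \<le> \<epsilon>) \<and>
    (\<integral>\<^sup>+ x. ennreal (\<bar>Lop a (H x) x - (c * g x + c' * g' x)\<bar> ^ ?n) * indicator (ball 0 R) x \<partial>lborel) \<le> ennreal \<epsilon>"
    using bd C2_data_lincomb[OF U(1) U'(1), of c c'] eta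
    by (intro exI[of _ "\<lambda>x. c * U x + c' * U' x"] exI[of _ "\<lambda>x. c *\<^sub>R G x + c' *\<^sub>R G' x"]
        exI[of _ "\<lambda>x. c *\<^sub>R H x + c' *\<^sub>R H' x"]) auto
qed

lemma gsol_zero: "gsol (\<lambda>x. 0) (\<lambda>x. 0)"
  unfolding gsol_def
  by (auto intro!: exI[of _ "\<lambda>x. 0"] C2_data_const simp: Lop_zero power_0_left)

lemma gsol_sum:
  assumes "\<And>j. j \<in> I \<Longrightarrow> gsol (z j) (g j)"
  shows "gsol (\<lambda>x. \<Sum>j\<in>I. c j * z j x) (\<lambda>x. \<Sum>j\<in>I. c j * g j x)"
  using assms
proof (induction I rule: infinite_finite_induct)
  case (insert k I)
  then have "gsol (\<lambda>x. c k * z k x + 1 * (\<Sum>j\<in>I. c j * z j x)) (\<lambda>x. c k * g k x + 1 * (\<Sum>j\<in>I. c j * g j x))"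
    by (intro gsol_lincomb) auto
  then show ?case using insert by simp
qed (simp_all add: gsol_zero)

text \<open>The Bernstein argument with every error kept. The maximum principle is applied on the
  ball of radius \<open>\<rho>\<close> to w = V^2 + A Y^2 - \<theta> |x - x0|^2 - W1, where the
  hypothesis \<open>rho\<close> makes w nonpositive on the sphere and \<open>\<kappa>\<close> is a
  lower bound for w at the centre. The factor of \<open>\<epsilon>\<close> in the conclusion does
  not itself involve \<open>\<epsilon>\<close>, so \<open>\<epsilon>\<close> can later tend to zero
  with \<open>\<sigma>\<close>, \<open>\<theta>\<close> and \<open>\<rho>\<close> fixed.\<close>

lemma interp_step:
  fixes z g :: "('q, 'r) pt \<Rightarrow> real"
  assumes gs: "gsol z g" and Z: "\<And>x. \<bar>z x\<bar> \<le> Z" and Gb: "\<And>x. \<bar>g x\<bar> \<le> Gb"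
    and h: "hor h" "h \<noteq> 0" and A: "0 < A" and e: "0 < \<epsilon>" "\<epsilon> \<le> 1" and pos: "0 < \<sigma>" "0 < \<theta>" "0 < \<rho>"
    and Vb: "Vb = (2 * Z + 2) / norm h"
    and rho: "Vb\<^sup>2 + A * (Z + 1)\<^sup>2 \<le> \<theta> * \<rho>\<^sup>2 + W1"
    and par: "(2 * Gb / norm h)\<^sup>2 / (A * \<nu>) + 2 * A * (Z + \<epsilon>) * Gb + A\<^sup>2 * \<nu> * (Z + \<epsilon>)\<^sup>2
        + 4 * A * \<nu> * \<sigma> * Vb + 2 * \<theta> * real CARD('q + 'r) / \<nu> \<le> A * \<nu> * W1"
    and w: "0 \<le> \<kappa>" "\<And>V. \<bar>V - (z (x0 + h) - z x0) / norm h\<bar> \<le> 2 * \<epsilon> / norm h \<Longrightarrow> \<kappa> \<le> V\<^sup>2 - W1"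
  shows "\<kappa> ^ CARD('q + 'r) \<le> ABP_const CARD('q + 'r) * \<rho> ^ CARD('q + 'r) * ((4 * Vb / norm h + 2 * A * (Z + 1)) / \<nu>) ^ CARD('q + 'r) * \<epsilon>"
proof -
  let ?n = "CARD('q + 'r)"
  define C where C0: "C = ABP_const ?n"
  have C: "0 \<le> C" by (simp add: C0 ABP_const_nonneg)
  have Z0: "0 \<le> Z" "0 \<le> Gb" using Z[of 0] Gb[of 0] by auto
  have nh: "0 < norm h" using h by simp
  have Vb0: "0 < Vb" using Z0 nh by (simp add: Vb)
  have cg: "continuous_on UNIV g" using gs by (auto simp: gsol_def)
  define R where "R = norm x0 + \<rho> + norm h + 1"
  have R: "0 < R" using pos by (simp add: R_def add_nonneg_pos add_pos_nonneg)
  obtain U G H where U: "C2_data U G H" "\<forall>x\<in>ball 0 R. \<bar>U x - z x\<bar> \<le> \<epsilon>"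
    "(\<integral>\<^sup>+ x. ennreal (\<bar>Lop a (H x) x - g x\<bar> ^ ?n) * indicator (ball 0 R) x \<partial>lborel) \<le> ennreal \<epsilon>"
    using gs R e unfolding gsol_def by meson
  have "0 < \<sigma> * norm h" using pos nh by simp
  from riemann_sum_derivative[OF U(1) this, of x0 \<rho> h] obtain m where m: "m > 0"
    "\<And>x. x \<in> cball x0 \<rho> \<Longrightarrow> \<bar>U (x + h) - U x - (\<Sum>j<m. (1 / real m) *\<^sub>R G (x + (real j / real m) *\<^sub>R h)) \<bullet> h\<bar> \<le> \<sigma> * norm h"
    by blast
  have sub: "x + s *\<^sub>R h \<in> ball 0 R" if "x \<in> cball x0 \<rho>" "0 \<le> s" "s \<le> 1" for x s
  proof -
    have "norm (x + s *\<^sub>R h) \<le> norm x + norm (s *\<^sub>R h)" by (rule norm_triangle_ineq)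
    also have "norm x \<le> norm x0 + dist x0 x" by (metis dist_norm norm_minus_commute norm_triangle_sub)
    also have "dist x0 x \<le> \<rho>" using that by simp
    also have "norm (s *\<^sub>R h) \<le> norm h" using that by (simp add: mult_left_le_one_le)
    finally show ?thesis by (simp add: R_def)
  qed
  have hs: "hor (s *\<^sub>R h)" for s using h by (simp add: hor_def)
  define res where "res x = Lop a (H x) x - g x" for x
  have cres: "continuous_on UNIV (\<lambda>x. \<bar>res x\<bar>)" unfolding res_def
    by (intro continuous_on_rabs continuous_on_residual[OF U(1) cg])
  define V where "V x = (1 / norm h) * U (x + h) + (- 1 / norm h) * U x" for x
  define GV where "GV x = (1 / norm h) *\<^sub>R G (x + h) + (- 1 / norm h) *\<^sub>R G x" for x
  define HV where "HV x = (1 / norm h) *\<^sub>R H (x + h) + (- 1 / norm h) *\<^sub>R H x" for x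
  define Y where "Y x = (\<Sum>j<m. (1 / real m) * U (x + (real j / real m) *\<^sub>R h))" for x
  define GY where "GY x = (\<Sum>j<m. (1 / real m) *\<^sub>R G (x + (real j / real m) *\<^sub>R h))" for x
  define HY where "HY x = (\<Sum>j<m. (1 / real m) *\<^sub>R H (x + (real j / real m) *\<^sub>R h))" for x
  have CV: "C2_data V GV HV" unfolding V_def[abs_def] GV_def[abs_def] HV_def[abs_def]
    by (intro C2_data_lincomb C2_data_translate U(1))
  have CY: "C2_data Y GY HY" unfolding Y_def[abs_def] GY_def[abs_def] HY_def[abs_def]
    by (intro C2_data_sum C2_data_scale C2_data_translate U(1))
  define w where "w x = V x * V x + A * (Y x * Y x) - \<theta> * (norm (x - x0))\<^sup>2 - W1" for x
  define Hw where "Hw x = (V x *\<^sub>R HV x + V x *\<^sub>R HV x + outer (GV x) (GV x) + outer (GV x) (GV x))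
        + A *\<^sub>R (Y x *\<^sub>R HY x + Y x *\<^sub>R HY x + outer (GY x) (GY x) + outer (GY x) (GY x)) - (2 * \<theta>) *\<^sub>R mat 1" for x
  have "\<exists>Gw. C2_data w Gw Hw"
  proof -
    note C2_data_lincomb[OF C2_data_mult[OF CV CV] C2_data_mult[OF CY CY], of 1 A]
    note C2_data_lincomb[OF this C2_data_norm_sq[of x0], of 1 "- \<theta>"]
    note C2_data_lincomb[OF this C2_data_const[of "1"], of 1 "- W1"]
    moreover have "(\<lambda>x. 1 * (1 * (1 * (V x * V x) + A * (Y x * Y x)) + - \<theta> * (norm (x - x0))\<^sup>2) + - W1 * 1) = w"
      by (rule ext) (simp add: w_def)
    moreover have "(\<lambda>x. 1 *\<^sub>R (1 *\<^sub>R (1 *\<^sub>R (V x *\<^sub>R HV x + V x *\<^sub>R HV x + outer (GV x) (GV x) + outer (GV x) (GV x)) +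
        A *\<^sub>R (Y x *\<^sub>R HY x + Y x *\<^sub>R HY x + outer (GY x) (GY x) + outer (GY x) (GY x))) + - \<theta> *\<^sub>R 2 *\<^sub>R mat 1) + - W1 *\<^sub>R 0) = Hw"
      by (rule ext) (simp add: Hw_def mult.commute)
    ultimately show ?thesis by metis
  qed
  then obtain Gw where Cw: "C2_data w Gw Hw" ..
  have Uz: "\<bar>U y - z y\<bar> \<le> \<epsilon>" if "x \<in> cball x0 \<rho>" "0 \<le> s" "s \<le> 1" "y = x + s *\<^sub>R h" for x y s
    using U(2) sub that by auto
  have Ub: "\<bar>U y\<bar> \<le> Z + \<epsilon>" if "x \<in> cball x0 \<rho>" "0 \<le> s" "s \<le> 1" "y = x + s *\<^sub>R h" for x y s
    using Uz[OF that] Z[of y] by linarith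
  have Vbd: "\<bar>V x\<bar> \<le> Vb" if "x \<in> cball x0 \<rho>" for x
  proof -
    have "\<bar>U (x + h)\<bar> \<le> Z + \<epsilon>" "\<bar>U x\<bar> \<le> Z + \<epsilon>"
      using Ub[OF that, of 1] Ub[OF that, of 0] by auto
    then have "\<bar>U (x + h) - U x\<bar> \<le> 2 * Z + 2" using e by linarith
    then have "\<bar>U (x + h) - U x\<bar> / norm h \<le> Vb" using nh by (simp add: Vb divide_right_mono)
    moreover have "V x = (U (x + h) - U x) / norm h" by (simp add: V_def diff_divide_distrib)
    ultimately show ?thesis by simp
  qed
  have sum_le: "\<bar>\<Sum>j<m. (1 / real m) * f j\<bar> \<le> b" if "\<And>j. j < m \<Longrightarrow> \<bar>f j\<bar> \<le> b" for f b
  proof -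
    have "\<bar>\<Sum>j<m. (1 / real m) * f j\<bar> \<le> (\<Sum>j<m. (1 / real m) * b)"
      by (rule order.trans[OF sum_abs sum_mono]) (use that in \<open>auto simp: abs_mult intro!: divide_right_mono\<close>)
    then show ?thesis using m(1) by simp
  qed
  have jm: "0 \<le> real j / real m" "real j / real m \<le> 1" if "j < m" for j
    using that by auto
  have Ybd: "\<bar>Y x\<bar> \<le> Z + \<epsilon>" if "x \<in> cball x0 \<rho>" for x
    unfolding Y_def using Ub[OF that] jm by (intro sum_le) blast
  \<comment> \<open>Indices k < m are the nodes of the mean, k = m is the shift by h, and k = m + 1
    is the point itself; the weights come from the bound in \<open>bernstein_pointwise\<close>.
    Their total \<open>S\<close> is independent of m, which matters because m depends on the
    approximant.\<close>
  define c where "c k = (if k < m then 2 * A * (Z + \<epsilon>) / \<nu> / real m else 2 * Vb / norm h / \<nu>)" for k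
  define v where "v k = (if k < m then (real k / real m) *\<^sub>R h else if k = m then h else 0)" for k
  define r where "r x = (\<Sum>k<m+2. c k * \<bar>res (x + v k)\<bar>)" for x
  have c0: "0 \<le> c k" for k using A Z0 e nu Vb0 by (simp add: c_def)
  have r0: "0 \<le> r x" for x unfolding r_def using c0 by (intro sum_nonneg) auto
  have cr: "continuous_on UNIV r" unfolding r_def
    by (intro continuous_on_sum continuous_on_mult continuous_on_const continuous_on_compose2[OF cres])
      (auto intro!: continuous_intros)
  define S where "S = (4 * Vb / norm h + 2 * A * (Z + \<epsilon>)) / \<nu>"
  have Ssum: "(\<Sum>k<m+2. c k) = S"
  proof -
    have "(\<Sum>k<m. c k) = 2 * A * (Z + \<epsilon>) / \<nu>" using m(1) by (simp add: c_def)
    moreover have "c m = 2 * Vb / norm h / \<nu>" "c (Suc m) = 2 * Vb / norm h / \<nu>" by (simp_all add: c_def)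
    ultimately show ?thesis by (simp add: S_def add_divide_distrib)
  qed
  have S0: "0 < S" using Vb0 nh A Z0 e nu by (auto simp: S_def intro!: divide_pos_pos add_pos_nonneg)
  have rsum: "r x = 2 * A * (Z + \<epsilon>) / \<nu> * (\<Sum>j<m. (1 / real m) * \<bar>res (x + (real j / real m) *\<^sub>R h)\<bar>)
      + 2 * Vb / norm h / \<nu> * (\<bar>res (x + h)\<bar> + \<bar>res x\<bar>)" for x
  proof -
    have "(\<Sum>k<m. c k * \<bar>res (x + v k)\<bar>) = 2 * A * (Z + \<epsilon>) / \<nu> * (\<Sum>j<m. (1 / real m) * \<bar>res (x + (real j / real m) *\<^sub>R h)\<bar>)"
      unfolding sum_distrib_left by (intro sum.cong) (auto simp: c_def v_def)
    moreover have "c m = 2 * Vb / norm h / \<nu>" "c (Suc m) = 2 * Vb / norm h / \<nu>" "v m = h" "v (Suc m) = 0"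
      by (simp_all add: c_def v_def)
    ultimately show ?thesis by (simp add: r_def distrib_left)
  qed
  have trace_le: "- trace (Hw x) \<le> r x" if x: "dist x0 x < \<rho>" "0 < w x" "nsd (Hw x)" for x
  proof -
    have xc: "x \<in> cball x0 \<rho>" using x by simp
    define rV where "rV = (res (x + h) - res x) / norm h"
    define rY where "rY = (\<Sum>j<m. (1 / real m) * res (x + (real j / real m) *\<^sub>R h))"
    have "- trace (Hw x) \<le> (2 * Vb * \<bar>rV\<bar> + 2 * A * (Z + \<epsilon>) * \<bar>rY\<bar>) / \<nu>"
    proof (rule bernstein_pointwise[OF x(3) C2_dataD(4)[OF Cw] Hw_def[of x]])
      show "norm ((1 / norm h) *\<^sub>R h) = 1" using nh by simp
      have "\<bar>GY x \<bullet> h - (U (x + h) - U x)\<bar> \<le> \<sigma> * norm h"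
        using m(2)[OF xc] by (simp add: GY_def abs_minus_commute)
      then have "\<bar>GY x \<bullet> h - (U (x + h) - U x)\<bar> / norm h \<le> \<sigma>" using nh by (simp add: pos_divide_le_eq)
      moreover have "GY x \<bullet> ((1 / norm h) *\<^sub>R h) - V x = (GY x \<bullet> h - (U (x + h) - U x)) / norm h"
        by (simp add: V_def diff_divide_distrib)
      ultimately show "\<bar>GY x \<bullet> ((1 / norm h) *\<^sub>R h) - V x\<bar> \<le> \<sigma>" by simp
      show "\<bar>V x\<bar> \<le> Vb" "\<bar>Y x\<bar> \<le> Z + \<epsilon>" using Vbd Ybd xc by auto
      have "0 \<le> \<theta> * (norm (x - x0))\<^sup>2" using pos by simp
      then show "W1 \<le> V x * V x + A * (Y x * Y x)" using x(2) unfolding w_def by linarith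
      \<comment> \<open>The Hessian at x + h is paired with the coefficients at x. They equal those
        at x + h because h is horizontal.\<close>
      have "Lop a (H (x + h)) x = Lop a (H (x + h)) (x + h)" using Lop_shift h by simp
      then show "Lop a (HV x) x = (g (x + h) - g x) / norm h + rV"
        by (simp add: HV_def rV_def res_def Lop_add Lop_scaleR Lop_diff diff_divide_distrib)
      show "\<bar>(g (x + h) - g x) / norm h\<bar> \<le> 2 * Gb / norm h"
        using Gb[of "x + h"] Gb[of x] nh by (simp add: divide_right_mono)
      show "Lop a (HY x) x = (\<Sum>j<m. (1 / real m) * g (x + (real j / real m) *\<^sub>R h)) + rY"
        unfolding HY_def rY_def res_def Lop_sum Lop_scaleR sum.distrib[symmetric]
        using Lop_shift[OF hs] by (simp add: add_divide_distrib[symmetric])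
      show "\<bar>\<Sum>j<m. (1 / real m) * g (x + (real j / real m) *\<^sub>R h)\<bar> \<le> Gb" using Gb by (intro sum_le)
    qed (use A pos par in auto)
    also have "\<dots> \<le> r x"
    proof -
      have "\<bar>rV\<bar> \<le> (\<bar>res (x + h)\<bar> + \<bar>res x\<bar>) / norm h"
        using nh by (simp add: rV_def divide_right_mono)
      then have "2 * Vb * \<bar>rV\<bar> / \<nu> \<le> 2 * Vb * ((\<bar>res (x + h)\<bar> + \<bar>res x\<bar>) / norm h) / \<nu>"
        using Vb0 nu by (intro divide_right_mono mult_left_mono) auto
      moreover have "\<bar>rY\<bar> \<le> (\<Sum>j<m. (1 / real m) * \<bar>res (x + (real j / real m) *\<^sub>R h)\<bar>)"
        unfolding rY_def by (rule order.trans[OF sum_abs]) (simp add: abs_mult)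
      then have "2 * A * (Z + \<epsilon>) * \<bar>rY\<bar> / \<nu> \<le> 2 * A * (Z + \<epsilon>) * (\<Sum>j<m. (1 / real m) * \<bar>res (x + (real j / real m) *\<^sub>R h)\<bar>) / \<nu>"
        using A Z0 e nu by (intro divide_right_mono mult_left_mono) auto
      moreover have "2 * Vb * ((\<bar>res (x + h)\<bar> + \<bar>res x\<bar>) / norm h) / \<nu> = 2 * Vb / norm h / \<nu> * (\<bar>res (x + h)\<bar> + \<bar>res x\<bar>)"
        "2 * A * (Z + \<epsilon>) * (\<Sum>j<m. (1 / real m) * \<bar>res (x + (real j / real m) *\<^sub>R h)\<bar>) / \<nu> =
         2 * A * (Z + \<epsilon>) / \<nu> * (\<Sum>j<m. (1 / real m) * \<bar>res (x + (real j / real m) *\<^sub>R h)\<bar>)"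
        by simp_all
      ultimately have "2 * Vb * \<bar>rV\<bar> / \<nu> + 2 * A * (Z + \<epsilon>) * \<bar>rY\<bar> / \<nu> \<le> r x"
        unfolding rsum by linarith
      then show ?thesis by (simp only: add_divide_distrib)
    qed
    finally show ?thesis .
  qed
  have bd: "w x \<le> 0" if "dist x0 x = \<rho>" for x
  proof -
    have xc: "x \<in> cball x0 \<rho>" using that by simp
    have "V x * V x \<le> Vb\<^sup>2" using abs_le_imp_power2_le[OF Vbd[OF xc]] by (simp add: power2_eq_square)
    moreover have "\<bar>Y x\<bar> \<le> Z + 1" using Ybd[OF xc] e by linarith
    then have "A * (Y x * Y x) \<le> A * (Z + 1)\<^sup>2"
      using A abs_le_imp_power2_le[of "Y x" "Z + 1"] by (intro mult_left_mono) (auto simp: power2_eq_square)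
    moreover have "norm (x - x0) = \<rho>" using that by (simp add: dist_norm norm_minus_commute)
    ultimately show ?thesis using rho by (simp add: w_def)
  qed
  have wx0: "\<kappa> \<le> w x0"
  proof -
    have x0c: "x0 \<in> cball x0 \<rho>" using pos by simp
    have "\<bar>U (x0 + h) - z (x0 + h)\<bar> \<le> \<epsilon>" "\<bar>U x0 - z x0\<bar> \<le> \<epsilon>"
      using Uz[OF x0c, of 1] Uz[OF x0c, of 0] by auto
    then have "\<bar>(U (x0 + h) - U x0) - (z (x0 + h) - z x0)\<bar> / norm h \<le> 2 * \<epsilon> / norm h"
      by (intro divide_right_mono) auto
    moreover have "V x0 - (z (x0 + h) - z x0) / norm h = ((U (x0 + h) - U x0) - (z (x0 + h) - z x0)) / norm h"
      by (simp add: V_def diff_divide_distrib)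
    ultimately have "\<bar>V x0 - (z (x0 + h) - z x0) / norm h\<bar> \<le> 2 * \<epsilon> / norm h" by simp
    from w(2)[OF this] have "\<kappa> \<le> V x0 * V x0 - W1" by (simp add: power2_eq_square)
    moreover have "0 \<le> A * (Y x0 * Y x0)" using A by simp
    ultimately show ?thesis by (simp add: w_def)
  qed
  have "ennreal (w x0 ^ ?n) \<le> ennreal (C * \<rho> ^ ?n) * (\<integral>\<^sup>+ x. ennreal (r x ^ ?n) * indicator (ball x0 \<rho>) x \<partial>lborel)"
    unfolding C0 using bd trace_le pos(3) wx0 w(1) by (intro ABP[OF Cw pos(3) _ cr r0]) auto
  also have "(\<integral>\<^sup>+ x. ennreal (r x ^ ?n) * indicator (ball x0 \<rho>) x \<partial>lborel)
      \<le> ennreal (S ^ ?n) * (\<integral>\<^sup>+ x. ennreal (\<bar>res x\<bar> ^ ?n) * indicator (ball 0 R) x \<partial>lborel)"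
    unfolding r_def
  proof (rule nn_integral_sum_translates_le[OF cres _ _ c0 Ssum S0])
    fix k x assume "k \<in> {..<m + 2}" and x: "x \<in> ball x0 \<rho>"
    then have xc: "x \<in> cball x0 \<rho>" by simp
    show "x + v k \<in> ball 0 R"
      using sub[OF xc, of 1] sub[OF xc, of 0] sub[OF xc jm] by (auto simp: v_def)
  qed auto
  also have "\<dots> \<le> ennreal (S ^ ?n) * ennreal \<epsilon>" using U(3) by (intro mult_left_mono) (auto simp: res_def)
  finally have "ennreal (w x0 ^ ?n) \<le> ennreal (C * \<rho> ^ ?n) * (ennreal (S ^ ?n) * ennreal \<epsilon>)"
    by (simp add: mult_left_mono)
  also have "\<dots> = ennreal (C * \<rho> ^ ?n * S ^ ?n * \<epsilon>)"
    using C pos S0 e by (simp add: ennreal_mult mult.assoc)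
  finally have "w x0 ^ ?n \<le> C * \<rho> ^ ?n * S ^ ?n * \<epsilon>"
    by (rule iffD1[OF ennreal_le_iff, rotated]) (use C pos S0 e in simp)
  moreover have "\<kappa> ^ ?n \<le> w x0 ^ ?n" using wx0 w(1) by (rule power_mono)
  moreover have "C * \<rho> ^ ?n * S ^ ?n * \<epsilon> \<le> C * \<rho> ^ ?n * ((4 * Vb / norm h + 2 * A * (Z + 1)) / \<nu>) ^ ?n * \<epsilon>"
  proof -
    have "S \<le> (4 * Vb / norm h + 2 * A * (Z + 1)) / \<nu>"
      unfolding S_def using A e nu by (intro divide_right_mono add_left_mono mult_left_mono) auto
    then have "S ^ ?n \<le> ((4 * Vb / norm h + 2 * A * (Z + 1)) / \<nu>) ^ ?n" using S0 by (intro power_mono) auto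
    then show ?thesis using C pos e by (intro mult_right_mono mult_left_mono) auto
  qed
  ultimately show ?thesis unfolding C0[symmetric] by linarith
qed

text \<open>The limit of \<open>interp_step\<close> as \<epsilon>, \<sigma> and \<theta> vanish: the
  bound is what \<open>par\<close> then asks of \<open>W1\<close>, after division by A
  \<nu>.\<close>

lemma interp_sq:
  fixes z g :: "('q, 'r) pt \<Rightarrow> real"
  assumes gs: "gsol z g" and Z: "\<And>x. \<bar>z x\<bar> \<le> Z" and Gb: "\<And>x. \<bar>g x\<bar> \<le> Gb"
    and h: "hor h" "h \<noteq> 0" and A: "0 < A"
  shows "((z (x0 + h) - z x0) / norm h)\<^sup>2 \<le> A * Z\<^sup>2 + 2 * Z * Gb / \<nu> + (2 * Gb / norm h)\<^sup>2 / (A * \<nu>)\<^sup>2"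
    (is "?v\<^sup>2 \<le> ?T")
proof (rule ccontr)
  let ?n = "CARD('q + 'r)"
  assume neg: "\<not> ?v\<^sup>2 \<le> ?T"
  have Z0: "0 \<le> Z" "0 \<le> Gb" using Z[of 0] Gb[of 0] by auto
  have nh: "0 < norm h" using h by simp
  \<comment> \<open>The gap to be refuted is 2 \<kappa>. One \<kappa> raises \<open>W1\<close> above
    the claimed bound and gives room in \<open>par\<close>; the other, halved once more for the
    approximation, survives as excess at \<open>x0\<close>.\<close>
  define \<kappa> where "\<kappa> = (?v\<^sup>2 - ?T) / 2"
  have k0: "0 < \<kappa>" using neg by (simp add: \<kappa>_def)
  define W1 where "W1 = ?T + \<kappa>"
  have W10: "0 \<le> W1" using k0 Z0 A nu by (simp add: W1_def)
  define Vb where "Vb = (2 * Z + 2) / norm h"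
  have Vb0: "0 < Vb" using Z0 nh by (simp add: Vb_def)
  \<comment> \<open>The room A \<nu> \<kappa> in \<open>par\<close> is shared out in quarters:
    \<open>\<sigma>\<close>, \<open>\<theta>\<close> and, through \<open>\<epsilon>0\<close>, the
    approximation error take one each.\<close>
  define \<sigma> where "\<sigma> = \<kappa> / (16 * Vb)"
  define \<theta> where "\<theta> = A * \<nu>\<^sup>2 * \<kappa> / (8 * real ?n)"
  have n0: "0 < real ?n" by (simp add: card_gt_0_iff del: card_sum)
  have pos: "0 < \<sigma>" "0 < \<theta>" using k0 Vb0 A nu n0 by (simp_all add: \<sigma>_def \<theta>_def del: card_sum)
  \<comment> \<open>The summand 1 ensures \<open>1 \<le> \<rho>\<close>, so that a lower bound for
    \<theta> \<rho> is also one for \<open>\<theta> * \<rho>\<^sup>2\<close>.\<close>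
  define \<rho> where "\<rho> = 1 + (Vb\<^sup>2 + A * (Z + 1)\<^sup>2) / \<theta>"
  have rho1: "1 \<le> \<rho>" using pos A by (simp add: \<rho>_def)
  have "\<theta> * \<rho> = \<theta> + (Vb\<^sup>2 + A * (Z + 1)\<^sup>2)" using pos by (simp add: \<rho>_def field_simps)
  then have "Vb\<^sup>2 + A * (Z + 1)\<^sup>2 \<le> \<theta> * \<rho>" using pos by linarith
  also have "\<dots> \<le> \<theta> * \<rho>\<^sup>2" using pos rho1 by (simp add: power2_eq_square)
  finally have rho: "Vb\<^sup>2 + A * (Z + 1)\<^sup>2 \<le> \<theta> * \<rho>\<^sup>2 + W1" using W10 by simp
  define B where "B = ABP_const ?n * \<rho> ^ ?n * ((4 * Vb / norm h + 2 * A * (Z + 1)) / \<nu>) ^ ?n"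
  have B0: "0 \<le> B" unfolding B_def using ABP_const_nonneg[of ?n] rho1 Vb0 nh A Z0 nu by (intro mult_nonneg_nonneg zero_le_power divide_nonneg_pos) auto
  \<comment> \<open>\<open>P\<close> bounds the growth in \<epsilon> of the terms of
    \<open>par\<close> that contain Z + \<epsilon>, after \<open>\<epsilon>\<^sup>2\<close> is
    replaced by \<epsilon>.\<close>
  define P where "P = 2 * A * Gb + A\<^sup>2 * \<nu> * (2 * Z + 1)"
  have P0: "0 \<le> P" using A Z0 nu by (simp add: P_def)
  define \<epsilon>0 where "\<epsilon>0 = min 1 (min (A * \<nu> * \<kappa> / 4 / (P + 1)) (\<kappa> * norm h / (8 * (\<bar>?v\<bar> + 1))))"
  have e0: "0 < \<epsilon>0" using A nu k0 P0 nh by (auto simp: \<epsilon>0_def intro!: divide_pos_pos mult_pos_pos add_nonneg_pos)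
  have main: "(\<kappa> / 2) ^ ?n \<le> B * \<epsilon>" if e: "0 < \<epsilon>" "\<epsilon> \<le> \<epsilon>0" for \<epsilon>
  proof -
    have e1: "\<epsilon> \<le> 1" using e by (simp add: \<epsilon>0_def)
    have eP: "\<epsilon> * P \<le> A * \<nu> * \<kappa> / 4"
    proof -
      have "\<epsilon> \<le> A * \<nu> * \<kappa> / 4 / (P + 1)" using e by (simp add: \<epsilon>0_def)
      then have "\<epsilon> * (P + 1) \<le> A * \<nu> * \<kappa> / 4" by (rule iffD1[OF pos_le_divide_eq, rotated]) (use P0 in simp)
      then show ?thesis using e by (simp add: distrib_left)
    qed
    have ev: "2 * \<epsilon> / norm h * \<bar>?v\<bar> \<le> \<kappa> / 4"
    proof -
      have "\<epsilon> \<le> \<kappa> * norm h / (8 * (\<bar>?v\<bar> + 1))" using e by (simp add: \<epsilon>0_def)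
      then have "\<epsilon> * (8 * (\<bar>?v\<bar> + 1)) \<le> \<kappa> * norm h" by (subst (asm) pos_le_divide_eq) (auto intro: add_nonneg_pos)
      then have "\<epsilon> * (8 * \<bar>?v\<bar>) \<le> \<kappa> * norm h" using e(1) by (simp only: distrib_left)
      then have "\<epsilon> * (8 * \<bar>?v\<bar>) / norm h \<le> \<kappa>" using nh by (simp only: pos_divide_le_eq)
      then show ?thesis by (simp add: mult_ac)
    qed
    have par: "(2 * Gb / norm h)\<^sup>2 / (A * \<nu>) + 2 * A * (Z + \<epsilon>) * Gb + A\<^sup>2 * \<nu> * (Z + \<epsilon>)\<^sup>2
        + 4 * A * \<nu> * \<sigma> * Vb + 2 * \<theta> * real ?n / \<nu> \<le> A * \<nu> * W1"
    proof -
      have "4 * A * \<nu> * \<sigma> * Vb = A * \<nu> * \<kappa> / 4" using Vb0 by (simp add: \<sigma>_def)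
      moreover have "2 * \<theta> * real ?n / \<nu> = A * \<nu> * \<kappa> / 4"
        using n0 nu by (simp add: \<theta>_def power2_eq_square del: card_sum)
      moreover have "A * \<nu> * ?T = A\<^sup>2 * \<nu> * Z\<^sup>2 + 2 * A * Z * Gb + (2 * Gb / norm h)\<^sup>2 / (A * \<nu>)"
        using A nu by (simp add: distrib_left power2_eq_square mult_ac)
      moreover have "2 * A * (Z + \<epsilon>) * Gb + A\<^sup>2 * \<nu> * (Z + \<epsilon>)\<^sup>2 \<le> 2 * A * Z * Gb + A\<^sup>2 * \<nu> * Z\<^sup>2 + \<epsilon> * P"
      proof -
        have "A\<^sup>2 * \<nu> * \<epsilon>\<^sup>2 \<le> A\<^sup>2 * \<nu> * \<epsilon>" using A nu e e1 by (intro mult_left_mono) (auto simp: power2_eq_square)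
        moreover have "2 * A * (Z + \<epsilon>) * Gb + A\<^sup>2 * \<nu> * (Z + \<epsilon>)\<^sup>2 = 2 * A * Z * Gb + A\<^sup>2 * \<nu> * Z\<^sup>2
           + (2 * A * Gb * \<epsilon> + A\<^sup>2 * \<nu> * (2 * Z) * \<epsilon>) + A\<^sup>2 * \<nu> * \<epsilon>\<^sup>2"
          by (simp add: power2_eq_square algebra_simps)
        moreover have "\<epsilon> * P = (2 * A * Gb * \<epsilon> + A\<^sup>2 * \<nu> * (2 * Z) * \<epsilon>) + A\<^sup>2 * \<nu> * \<epsilon>"
          by (simp add: P_def algebra_simps)
        ultimately show ?thesis by linarith
      qed
      moreover have "A * \<nu> * W1 = A * \<nu> * ?T + A * \<nu> * \<kappa>" by (simp add: W1_def distrib_left)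
      moreover have "0 < A * \<nu> * \<kappa>" using A nu k0 by simp
      ultimately show ?thesis using eP by linarith
    qed
    show ?thesis unfolding B_def
    proof (rule interp_step[OF gs Z Gb h A e(1) e1 pos _ Vb_def rho par])
      show "0 < \<rho>" using rho1 by simp
      show "0 \<le> \<kappa> / 2" using k0 by simp
      fix V assume V: "\<bar>V - ?v\<bar> \<le> 2 * \<epsilon> / norm h"
      have "- (?v * (V - ?v)) \<le> \<bar>?v\<bar> * (2 * \<epsilon> / norm h)" by (rule neg_mult_le[OF order_refl V])
      also have "\<dots> \<le> \<kappa> / 4" using ev by (simp add: mult.commute)
      finally have "- (\<kappa> / 4) \<le> ?v * (V - ?v)" by linarith
      moreover have "V\<^sup>2 = ?v\<^sup>2 + 2 * (?v * (V - ?v)) + (V - ?v)\<^sup>2" by (simp add: power2_eq_square algebra_simps)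
      moreover have "0 \<le> (V - ?v)\<^sup>2" by simp
      moreover have "s = T + 2 * k" if "k = (s - T) / 2" for s T k :: real using that by simp
      from this[OF \<kappa>_def] have "?v\<^sup>2 = ?T + 2 * \<kappa>" .
      ultimately show "\<kappa> / 2 \<le> V\<^sup>2 - W1" unfolding W1_def by linarith
    qed
  qed
  define \<epsilon> where "\<epsilon> = min \<epsilon>0 ((\<kappa> / 2) ^ ?n / (2 * (B + 1)))"
  have kn: "0 < (\<kappa> / 2) ^ ?n" using k0 by simp
  have B1: "0 < 2 * (B + 1)" using B0 by simp
  have e: "0 < \<epsilon>" "\<epsilon> \<le> \<epsilon>0" "\<epsilon> \<le> (\<kappa> / 2) ^ ?n / (2 * (B + 1))"
    using e0 divide_pos_pos[OF kn B1] by (auto simp: \<epsilon>_def simp del: card_sum)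
  have "\<epsilon> * (2 * (B + 1)) \<le> (\<kappa> / 2) ^ ?n" using e(3) B1 by (simp only: pos_le_divide_eq)
  then have "B * \<epsilon> + (B * \<epsilon> + 2 * \<epsilon>) \<le> (\<kappa> / 2) ^ ?n" by (simp only: algebra_simps)
  moreover have "0 \<le> B * \<epsilon>" using B0 e by simp
  ultimately have "B * \<epsilon> < (\<kappa> / 2) ^ ?n" using e(1) by linarith
  then show False using main[OF e(1,2)] by linarith
qed

text \<open>The choice A = 1 / (K |h|)^2 in \<open>interp_sq\<close>. With X = Z / K and Y = K^2
  |h|^2 Gb / \<nu> the right-hand side times |h|^2 is at most X^2 + 2 X Y + 4 Y^2, which lies below
  (2 X + 3 Y)^2. A large K buys a small factor of sup |z| at the cost of K^2 on the source.\<close>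

lemma interp:
  fixes z g :: "('q, 'r) pt \<Rightarrow> real"
  assumes gs: "gsol z g" and Z: "\<And>x. \<bar>z x\<bar> \<le> Z" and Gb: "\<And>x. \<bar>g x\<bar> \<le> Gb"
    and h: "hor h" and K: "1 \<le> K"
  shows "\<bar>z (x0 + h) - z x0\<bar> \<le> 2 * Z / K + 3 * K\<^sup>2 * (norm h)\<^sup>2 * Gb / \<nu>"
proof -
  have Z0: "0 \<le> Z" "0 \<le> Gb" using Z[of 0] Gb[of 0] by auto
  show ?thesis
  proof (cases "h = 0")
    case True
    then show ?thesis using Z0 K nu by simp
  next
    case False
    then have nh: "0 < norm h" by simp
    define A where "A = 1 / (K * norm h)\<^sup>2"
    have A: "0 < A" using nh K by (simp add: A_def)
    let ?D = "z (x0 + h) - z x0"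
    define X where "X = Z / K"
    define Y where "Y = K\<^sup>2 * (norm h)\<^sup>2 * Gb / \<nu>"
    have XY: "0 \<le> X" "0 \<le> Y" using Z0 K nu by (simp_all add: X_def Y_def)
    have "?D\<^sup>2 = (norm h)\<^sup>2 * (?D / norm h)\<^sup>2" using nh by (simp add: power_divide)
    also have "\<dots> \<le> (norm h)\<^sup>2 * (A * Z\<^sup>2 + 2 * Z * Gb / \<nu> + (2 * Gb / norm h)\<^sup>2 / (A * \<nu>)\<^sup>2)"
      using interp_sq[OF gs Z Gb h False A] by (intro mult_left_mono) auto
    also have "\<dots> = X\<^sup>2 + 2 * (norm h)\<^sup>2 * Z * Gb / \<nu> + 4 * Y\<^sup>2"
    proof -
      have "t\<^sup>2 * (1 / (K * t)\<^sup>2 * Z\<^sup>2) = (Z / K)\<^sup>2"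
        and "t\<^sup>2 * ((2 * Gb / t)\<^sup>2 / (1 / (K * t)\<^sup>2 * \<nu>)\<^sup>2) = 4 * (K\<^sup>2 * t\<^sup>2 * Gb / \<nu>)\<^sup>2" if "0 < t" for t
        using that K nu by (simp_all add: field_simps power2_eq_square)
      from this[OF nh] show ?thesis unfolding A_def X_def Y_def distrib_left by simp
    qed
    also have "2 * (norm h)\<^sup>2 * Z * Gb / \<nu> \<le> 2 * X * Y"
    proof -
      have "2 * X * Y = K * (2 * (norm h)\<^sup>2 * Z * Gb / \<nu>)" using K by (simp add: X_def Y_def power2_eq_square)
      moreover have "0 \<le> 2 * (norm h)\<^sup>2 * Z * Gb / \<nu>" using Z0 nu by simp
      ultimately show ?thesis using K by (metis mult_1 mult_right_mono)
    qed
    also have "X\<^sup>2 + 2 * X * Y + 4 * Y\<^sup>2 \<le> (2 * X + 3 * Y)\<^sup>2"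
      using XY by (simp add: power2_eq_square algebra_simps)
    finally have "?D\<^sup>2 \<le> (2 * X + 3 * Y)\<^sup>2" by simp
    then have "\<bar>?D\<bar> \<le> 2 * X + 3 * Y" using XY by (simp add: abs_le_square_iff[symmetric])
    then show ?thesis by (simp add: X_def Y_def mult_ac)
  qed
qed

end

section \<open>Bootstrapping third differences\<close>

definition diff2 :: "'a::real_vector \<Rightarrow> ('a \<Rightarrow> real) \<Rightarrow> 'a \<Rightarrow> real" where
  "diff2 h u x = u (x + 2 *\<^sub>R h) - 2 * u (x + h) + u x"

text \<open>With T the shift by h, this is (T^2 - 1)^2 = (T^2 + 2 T + 1) (T - 1)^2.\<close>

lemma diff2_double: "diff2 (2 *\<^sub>R h) u x = diff2 h u (x + 2 *\<^sub>R h) + 2 * diff2 h u (x + h) + diff2 h u x"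
proof -
  have e1: "x + 2 *\<^sub>R 2 *\<^sub>R h = x + 2 *\<^sub>R h + 2 *\<^sub>R h"
    and e2: "x + h + 2 *\<^sub>R h = x + 2 *\<^sub>R h + h" and e3: "x + h + h = x + 2 *\<^sub>R h"
    by (simp_all only: scaleR_2 add_ac)
  show ?thesis unfolding diff2_def e1 e2 e3 by simp
qed

lemma hor_scaleR [intro]: "hor h \<Longrightarrow> hor (c *\<^sub>R h)"
  and hor_add [intro]: "hor h \<Longrightarrow> hor k \<Longrightarrow> hor (h + k)"
  and hor_diff [intro]: "hor h \<Longrightarrow> hor k \<Longrightarrow> hor (h - k)"
  and hor_zero [simp]: "hor 0"
  by (auto simp: hor_def)

text \<open>The three smallness conditions control, in this order, the interpolation error after
  subtracting the mean, the increment of the mean, and the doubling error. Each costs an eighth of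
  the current constant; together they stay below the half that the iteration allows.\<close>

lemma bootstrap_parameters:
  fixes \<delta> :: real
  assumes "0 < \<delta>" "\<delta> < 1"
  shows "\<exists>(m::nat) K \<mu>. 1 \<le> m \<and> 1 \<le> K \<and> 0 < \<mu> \<and> \<mu> \<le> 1 \<and> 2 * real m powr \<delta> / K \<le> 1 / 8 \<and>
     real m powr (\<delta> - 1) \<le> 1 / 8 \<and> 2 * \<mu> powr \<delta> / (2 powr \<delta> - 1) \<le> 1 / 8"
proof -
  have "((\<lambda>m. real m powr (\<delta> - 1)) \<longlongrightarrow> 0) sequentially"
    using assms by (intro tendsto_neg_powr filterlim_real_sequentially) auto
  then have "\<forall>\<^sub>F m in sequentially. real m powr (\<delta> - 1) < 1 / 8" by (rule order_tendstoD) simp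
  then have "\<forall>\<^sub>F m in sequentially. real m powr (\<delta> - 1) < 1 / 8 \<and> 1 \<le> m"
    using eventually_ge_at_top[of 1] by (rule eventually_conj)
  then obtain m :: nat where m: "real m powr (\<delta> - 1) < 1 / 8" "1 \<le> m"
    unfolding eventually_sequentially by blast
  have two: "1 < 2 powr \<delta>" "2 powr \<delta> \<le> 2" using assms powr_mono[of \<delta> 1 2] gr_one_powr[of 2 \<delta>] by auto
  \<comment> \<open>The solution of 2 \<mu>^\<delta> / (2^\<delta> - 1) = 1/8.\<close>
  define \<mu> where "\<mu> = ((2 powr \<delta> - 1) / 16) powr (1 / \<delta>)"
  have "\<mu> powr \<delta> = ((2 powr \<delta> - 1) / 16) powr 1" using assms by (simp add: \<mu>_def powr_powr del: powr_one')
  also have "\<dots> = (2 powr \<delta> - 1) / 16" using two(1) by (intro powr_one) simp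
  finally have mu: "\<mu> powr \<delta> = (2 powr \<delta> - 1) / 16" .
  have p: "0 < 2 powr \<delta> - 1" using two(1) by linarith
  then have "(2 powr \<delta> - 1) / 16 \<noteq> 0" by (simp only: divide_eq_0_iff) auto
  then have mu0: "0 < \<mu>" by (simp only: \<mu>_def powr_gt_zero not_False_eq_True)
  have "2 powr \<delta> - 1 \<noteq> 0" using p by (rule less_imp_neq[symmetric])
  then have fin: "2 * \<mu> powr \<delta> / (2 powr \<delta> - 1) = 1 / 8" unfolding mu by (simp add: field_simps)
  have p1: "0 \<le> (2 powr \<delta> - 1) / 16" "(2 powr \<delta> - 1) / 16 \<le> 1"
    using less_imp_le[OF p] two(2) by (simp_all only: zero_le_divide_iff divide_le_eq) simp_all
  have "\<mu> \<le> 1 powr (1 / \<delta>)" unfolding \<mu>_def by (intro powr_mono2 p1) (use assms in simp)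
  moreover have "1 \<le> real m powr \<delta>" using m assms by (intro ge_one_powr_ge_zero) auto
  ultimately show ?thesis using m mu0 fin
    by (intro exI[of _ m] exI[of _ "16 * real m powr \<delta>"] exI[of _ \<mu>]) auto
qed

context coeffs
begin

text \<open>One turn of the iteration: a bound with constant \<open>B\<close> improves to N1 F + B /
  2. The cut-off \<open>\<eta>\<close> is the same before and after, which is possible because the
  hypothesis is applied only to multiples of h and k that are at least as long. In \<open>N1\<close>
  the 12 is 3 from \<open>interp\<close> times 4 from the bound on the source, and \<mu> / 2 is the
  smallest ratio |h| / |k| treated directly.\<close>

lemma bootstrap_step:
  fixes u f :: "('q, 'r) pt \<Rightarrow> real"
  assumes gs: "gsol u f" and f: "\<And>x h. hor h \<Longrightarrow> \<bar>f (x + h) - f x\<bar> \<le> F * norm h powr \<delta>"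
    and F: "0 \<le> F" and del: "0 < \<delta>" "\<delta> < 1" and B: "0 \<le> B"
    and par: "1 \<le> m" "1 \<le> K" "0 < \<mu>" "\<mu> \<le> 1" "2 * real m powr \<delta> / K \<le> 1 / 8"
     "real m powr (\<delta> - 1) \<le> 1 / 8" "2 * \<mu> powr \<delta> / (2 powr \<delta> - 1) \<le> 1 / 8"
    and N1: "N1 = 12 * K\<^sup>2 * (\<mu> / 2) powr (\<delta> - 2) / \<nu>"
    and P: "\<And>h k x. hor h \<Longrightarrow> hor k \<Longrightarrow> \<eta> \<le> norm h \<Longrightarrow> \<eta> \<le> norm k \<Longrightarrow>
       \<bar>diff2 h u (x + k) - diff2 h u x\<bar> \<le> B * (norm h)\<^sup>2 * norm k powr \<delta>" and eta: "0 < \<eta>"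
    and h: "hor h" "\<eta> \<le> norm h" and k: "hor k" "\<eta> \<le> norm k"
  shows "\<bar>diff2 h u (x + k) - diff2 h u x\<bar> \<le> (N1 * F + B / 2) * (norm h)\<^sup>2 * norm k powr \<delta>"
proof -
  define Z where "Z h x = diff2 h u x / (norm h)\<^sup>2" for h x
  have ZP: "\<bar>Z h (x + k) - Z h x\<bar> \<le> B * norm k powr \<delta>"
    if "hor h" "hor k" "\<eta> \<le> norm h" "\<eta> \<le> norm k" for h k x
  proof -
    have "0 < norm h" using that(3) eta by linarith
    then have "0 < (norm h)\<^sup>2" by (rule zero_less_power)
    moreover have "Z h (x + k) - Z h x = (diff2 h u (x + k) - diff2 h u x) / (norm h)\<^sup>2"
      by (simp add: Z_def diff_divide_distrib)
    ultimately show ?thesis using P[OF that, of x] by (simp add: pos_divide_le_eq mult_ac)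
  qed
  let ?\<kappa> = "norm k"
  have k0: "0 < ?\<kappa>" using k eta by linarith
  have big: "\<bar>Z h (x + k) - Z h x\<bar> \<le> (N1 * F + B / 4) * ?\<kappa> powr \<delta>"
    if h: "hor h" "\<eta> \<le> norm h" and hk: "\<mu> * ?\<kappa> / 2 \<le> norm h" for h x
  proof -
    have h0: "0 < norm h" using h eta by linarith
    \<comment> \<open>The mean over translates is subtracted so that \<open>z\<close> is bounded in
      terms of \<open>B\<close>. The coefficients 1 and -1 are written out to match
      \<open>gsol_lincomb\<close> and \<open>gsol_sum\<close>.\<close>
    define z where "z x = 1 * Z h x + (-1) * (\<Sum>j<m. (1 / real m) * Z h (x + real j *\<^sub>R k))" for x
    define w where "w x = diff2 h f x / (norm h)\<^sup>2" for x
    define g where "g x = 1 * w x + (-1) * (\<Sum>j<m. (1 / real m) * w (x + real j *\<^sub>R k))" for x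
    have m0: "0 < real m" using par by simp
    have "gsol (\<lambda>x. (1 / (norm h)\<^sup>2) * u (x + 2 *\<^sub>R h) + 1 * ((- 2 / (norm h)\<^sup>2) * u (x + h) + (1 / (norm h)\<^sup>2) * u x))
       (\<lambda>x. (1 / (norm h)\<^sup>2) * f (x + 2 *\<^sub>R h) + 1 * ((- 2 / (norm h)\<^sup>2) * f (x + h) + (1 / (norm h)\<^sup>2) * f x))"
      using h by (intro gsol_lincomb gsol_translate gs hor_scaleR)
    moreover have "(\<lambda>x. (1 / (norm h)\<^sup>2) * u (x + 2 *\<^sub>R h) + 1 * ((- 2 / (norm h)\<^sup>2) * u (x + h) + (1 / (norm h)\<^sup>2) * u x)) = Z h"
      "(\<lambda>x. (1 / (norm h)\<^sup>2) * f (x + 2 *\<^sub>R h) + 1 * ((- 2 / (norm h)\<^sup>2) * f (x + h) + (1 / (norm h)\<^sup>2) * f x)) = w"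
      by (auto simp: Z_def w_def diff2_def diff_divide_distrib add_divide_distrib)
    ultimately have "gsol (Z h) w" by simp
    then have gz: "gsol z g" unfolding z_def[abs_def] g_def[abs_def]
      using k by (intro gsol_lincomb gsol_sum gsol_translate hor_scaleR)
    have avg: "1 * F x + (-1) * (\<Sum>j<m. (1 / real m) * F (x + real j *\<^sub>R k)) =
        (\<Sum>j<m. (1 / real m) * (F x - F (x + real j *\<^sub>R k)))" for F :: "('q,'r) pt \<Rightarrow> real" and x
      using m0 by (simp add: right_diff_distrib sum_subtractf diff_divide_distrib)
    have avg_le: "\<bar>\<Sum>j<m. (1 / real m) * t j\<bar> \<le> b" if "\<And>j. j < m \<Longrightarrow> \<bar>t j\<bar> \<le> b" for t b
    proof -
      have "\<bar>\<Sum>j<m. (1 / real m) * t j\<bar> \<le> (\<Sum>j<m. (1 / real m) * b)"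
        by (rule order.trans[OF sum_abs sum_mono]) (use that in \<open>auto simp: abs_mult intro!: divide_right_mono\<close>)
      then show ?thesis using m0 by simp
    qed
    \<comment> \<open>j = 0 is treated apart, since a step of length zero lies below the cut-off
      \<open>\<eta>\<close>.\<close>
    have Zj: "\<bar>Z h (x + real j *\<^sub>R k) - Z h x\<bar> \<le> B * (real m * ?\<kappa>) powr \<delta>" if "j \<le> m" for x j
    proof (cases "j = 0")
      case True
      then show ?thesis using B by simp
    next
      case False
      have "1 * ?\<kappa> \<le> real j * ?\<kappa>" using False k0 by (intro mult_right_mono) auto
      then have "\<eta> \<le> norm (real j *\<^sub>R k)" using k by simp
      then have "\<bar>Z h (x + real j *\<^sub>R k) - Z h x\<bar> \<le> B * norm (real j *\<^sub>R k) powr \<delta>"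
        using h k by (intro ZP) auto
      also have "\<dots> \<le> B * (real m * ?\<kappa>) powr \<delta>"
        using B that del by (intro mult_left_mono powr_mono2) (auto intro: mult_right_mono)
      finally show ?thesis .
    qed
    have zb: "\<bar>z x\<bar> \<le> B * (real m * ?\<kappa>) powr \<delta>" for x
      unfolding z_def avg using Zj by (intro avg_le) (simp add: abs_minus_commute)
    have wb: "\<bar>w x\<bar> \<le> 2 * F * norm h powr (\<delta> - 2)" for x
    proof -
      have e: "x + 2 *\<^sub>R h = x + h + h" by (simp only: scaleR_2 add_ac)
      have "diff2 h f x = (f (x + h + h) - f (x + h)) - (f (x + h) - f x)" unfolding diff2_def e by simp
      then have "\<bar>diff2 h f x\<bar> \<le> 2 * F * norm h powr \<delta>"
        using f[OF h(1), of "x + h"] f[OF h(1), of x] by linarith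
      then have "\<bar>w x\<bar> \<le> 2 * F * norm h powr \<delta> / (norm h)\<^sup>2"
        by (simp add: w_def divide_right_mono)
      also have "\<dots> = 2 * F * norm h powr (\<delta> - 2)" using h0 by (simp add: powr_diff)
      finally show ?thesis .
    qed
    have gb: "\<bar>g x\<bar> \<le> 4 * F * (\<mu> * ?\<kappa> / 2) powr (\<delta> - 2)" for x
    proof -
      have "\<bar>w x - w (x + real j *\<^sub>R k)\<bar> \<le> 4 * F * norm h powr (\<delta> - 2)" for j
        using wb[of x] wb[of "x + real j *\<^sub>R k"] by linarith
      then have "\<bar>g x\<bar> \<le> 4 * F * norm h powr (\<delta> - 2)" unfolding g_def avg by (intro avg_le)
      \<comment> \<open>The exponent is negative, so a lower bound on |h| is needed; this is what
        confines the direct argument to h not much shorter than k.\<close>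
      also have "\<dots> \<le> 4 * F * (\<mu> * ?\<kappa> / 2) powr (\<delta> - 2)"
        using F del hk k0 par by (intro mult_left_mono powr_mono2') auto
      finally show ?thesis .
    qed
    have "\<bar>z (x + k) - z x\<bar> \<le> 2 * (B * (real m * ?\<kappa>) powr \<delta>) / K + 3 * K\<^sup>2 * ?\<kappa>\<^sup>2 * (4 * F * (\<mu> * ?\<kappa> / 2) powr (\<delta> - 2)) / \<nu>"
      using interp[OF gz zb gb k(1) par(2)] .
    also have "\<dots> = B * (2 * real m powr \<delta> / K) * ?\<kappa> powr \<delta> + N1 * F * ?\<kappa> powr \<delta>"
    proof -
      have "(\<mu> * ?\<kappa> / 2) powr (\<delta> - 2) = (\<mu> / 2) powr (\<delta> - 2) * ?\<kappa> powr (\<delta> - 2)"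
        using par k0 by (simp add: powr_mult[symmetric])
      moreover have "?\<kappa>\<^sup>2 * ?\<kappa> powr (\<delta> - 2) = ?\<kappa> powr \<delta>" using k0 by (simp add: powr_diff)
      moreover have "(real m * ?\<kappa>) powr \<delta> = real m powr \<delta> * ?\<kappa> powr \<delta>" using k0 by (simp add: powr_mult)
      ultimately show ?thesis unfolding N1
        by (simp add: mult_ac)
    qed
    also have "\<dots> \<le> B * (1 / 8) * ?\<kappa> powr \<delta> + N1 * F * ?\<kappa> powr \<delta>"
      using par(5) B by (intro add_right_mono mult_right_mono mult_left_mono) auto
    finally have 1: "\<bar>z (x + k) - z x\<bar> \<le> B * (1 / 8) * ?\<kappa> powr \<delta> + N1 * F * ?\<kappa> powr \<delta>" .
    \<comment> \<open>The increment of the mean along k telescopes: only the end terms, m k apart,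
      remain.\<close>
    have "(\<Sum>j<m. (1 / real m) * Z h (x + k + real j *\<^sub>R k)) - (\<Sum>j<m. (1 / real m) * Z h (x + real j *\<^sub>R k)) =
        (1 / real m) * (\<Sum>j<m. Z h (x + real (Suc j) *\<^sub>R k) - Z h (x + real j *\<^sub>R k))"
      unfolding sum_distrib_left sum_subtractf[symmetric] by (intro sum.cong) (auto simp: algebra_simps)
    also have "\<dots> = (1 / real m) * (Z h (x + real m *\<^sub>R k) - Z h x)"
      using sum_lessThan_telescope[of "\<lambda>j. Z h (x + real j *\<^sub>R k)" m] by simp
    finally have "Z h (x + k) - Z h x = (z (x + k) - z x) + (1 / real m) * (Z h (x + real m *\<^sub>R k) - Z h x)"
      by (simp add: z_def)
    moreover have "\<bar>(1 / real m) * (Z h (x + real m *\<^sub>R k) - Z h x)\<bar> \<le> B * (1 / 8) * ?\<kappa> powr \<delta>"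
    proof -
      have "\<bar>(1 / real m) * (Z h (x + real m *\<^sub>R k) - Z h x)\<bar> \<le> (1 / real m) * (B * (real m * ?\<kappa>) powr \<delta>)"
        unfolding abs_mult using Zj[of m x] m0 by (intro mult_mono) auto
      also have "\<dots> = B * real m powr (\<delta> - 1) * ?\<kappa> powr \<delta>"
        using m0 k0 by (simp add: powr_mult powr_diff)
      also have "\<dots> \<le> B * (1 / 8) * ?\<kappa> powr \<delta>" using par(6) B by (intro mult_right_mono mult_left_mono) auto
      finally show ?thesis .
    qed
    ultimately have "\<bar>Z h (x + k) - Z h x\<bar> \<le> B * (1 / 8) * ?\<kappa> powr \<delta> + N1 * F * ?\<kappa> powr \<delta> + B * (1 / 8) * ?\<kappa> powr \<delta>"
      using 1 by linarith
    then show ?thesis by (simp add: algebra_simps)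
  qed
  have two: "1 < 2 powr \<delta>" "2 powr \<delta> \<le> 2" using del powr_mono[of \<delta> 1 2] gr_one_powr[of 2 \<delta>] by auto
  \<comment> \<open>By \<open>diff2_double\<close>, \<open>Z\<close> with step 2 h is the mean of
    \<open>Z\<close> with step h over three points, with weights 1/4, 1/2, 1/4. The difference
    therefore consists of increments of \<open>Z h\<close>.\<close>
  have dbl: "\<bar>Z (2 *\<^sub>R h) x - Z h x\<bar> \<le> B * norm h powr \<delta>" if h: "hor h" "\<eta> \<le> norm h" for h x
  proof -
    have h0: "0 < norm h" using h eta by linarith
    have gen: "\<bar>X\<bar> \<le> T" if "X = (P + 2 * Q) / 4" "\<bar>P\<bar> \<le> R" "R \<le> 2 * T" "\<bar>Q\<bar> \<le> T" for X P Q R T :: real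
      using that by (auto simp: abs_le_iff)
    have "Z (2 *\<^sub>R h) x - Z h x = ((Z h (x + 2 *\<^sub>R h) - Z h x) + 2 * (Z h (x + h) - Z h x)) / 4"
      by (simp add: Z_def diff2_double power_mult_distrib add_divide_distrib diff_divide_distrib)
    moreover have "\<bar>Z h (x + 2 *\<^sub>R h) - Z h x\<bar> \<le> B * norm (2 *\<^sub>R h) powr \<delta>"
    proof (rule ZP)
      have "norm (2 *\<^sub>R h) = 2 * norm h" by simp
      then show "\<eta> \<le> norm (2 *\<^sub>R h)" using h(2) h0 by linarith
    qed (use h in auto)
    moreover have "B * norm (2 *\<^sub>R h) powr \<delta> \<le> 2 * (B * norm h powr \<delta>)"
    proof -
      have "norm (2 *\<^sub>R h) powr \<delta> = 2 powr \<delta> * norm h powr \<delta>" by (simp add: powr_mult)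
      also have "\<dots> \<le> 2 * norm h powr \<delta>" using two by (intro mult_right_mono) auto
      finally show ?thesis using B by (simp add: mult_left_mono mult.left_commute)
    qed
    moreover have "\<bar>Z h (x + h) - Z h x\<bar> \<le> B * norm h powr \<delta>" using h by (intro ZP) auto
    ultimately show ?thesis by (rule gen)
  qed
  \<comment> \<open>The doubling errors form a geometric sum of ratio 2^\<delta> > 1, so the total
    is governed by the largest scale, not by the number of doublings.\<close>
  have pow: "\<bar>Z (2 ^ J *\<^sub>R h) x - Z h x\<bar> \<le> B * (norm h powr \<delta> * ((2 powr \<delta>) ^ J - 1) / (2 powr \<delta> - 1))" for J x
  proof (induction J)
    case (Suc J)
    have "norm h \<le> 2 ^ J * norm h" using mult_right_mono[of 1 "2 ^ J" "norm h"] by simp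
    then have "\<eta> \<le> norm (2 ^ J *\<^sub>R h)" using h by simp
    then have "\<bar>Z (2 *\<^sub>R 2 ^ J *\<^sub>R h) x - Z (2 ^ J *\<^sub>R h) x\<bar> \<le> B * norm (2 ^ J *\<^sub>R h) powr \<delta>"
      using h by (intro dbl) auto
    also have "norm (2 ^ J *\<^sub>R h) powr \<delta> = (2 powr \<delta>) ^ J * norm h powr \<delta>"
      by (simp add: powr_mult powr_power mult.commute powr_powr flip: powr_realpow)
    finally have "\<bar>Z (2 ^ Suc J *\<^sub>R h) x - Z h x\<bar> \<le> B * ((2 powr \<delta>) ^ J * norm h powr \<delta>)
        + B * (norm h powr \<delta> * ((2 powr \<delta>) ^ J - 1) / (2 powr \<delta> - 1))"
      using Suc.IH by simp
    also have "\<dots> = B * (norm h powr \<delta> * ((2 powr \<delta>) ^ Suc J - 1) / (2 powr \<delta> - 1))"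
    proof -
      have "B * (b ^ J * t) + B * (t * (b ^ J - 1) / (b - 1)) = B * (t * (b ^ Suc J - 1) / (b - 1))"
        if "1 < b" for b t :: real using that by (simp add: field_simps)
      from this[OF two(1)] show ?thesis .
    qed
    finally show ?case .
  qed simp
  have "\<bar>Z h (x + k) - Z h x\<bar> \<le> (N1 * F + B / 2) * ?\<kappa> powr \<delta>"
  proof (cases "\<mu> * ?\<kappa> / 2 \<le> norm h")
    case True
    have "(N1 * F + B / 4) * ?\<kappa> powr \<delta> \<le> (N1 * F + B / 2) * ?\<kappa> powr \<delta>"
      using B by (intro mult_right_mono) auto
    then show ?thesis using big[OF h True, of x] by linarith
  next
    case False
    have h0: "0 < norm h" using h eta by linarith
    have "\<exists>J. \<mu> * ?\<kappa> / 2 \<le> 2 ^ J * norm h"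
    proof -
      obtain J where "\<mu> * ?\<kappa> / 2 / norm h < 2 ^ J" using real_arch_pow[of 2 "\<mu> * ?\<kappa> / 2 / norm h"] by auto
      then show ?thesis using h0 by (intro exI[of _ J]) (simp add: pos_divide_less_eq)
    qed
    \<comment> \<open>The first doubling that enters the range of \<open>big\<close>. By minimality
      it overshoots by at most a factor 2, so the accumulated error is at most a multiple of (\<mu>
      |k|)^\<delta>.\<close>
    then obtain J where J: "\<mu> * ?\<kappa> / 2 \<le> 2 ^ J * norm h" and least: "\<And>i. i < J \<Longrightarrow> \<not> \<mu> * ?\<kappa> / 2 \<le> 2 ^ i * norm h"
      using exists_least_iff[of "\<lambda>J. \<mu> * ?\<kappa> / 2 \<le> 2 ^ J * norm h"] by blast
    have "J \<noteq> 0" using J False by (metis mult_1 power_0)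
    then obtain i where i: "J = Suc i" using not0_implies_Suc by blast
    have Jle: "2 ^ J * norm h \<le> \<mu> * ?\<kappa>" using least[of i] i by simp
    have "\<bar>Z (2 ^ J *\<^sub>R h) y - Z h y\<bar> \<le> B * (\<mu> powr \<delta> / (2 powr \<delta> - 1)) * ?\<kappa> powr \<delta>" for y
    proof -
      have "norm h powr \<delta> * ((2 powr \<delta>) ^ J - 1) \<le> norm h powr \<delta> * (2 powr \<delta>) ^ J" by (simp add: mult_left_mono)
      also have "\<dots> = (2 ^ J * norm h) powr \<delta>"
        by (simp add: powr_mult powr_power mult.commute powr_powr flip: powr_realpow)
      also have "\<dots> \<le> (\<mu> * ?\<kappa>) powr \<delta>" using Jle del by (intro powr_mono2) auto
      also have "\<dots> = \<mu> powr \<delta> * ?\<kappa> powr \<delta>" using par by (simp add: powr_mult)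
      finally have "B * (norm h powr \<delta> * ((2 powr \<delta>) ^ J - 1) / (2 powr \<delta> - 1)) \<le> B * (\<mu> powr \<delta> * ?\<kappa> powr \<delta> / (2 powr \<delta> - 1))"
        using B two by (intro mult_left_mono divide_right_mono) auto
      then show ?thesis using pow[of J y] by simp
    qed
    note c = this[of "x + k"] this[of x]
    have "\<eta> \<le> norm (2 ^ J *\<^sub>R h)"
      using h mult_right_mono[of 1 "2 ^ J" "norm h"] by simp
    then have "\<bar>Z (2 ^ J *\<^sub>R h) (x + k) - Z (2 ^ J *\<^sub>R h) x\<bar> \<le> (N1 * F + B / 4) * ?\<kappa> powr \<delta>"
      using h J by (intro big) auto
    then have "\<bar>Z h (x + k) - Z h x\<bar> \<le> (N1 * F + B / 4) * ?\<kappa> powr \<delta> + B * (2 * \<mu> powr \<delta> / (2 powr \<delta> - 1)) * ?\<kappa> powr \<delta>"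
    proof -
      have gen: "\<bar>a' - b'\<bar> \<le> E + Q" if "\<bar>a - b\<bar> \<le> E" "\<bar>a - a'\<bar> \<le> D" "\<bar>b - b'\<bar> \<le> D" "Q = 2 * D" for a b a' b' D E Q :: real
        using that by linarith
      have eq: "B * (2 * \<mu> powr \<delta> / (2 powr \<delta> - 1)) * ?\<kappa> powr \<delta> = 2 * (B * (\<mu> powr \<delta> / (2 powr \<delta> - 1)) * ?\<kappa> powr \<delta>)"
        by simp
      show ?thesis by (rule gen[OF \<open>\<bar>Z (2 ^ J *\<^sub>R h) (x + k) - Z (2 ^ J *\<^sub>R h) x\<bar> \<le> _\<close> c eq])
    qed
    also have "\<dots> \<le> (N1 * F + B / 4) * ?\<kappa> powr \<delta> + B * (1 / 8) * ?\<kappa> powr \<delta>"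
      using par(7) B by (intro add_left_mono mult_right_mono mult_left_mono) auto
    also have "\<dots> = (N1 * F + B * (3 / 8)) * ?\<kappa> powr \<delta>" by (simp add: algebra_simps)
    also have "\<dots> \<le> (N1 * F + B / 2) * ?\<kappa> powr \<delta>" using B by (intro mult_right_mono) auto
    finally show ?thesis .
  qed
  then have "(norm h)\<^sup>2 * \<bar>Z h (x + k) - Z h x\<bar> \<le> (norm h)\<^sup>2 * ((N1 * F + B / 2) * ?\<kappa> powr \<delta>)"
    by (rule mult_left_mono) simp
  moreover have "0 < norm h" using h eta by linarith
  then have "diff2 h u (x + k) - diff2 h u x = (norm h)\<^sup>2 * (Z h (x + k) - Z h x)"
    by (simp add: Z_def right_diff_distrib)
  then have "\<bar>diff2 h u (x + k) - diff2 h u x\<bar> = (norm h)\<^sup>2 * \<bar>Z h (x + k) - Z h x\<bar>"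
    by (simp add: abs_mult)
  ultimately show ?thesis by (simp only: mult_ac)
qed

text \<open>\<open>bootstrap_step\<close> is iterated from the crude bound that boundedness of u
  provides; the constants converge to 2 N1 F, the fixed point of B -> N1 F + B / 2. The starting
  constant degenerates as h or k shrinks but drops out in the limit, so the cut-off can be placed at
  the given h and k, and no supremum has to be formed.\<close>

lemma third_difference_bound:
  fixes u f :: "('q, 'r) pt \<Rightarrow> real"
  assumes gs: "gsol u f" and f: "\<And>x h. hor h \<Longrightarrow> \<bar>f (x + h) - f x\<bar> \<le> F * norm h powr \<delta>"
    and F: "0 \<le> F" and del: "0 < \<delta>" "\<delta> < 1" and u: "\<And>x. \<bar>u x\<bar> \<le> Ub"
    and par: "1 \<le> m" "1 \<le> K" "0 < \<mu>" "\<mu> \<le> 1" "2 * real m powr \<delta> / K \<le> 1 / 8"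
     "real m powr (\<delta> - 1) \<le> 1 / 8" "2 * \<mu> powr \<delta> / (2 powr \<delta> - 1) \<le> 1 / 8"
    and N1: "N1 = 12 * K\<^sup>2 * (\<mu> / 2) powr (\<delta> - 2) / \<nu>"
    and h: "hor h" and k: "hor k"
  shows "\<bar>diff2 h u (x + k) - diff2 h u x\<bar> \<le> 2 * N1 * F * (norm h)\<^sup>2 * norm k powr \<delta>"
proof -
  have N10: "0 \<le> N1" using N1 nu by simp
  consider "h = 0" | "k = 0" | "0 < norm h" "0 < norm k" by auto
  then show ?thesis
  proof cases
    case 1
    then show ?thesis by (simp add: diff2_def)
  next
    case 2
    then show ?thesis using N10 F by simp
  next
    case 3
    define \<eta> where "\<eta> = min (norm h) (norm k)"
    have eta: "0 < \<eta>" using 3 by (simp add: \<eta>_def)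
    \<comment> \<open>A third difference of u is at most 8 Ub, and |h|^2 |k|^\<delta> is at least
      this denominator once both lengths reach \<open>\<eta>\<close>.\<close>
    define B where "B = 8 * Ub / (\<eta>\<^sup>2 * \<eta> powr \<delta>)"
    have Ub: "0 \<le> Ub" using u[of 0] by linarith
    have den: "0 < \<eta>\<^sup>2 * \<eta> powr \<delta>" using eta by simp
    have B0: "0 \<le> B" using Ub den by (simp add: B_def)
    have P: "\<forall>h k x. hor h \<longrightarrow> hor k \<longrightarrow> \<eta> \<le> norm h \<longrightarrow> \<eta> \<le> norm k \<longrightarrow>
       \<bar>diff2 h u (x + k) - diff2 h u x\<bar> \<le> (2 * N1 * F + B / 2 ^ i) * (norm h)\<^sup>2 * norm k powr \<delta>" for i
    proof (induction i)
      case 0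
      show ?case
      proof (intro allI impI)
        fix h k :: "('q, 'r) pt" and x assume hk: "\<eta> \<le> norm h" "\<eta> \<le> norm k"
        have "\<bar>diff2 h u y\<bar> \<le> 4 * Ub" for y
          using u[of "y + 2 *\<^sub>R h"] u[of "y + h"] u[of y] unfolding diff2_def by linarith
        from this[of "x + k"] this[of x] have "\<bar>diff2 h u (x + k) - diff2 h u x\<bar> \<le> 8 * Ub" by linarith
        also have "\<dots> = B * (\<eta>\<^sup>2 * \<eta> powr \<delta>)" using eta by (simp add: B_def)
        also have "\<dots> \<le> B * ((norm h)\<^sup>2 * norm k powr \<delta>)"
          using hk eta del B0 by (intro mult_left_mono mult_mono power_mono powr_mono2) auto
        also have "\<dots> \<le> (2 * N1 * F + B) * ((norm h)\<^sup>2 * norm k powr \<delta>)"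
          using N10 F by (intro mult_right_mono) auto
        finally show "\<bar>diff2 h u (x + k) - diff2 h u x\<bar> \<le> (2 * N1 * F + B / 2 ^ 0) * (norm h)\<^sup>2 * norm k powr \<delta>"
          by (simp add: mult.assoc)
      qed
    next
      case (Suc i)
      have B': "0 \<le> 2 * N1 * F + B / 2 ^ i" using B0 N10 F by simp
      have eq: "N1 * F + (2 * N1 * F + B / 2 ^ i) / 2 = 2 * N1 * F + B / 2 ^ Suc i" by (simp add: field_simps)
      have "\<bar>diff2 h u (x + k) - diff2 h u x\<bar> \<le> (N1 * F + (2 * N1 * F + B / 2 ^ i) / 2) * (norm h)\<^sup>2 * norm k powr \<delta>"
        if "hor h" "hor k" "\<eta> \<le> norm h" "\<eta> \<le> norm k" for h k x
        by (rule bootstrap_step[OF gs _ F del B' par N1 _ eta that(1,3,2,4)]) (use f Suc.IH in auto)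
      then show ?case unfolding eq by blast
    qed
    have "(\<lambda>i. (2 * N1 * F + B * (1 / 2) ^ i) * (norm h)\<^sup>2 * norm k powr \<delta>) \<longlonglongrightarrow> (2 * N1 * F + B * 0) * (norm h)\<^sup>2 * norm k powr \<delta>"
      by (intro tendsto_intros LIMSEQ_realpow_zero) auto
    then have "\<bar>diff2 h u (x + k) - diff2 h u x\<bar> \<le> (2 * N1 * F + B * 0) * (norm h)\<^sup>2 * norm k powr \<delta>"
    proof (rule LIMSEQ_le_const)
      have "\<bar>diff2 h u (x + k) - diff2 h u x\<bar> \<le> (2 * N1 * F + B * (1 / 2) ^ i) * (norm h)\<^sup>2 * norm k powr \<delta>" for i
        using P[of i] h k by (simp add: \<eta>_def power_divide)
      then show "\<exists>N. \<forall>n\<ge>N. \<bar>diff2 h u (x + k) - diff2 h u x\<bar> \<le> (2 * N1 * F + B * (1 / 2) ^ n) * (norm h)\<^sup>2 * norm k powr \<delta>"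
        by blast
    qed
    then show ?thesis by simp
  qed
qed

end

section \<open>Derivatives in the first variables\<close>

lemma geometric_limit_bound:
  fixes s :: "nat \<Rightarrow> real"
  assumes step: "\<And>j. \<bar>s (Suc j) - s j\<bar> \<le> c * r ^ j" and r: "0 \<le> r" "r < 1" and lim: "s \<longlonglongrightarrow> L"
  shows "\<bar>s j - L\<bar> \<le> c * r ^ j / (1 - r)"
proof -
  have c0: "0 \<le> c" using step[of 0] by simp
  have *: "\<bar>s (j + n) - s j\<bar> \<le> c * r ^ j * (1 - r ^ n) / (1 - r)" for n
  proof (induction n)
    case (Suc n)
    have "\<bar>s (j + Suc n) - s j\<bar> \<le> c * r ^ (j + n) + c * r ^ j * (1 - r ^ n) / (1 - r)"
      using Suc step[of "j + n"] by simp
    also have "\<dots> = c * r ^ j * (1 - r ^ Suc n) / (1 - r)"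
      using r by (simp add: power_add field_simps)
    finally show ?case .
  qed simp
  have "\<bar>s (j + n) - s j\<bar> \<le> c * r ^ j / (1 - r)" for n
  proof -
    have "c * r ^ j * (1 - r ^ n) \<le> c * r ^ j * 1" using r c0 by (intro mult_left_mono) auto
    then have "c * r ^ j * (1 - r ^ n) / (1 - r) \<le> c * r ^ j / (1 - r)" using r by (intro divide_right_mono) auto
    then show ?thesis using *[of n] by linarith
  qed
  moreover have "(\<lambda>n. \<bar>s (j + n) - s j\<bar>) \<longlonglongrightarrow> \<bar>L - s j\<bar>"
    using LIMSEQ_ignore_initial_segment[OF lim, of j] by (intro tendsto_intros) (simp add: add.commute)
  ultimately have "\<bar>L - s j\<bar> \<le> c * r ^ j / (1 - r)"
    by (intro LIMSEQ_le_const2[of "\<lambda>n. \<bar>s (j + n) - s j\<bar>"]) auto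
  then show ?thesis by (simp add: abs_minus_commute)
qed

lemma geometric_limit_exists:
  fixes s :: "nat \<Rightarrow> real"
  assumes step: "\<And>j. \<bar>s (Suc j) - s j\<bar> \<le> c * r ^ j" and r: "0 \<le> r" "r < 1"
  shows "convergent s"
proof -
  have "summable (\<lambda>j. c * r ^ j)" using r by (intro summable_mult summable_geometric) auto
  then have "summable (\<lambda>j. s (Suc j) - s j)"
    using step by (intro summable_comparison_test[of "\<lambda>j. s (Suc j) - s j" "\<lambda>j. c * r ^ j"]) auto
  then obtain l where "(\<lambda>j. s (Suc j) - s j) sums l" by (auto simp: summable_def)
  then have "(\<lambda>n. s n - s 0) \<longlonglongrightarrow> l" by (simp add: sums_def sum_lessThan_telescope)
  then have "(\<lambda>n. (s n - s 0) + s 0) \<longlonglongrightarrow> l + s 0" by (intro tendsto_intros)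
  then show ?thesis by (auto simp: convergent_def)
qed

lemma continuous_on_uniform_limit:
  fixes s :: "nat \<Rightarrow> 'a::topological_space \<Rightarrow> real"
  assumes c: "\<And>j. continuous_on UNIV (s j)" and b: "\<And>j x. \<bar>s j x - L x\<bar> \<le> b j" and lim: "b \<longlonglongrightarrow> 0"
  shows "continuous_on UNIV L"
proof (rule uniform_limit_theorem[where F = sequentially])
  show "uniform_limit UNIV s L sequentially"
    unfolding uniform_limit_iff
  proof (intro allI impI)
    fix e :: real assume "0 < e"
    with lim have "\<forall>\<^sub>F n in sequentially. b n < e" by (rule order_tendstoD)
    then show "\<forall>\<^sub>F n in sequentially. \<forall>x\<in>UNIV. dist (s n x) (L x) < e"
      by eventually_elim (use b in \<open>auto simp: dist_real_def intro: le_less_trans\<close>)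
  qed
qed (use c in auto)

text \<open>Convergence of the difference quotients along the single sequence \<open>2 ^ (- j)\<close> suffices when
  it is uniform: they are the derivatives of the averages of \<open>\<phi>\<close> over \<open>[s, s + 2 ^ (- j)]\<close>.\<close>
lemma dyadic_difference_quotients_derivative:
  fixes \<phi> P :: "real \<Rightarrow> real"
  assumes c: "continuous_on UNIV \<phi>"
    and b: "\<And>j s. \<bar>2 ^ j * (\<phi> (s + 1 / 2 ^ j) - \<phi> s) - P s\<bar> \<le> b j" and lim: "b \<longlonglongrightarrow> 0"
  shows "(\<phi> has_real_derivative P t) (at t)"
proof -
  \<comment> \<open>Half-width 3 leaves room: the points of \<open>?S\<close> lie within 1 of t and
    are shifted by at most 1, so they stay inside the open interval, where \<Phi> has two-sided
    derivatives.\<close>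
  have cI: "continuous_on {t - 3..t + 3} \<phi>" using c continuous_on_subset by blast
  obtain \<Phi> where Phi: "\<And>s. s \<in> {t - 3..t + 3} \<Longrightarrow> (\<Phi> has_vector_derivative \<phi> s) (at s within {t - 3..t + 3})"
    using antiderivative_continuous[OF cI] by metis
  have dPhi: "(\<Phi> has_real_derivative \<phi> s) (at s)" if "t - 3 < s" "s < t + 3" for s
    using Phi[of s] that by (simp add: has_real_derivative_iff_has_vector_derivative at_within_Icc_at)
  define f where "f j s = 2 ^ j * (\<Phi> (s + 1 / 2 ^ j) - \<Phi> s)" for j :: nat and s
  let ?S = "{t - 1..t + 1}"
  have pj: "0 < 1 / (2::real) ^ j" "1 / 2 ^ j \<le> (1::real)" for j :: nat by auto
  have df: "(f j has_derivative (\<lambda>h. h * (2 ^ j * (\<phi> (s + 1 / 2 ^ j) - \<phi> s)))) (at s within ?S)" if s: "s \<in> ?S" for j s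
  proof -
    have "t - 3 < s + d \<and> s + d < t + 3" if "0 < d" "d \<le> 1" for d :: real using s that by auto
    then have in1: "t - 3 < s + 1 / 2 ^ j" "s + 1 / 2 ^ j < t + 3" using pj[of j] by blast+
    have "((\<lambda>s. \<Phi> (s + 1 / 2 ^ j)) has_real_derivative \<phi> (s + 1 / 2 ^ j)) (at s)"
      using DERIV_shift[of \<Phi> "\<phi> (s + 1 / 2 ^ j)" s "1 / 2 ^ j"] dPhi[OF in1] by simp
    moreover have "(\<Phi> has_real_derivative \<phi> s) (at s)" using s by (intro dPhi) auto
    ultimately have "(f j has_real_derivative 2 ^ j * (\<phi> (s + 1 / 2 ^ j) - \<phi> s)) (at s)"
      unfolding f_def by (auto intro!: derivative_eq_intros)
    then show ?thesis
      unfolding has_field_derivative_def mult_commute_abs by (rule has_derivative_at_withinI)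
  qed
  have pt: "(\<lambda>j. f j s) \<longlonglongrightarrow> \<phi> s" if s: "s \<in> ?S" for s
  proof -
    have "(\<Phi> has_real_derivative \<phi> s) (at s)" using s by (intro dPhi) auto
    then have "((\<lambda>h. (\<Phi> (s + h) - \<Phi> s) / h) \<longlongrightarrow> \<phi> s) (at 0)" by (simp add: DERIV_def)
    moreover have "filterlim (\<lambda>j. 1 / 2 ^ j :: real) (at 0) sequentially"
    proof -
      have "(\<lambda>j. (1/2) ^ j :: real) \<longlonglongrightarrow> 0" by (intro LIMSEQ_realpow_zero) auto
      then show ?thesis by (auto simp: filterlim_at power_divide)
    qed
    ultimately have "((\<lambda>j. (\<Phi> (s + 1 / 2 ^ j) - \<Phi> s) / (1 / 2 ^ j)) \<longlongrightarrow> \<phi> s) sequentially"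
      by (rule filterlim_compose)
    then show ?thesis by (simp add: f_def mult.commute)
  qed
  have "\<exists>g. \<forall>s\<in>?S. (\<lambda>j. f j s) \<longlonglongrightarrow> g s \<and> (g has_derivative (\<lambda>h. h * P s)) (at s within ?S)"
  proof (rule has_derivative_sequence[OF _ df _ _ pt])
    fix e :: real assume "0 < e"
    with lim have "\<forall>\<^sub>F n in sequentially. b n < e" by (rule order_tendstoD)
    then show "\<forall>\<^sub>F n in sequentially. \<forall>s\<in>?S. \<forall>h. norm (h * (2 ^ n * (\<phi> (s + 1 / 2 ^ n) - \<phi> s)) - h * P s) \<le> e * norm h"
    proof eventually_elim
      case (elim n)
      show ?case
      proof (intro ballI allI)
        fix s h
        have "norm (h * (2 ^ n * (\<phi> (s + 1 / 2 ^ n) - \<phi> s)) - h * P s) = \<bar>h\<bar> * \<bar>2 ^ n * (\<phi> (s + 1 / 2 ^ n) - \<phi> s) - P s\<bar>"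
          by (simp add: right_diff_distrib[symmetric] abs_mult)
        also have "\<dots> \<le> \<bar>h\<bar> * e" using b[of n s] elim by (intro mult_left_mono) auto
        finally show "norm (h * (2 ^ n * (\<phi> (s + 1 / 2 ^ n) - \<phi> s)) - h * P s) \<le> e * norm h" by (simp add: mult.commute)
      qed
    qed
  qed (auto simp: convex_real_interval)
  then obtain g where g: "\<And>s. s \<in> ?S \<Longrightarrow> (\<lambda>j. f j s) \<longlonglongrightarrow> g s"
      "\<And>s. s \<in> ?S \<Longrightarrow> (g has_derivative (\<lambda>h. h * P s)) (at s within ?S)" by blast
  have geq: "g s = \<phi> s" if "s \<in> ?S" for s using LIMSEQ_unique[OF g(1)[OF that] pt[OF that]] .
  have "(g has_derivative (\<lambda>h. h * P t)) (at t within ?S)" by (rule g(2)) simp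
  then have "(\<phi> has_derivative (\<lambda>h. h * P t)) (at t within ?S)"
    by (rule has_derivative_transform[rotated 2]) (use geq in auto)
  then have "(\<phi> has_derivative (\<lambda>h. h * P t)) (at t)" by (simp add: at_within_Icc_at)
  then show ?thesis unfolding has_field_derivative_def mult_commute_abs .
qed

lemma partial_of_dyadic_limit:
  fixes v P :: "('q::finite, 'r::finite) pt \<Rightarrow> real"
  assumes c: "continuous_on UNIV v"
    and b: "\<And>j x. \<bar>2 ^ j * (v (x + (1 / 2 ^ j) *\<^sub>R axis i 1) - v x) - P x\<bar> \<le> b j" and lim: "b \<longlonglongrightarrow> 0"
  shows "has_partial i v" "partial i v = P"
proof -
  have d: "((\<lambda>t. v (x + t *\<^sub>R axis i 1)) has_real_derivative P x) (at 0)" for x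
  proof -
    have "((\<lambda>t. v (x + t *\<^sub>R axis i 1)) has_real_derivative P (x + 0 *\<^sub>R axis i 1)) (at 0)"
    proof (rule dyadic_difference_quotients_derivative[where P = "\<lambda>t. P (x + t *\<^sub>R axis i 1)" and b = b])
      show "continuous_on UNIV (\<lambda>t. v (x + t *\<^sub>R axis i 1))"
        by (rule continuous_on_compose2[OF c]) (auto intro!: continuous_intros)
      show "\<bar>2 ^ j * (v (x + (s + 1 / 2 ^ j) *\<^sub>R axis i 1) - v (x + s *\<^sub>R axis i 1)) - P (x + s *\<^sub>R axis i 1)\<bar> \<le> b j" for j s
        using b[of j "x + s *\<^sub>R axis i 1"] by (simp add: scaleR_add_left add.assoc)
    qed (rule lim)
    then show ?thesis by simp
  qed
  show "has_partial i v" unfolding has_partial_def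
    using d real_differentiable_def by blast
  show "partial i v = P" unfolding partial_def using DERIV_imp_deriv[OF d] by auto
qed

text \<open>From here to the end of the section, regularity is deduced from the third difference
  bound. Its order 2 + \<delta> exceeds 2, so second difference quotients at dyadic scales converge
  geometrically with ratio 2^(-\<delta>).\<close>

locale third_diff =
  fixes u :: "('q::finite, 'r::finite) pt \<Rightarrow> real" and \<delta> M Ub :: real
  assumes cont: "continuous_on UNIV u" and bdd: "\<bar>u x\<bar> \<le> Ub" and del: "0 < \<delta>" "\<delta> < 1" and M: "0 \<le> M"
    and third: "hor h \<Longrightarrow> hor k \<Longrightarrow> \<bar>diff2 h u (x + k) - diff2 h u x\<bar> \<le> M * (norm h)\<^sup>2 * norm k powr \<delta>"
begin

definition rate :: real where "rate = (1/2) powr \<delta>"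

lemma rate: "0 < rate" "rate < 1" "(1 / 2 ^ j) powr \<delta> = rate ^ j"
proof -
  show "0 < rate" by (simp add: rate_def)
  have "(1/2) powr \<delta> < (1/2) powr 0" using del by (intro powr_less_mono') auto
  then show "rate < 1" by (simp add: rate_def)
  have "(1 / 2 ^ j) powr \<delta> = ((1/2) powr real j) powr \<delta>" by (simp add: powr_realpow power_divide)
  also have "\<dots> = ((1/2) powr \<delta>) powr real j" by (simp add: powr_powr mult.commute)
  also have "\<dots> = rate ^ j" by (simp add: rate_def powr_realpow)
  finally show "(1 / 2 ^ j) powr \<delta> = rate ^ j" .
qed

lemma rate_lim: "(\<lambda>j. c * rate ^ j) \<longlonglongrightarrow> 0"
proof -
  have "(\<lambda>j. c * rate ^ j) \<longlonglongrightarrow> c * 0" using rate by (intro tendsto_intros LIMSEQ_realpow_zero) auto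
  then show ?thesis by simp
qed

text \<open>Approximates the second derivative of u along h: the step is scaled by 2^(-j), and 4^j
  is the inverse square of that factor.\<close>

definition q :: "nat \<Rightarrow> ('q, 'r) pt \<Rightarrow> ('q, 'r) pt \<Rightarrow> real" where
  "q j h x = 4 ^ j * diff2 ((1 / 2 ^ j) *\<^sub>R h) u x"

lemma continuous_on_translate_u: "continuous_on UNIV (\<lambda>x. u (x + h))"
  by (rule continuous_on_compose2[OF cont]) (auto intro!: continuous_intros)

lemma q_cont: "continuous_on UNIV (q j h)"
  unfolding q_def[abs_def] diff2_def by (intro continuous_intros continuous_on_translate_u cont)

lemma q_holder: "hor h \<Longrightarrow> hor k \<Longrightarrow> \<bar>q j h (x + k) - q j h x\<bar> \<le> M * (norm h)\<^sup>2 * norm k powr \<delta>"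
proof -
  assume h: "hor h" and k: "hor k"
  have "\<bar>q j h (x + k) - q j h x\<bar> = 4 ^ j * \<bar>diff2 ((1 / 2 ^ j) *\<^sub>R h) u (x + k) - diff2 ((1 / 2 ^ j) *\<^sub>R h) u x\<bar>"
    by (simp add: q_def right_diff_distrib[symmetric] abs_mult)
  also have "\<dots> \<le> 4 ^ j * (M * (norm ((1 / 2 ^ j) *\<^sub>R h))\<^sup>2 * norm k powr \<delta>)"
    using h k by (intro mult_left_mono third hor_scaleR) auto
  also have "\<dots> = M * (norm h)\<^sup>2 * norm k powr \<delta>"
  proof -
    have "(2::real) ^ j * 2 ^ j = 4 ^ j" by (simp add: power_mult_distrib[symmetric])
    then have "4 ^ j * (norm ((1 / 2 ^ j) *\<^sub>R h))\<^sup>2 = (norm h)\<^sup>2" by (simp add: power2_eq_square)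
    then show ?thesis by (metis (no_types, opaque_lifting) mult.assoc mult.left_commute)
  qed
  finally show ?thesis .
qed

text \<open>By \<open>diff2_double\<close>, \<open>q j h\<close> is the mean of
  \<open>q (Suc j) h\<close> over three points with weights 1/4, 1/2, 1/4, so the difference
  consists of increments to which \<open>q_holder\<close> applies.\<close>

lemma q_step: "hor h \<Longrightarrow> \<bar>q (Suc j) h x - q j h x\<bar> \<le> M * (norm h)\<^sup>2 * norm h powr \<delta> * rate ^ j"
proof -
  assume h: "hor h"
  define k where "k = (1 / 2 ^ Suc j) *\<^sub>R h"
  have k: "hor k" using h by (auto simp: k_def)
  have k2: "2 *\<^sub>R k = (1 / 2 ^ j) *\<^sub>R h" by (simp add: k_def)
  have "q j h x = 4 ^ j * (diff2 k u (x + 2 *\<^sub>R k) + 2 * diff2 k u (x + k) + diff2 k u x)"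
    unfolding q_def k2[symmetric] diff2_double ..
  moreover have "q (Suc j) h y = 4 * 4 ^ j * diff2 k u y" for y by (simp add: q_def k_def)
  ultimately have "q (Suc j) h x - q j h x =
      - ((q (Suc j) h (x + 2 *\<^sub>R k) - q (Suc j) h x) + 2 * (q (Suc j) h (x + k) - q (Suc j) h x)) / 4"
    by (simp add: field_simps)
  moreover have "\<bar>q (Suc j) h (x + 2 *\<^sub>R k) - q (Suc j) h x\<bar> \<le> M * (norm h)\<^sup>2 * (norm h powr \<delta> * rate ^ j)"
  proof -
    have "norm (2 *\<^sub>R k) powr \<delta> = norm h powr \<delta> * rate ^ j"
      unfolding k2 rate(3)[symmetric] by (subst norm_scaleR, subst powr_mult) simp_all
    then show ?thesis using q_holder[OF h hor_scaleR[OF k, of 2], of "Suc j" x] by simp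
  qed
  moreover have "\<bar>q (Suc j) h (x + k) - q (Suc j) h x\<bar> \<le> M * (norm h)\<^sup>2 * (norm h powr \<delta> * rate ^ j)"
  proof -
    have "norm k powr \<delta> = norm h powr \<delta> * rate ^ Suc j"
      unfolding k_def rate(3)[symmetric] by (subst norm_scaleR, subst powr_mult) simp_all
    also have "\<dots> \<le> norm h powr \<delta> * rate ^ j" using rate by (intro mult_left_mono) auto
    finally have "M * (norm h)\<^sup>2 * norm k powr \<delta> \<le> M * (norm h)\<^sup>2 * (norm h powr \<delta> * rate ^ j)"
      using M by (intro mult_left_mono) auto
    then show ?thesis using q_holder[OF h k, of "Suc j" x] by linarith
  qed
  moreover have "0 \<le> M * (norm h)\<^sup>2 * (norm h powr \<delta> * rate ^ j)" using M rate by simp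
  moreover have "\<bar>X\<bar> \<le> T" if "X = - (P + 2 * Q) / 4" "\<bar>P\<bar> \<le> T" "\<bar>Q\<bar> \<le> T" "0 \<le> T" for X P Q T :: real
    using that by (auto simp: abs_le_iff)
  ultimately have "\<bar>q (Suc j) h x - q j h x\<bar> \<le> M * (norm h)\<^sup>2 * (norm h powr \<delta> * rate ^ j)" by metis
  then show ?thesis by (simp only: mult.assoc)
qed

definition Glim :: "('q, 'r) pt \<Rightarrow> ('q, 'r) pt \<Rightarrow> real" where
  "Glim h x = lim (\<lambda>j. q j h x)"

text \<open>The sum of the geometric series with the terms of \<open>q_step\<close>.\<close>

definition cG :: "('q, 'r) pt \<Rightarrow> real" where
  "cG h = M * (norm h)\<^sup>2 * norm h powr \<delta> / (1 - rate)"

lemma Glim: "hor h \<Longrightarrow> (\<lambda>j. q j h x) \<longlonglongrightarrow> Glim h x" "hor h \<Longrightarrow> \<bar>q j h x - Glim h x\<bar> \<le> cG h * rate ^ j"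
proof -
  assume h: "hor h"
  show *: "(\<lambda>j. q j h x) \<longlonglongrightarrow> Glim h x"
    using geometric_limit_exists[where s = "\<lambda>j. q j h x", OF q_step[OF h]] rate unfolding Glim_def by (simp add: convergent_LIMSEQ_iff)
  show "\<bar>q j h x - Glim h x\<bar> \<le> cG h * rate ^ j"
    using geometric_limit_bound[where s = "\<lambda>j. q j h x", OF q_step[OF h] _ _ *] rate by (simp add: cG_def)
qed

lemma Glim_cont: "hor h \<Longrightarrow> continuous_on UNIV (Glim h)"
  by (rule continuous_on_uniform_limit[OF q_cont Glim(2) rate_lim])

lemma q_bdd: "hor h \<Longrightarrow> \<bar>q j h x\<bar> \<le> 4 * Ub + 2 * cG h" and Glim_bdd: "hor h \<Longrightarrow> \<bar>Glim h x\<bar> \<le> 4 * Ub + 2 * cG h"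
proof -
  assume h: "hor h"
  have c0: "0 \<le> cG h" using M rate by (simp add: cG_def)
  have "\<bar>q 0 h x\<bar> \<le> 4 * Ub"
    using bdd[of "x + 2 *\<^sub>R h"] bdd[of "x + h"] bdd[of x] by (simp add: q_def diff2_def)
  moreover have "\<bar>q 0 h x - Glim h x\<bar> \<le> cG h" using Glim(2)[OF h, of 0 x] by simp
  moreover have "\<bar>q j h x - Glim h x\<bar> \<le> cG h"
  proof -
    have "cG h * rate ^ j \<le> cG h * 1" using c0 rate by (intro mult_left_mono power_le_one) auto
    then show ?thesis using Glim(2)[OF h, of j x] by linarith
  qed
  ultimately show "\<bar>q j h x\<bar> \<le> 4 * Ub + 2 * cG h" "\<bar>Glim h x\<bar> \<le> 4 * Ub + 2 * cG h" using c0 by linarith+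
qed

lemma Glim_holder: "hor h \<Longrightarrow> hor k \<Longrightarrow> \<bar>Glim h (x + k) - Glim h x\<bar> \<le> M * (norm h)\<^sup>2 * norm k powr \<delta>"
proof -
  assume h: "hor h" and k: "hor k"
  have "(\<lambda>j. \<bar>q j h (x + k) - q j h x\<bar>) \<longlonglongrightarrow> \<bar>Glim h (x + k) - Glim h x\<bar>"
    by (intro tendsto_intros Glim(1) h)
  then show ?thesis by (rule LIMSEQ_le_const2) (use q_holder[OF h k] in auto)
qed

definition e :: "'q \<Rightarrow> ('q, 'r) pt" where "e i = axis (Inl i) 1"

lemma e: "hor (e i)" "norm (e i) = 1"
  by (simp add: e_def hor_def axis_def) (simp add: e_def norm_axis_1)

definition p :: "'q \<Rightarrow> nat \<Rightarrow> ('q, 'r) pt \<Rightarrow> real" where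
  "p i j x = 2 ^ j * (u (x + (1 / 2 ^ j) *\<^sub>R e i) - u x)"

definition Plim :: "'q \<Rightarrow> ('q, 'r) pt \<Rightarrow> real" where
  "Plim i x = lim (\<lambda>j. p i j x)"

text \<open>Consecutive first quotients differ by 2^j times a second difference, which is 4^(-j)
  times a bounded quantity. Hence they converge geometrically with ratio 1/2.\<close>

lemma p_step_eq: "p i (Suc j) x - p i j x = - (q (Suc j) (e i) x * (1/4) * (1/2) ^ j)"
proof -
  define k where "k = (1 / 2 ^ Suc j) *\<^sub>R e i"
  have k2: "(1 / 2 ^ j) *\<^sub>R e i = 2 *\<^sub>R k" by (simp add: k_def)
  have "p i (Suc j) x - p i j x = - (2 ^ j * diff2 k u x)"
    unfolding p_def k2 k_def[symmetric] diff2_def by (simp add: algebra_simps)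
  moreover have "q (Suc j) (e i) x * (1/4) * (1/2) ^ j = (4 ^ j * (1/2) ^ j) * diff2 k u x"
    by (simp add: q_def k_def)
  moreover have "(4::real) ^ j * (1/2) ^ j = 2 ^ j" by (simp add: power_mult_distrib[symmetric])
  ultimately show ?thesis by simp
qed

lemma p_step: "\<bar>p i (Suc j) x - p i j x\<bar> \<le> (Ub + cG (e i)) * (1/2) ^ j"
proof -
  have "\<bar>p i (Suc j) x - p i j x\<bar> = \<bar>q (Suc j) (e i) x\<bar> * (1/4) * (1/2) ^ j"
    unfolding p_step_eq by (simp add: abs_mult)
  also have "\<dots> \<le> (4 * Ub + 2 * cG (e i)) * (1/4) * (1/2) ^ j"
    using q_bdd[OF e(1)] by (intro mult_right_mono) auto
  also have "\<dots> \<le> (Ub + cG (e i)) * (1/2) ^ j"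
  proof (rule mult_right_mono)
    have "0 \<le> cG (e i)" using M rate by (simp add: cG_def)
    then show "(4 * Ub + 2 * cG (e i)) * (1/4) \<le> Ub + cG (e i)" by simp
  qed simp
  finally show ?thesis .
qed

lemma Plim: "(\<lambda>j. p i j x) \<longlonglongrightarrow> Plim i x" "\<bar>p i j x - Plim i x\<bar> \<le> 2 * (Ub + cG (e i)) * (1/2) ^ j"
proof -
  show *: "(\<lambda>j. p i j x) \<longlonglongrightarrow> Plim i x"
    using geometric_limit_exists[where s = "\<lambda>j. p i j x", OF p_step] unfolding Plim_def by (simp add: convergent_LIMSEQ_iff)
  show "\<bar>p i j x - Plim i x\<bar> \<le> 2 * (Ub + cG (e i)) * (1/2) ^ j"
    using geometric_limit_bound[where s = "\<lambda>j. p i j x", OF p_step _ _ *, of j] by (simp add: algebra_simps)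
qed

lemma half_lim: "(\<lambda>j. c * (1/2) ^ j :: real) \<longlonglongrightarrow> 0"
proof -
  have "(\<lambda>j. c * (1/2) ^ j :: real) \<longlonglongrightarrow> c * 0" by (intro tendsto_intros LIMSEQ_realpow_zero) auto
  then show ?thesis by simp
qed

lemma Plim_cont: "continuous_on UNIV (Plim i)"
  by (rule continuous_on_uniform_limit[OF _ Plim(2) half_lim])
    (auto simp: p_def[abs_def] intro!: continuous_intros continuous_on_translate_u cont)

lemma Plim_bdd: "\<bar>Plim i x\<bar> \<le> 4 * Ub + 2 * cG (e i)"
  using Plim(2)[of i 0 x] bdd[of "x + e i"] bdd[of x] by (simp add: p_def)

text \<open>First quotients converge like 2^(-j), and their increments along k gain an additional
  factor |k|^\<delta>. For |k| = 2^(-n) this gain survives the division by |k| and makes the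
  difference quotients of \<open>Plim\<close> converge.\<close>

lemma Plim_increment:
  assumes k: "hor k"
  shows "\<bar>(p i j (x + k) - p i j x) - (Plim i (x + k) - Plim i x)\<bar> \<le> M * norm k powr \<delta> * (1/2) ^ j"
proof -
  define s where "s j = p i j (x + k) - p i j x" for j
  have "\<bar>s (Suc j) - s j\<bar> \<le> M * norm k powr \<delta> / 4 * (1/2) ^ j" for j
  proof -
    have "s (Suc j) - s j = (p i (Suc j) (x + k) - p i j (x + k)) - (p i (Suc j) x - p i j x)"
      by (simp add: s_def)
    also have "\<dots> = - ((q (Suc j) (e i) (x + k) - q (Suc j) (e i) x) * (1/4) * (1/2) ^ j)"
      unfolding p_step_eq by (simp add: algebra_simps)
    finally have "\<bar>s (Suc j) - s j\<bar> = \<bar>q (Suc j) (e i) (x + k) - q (Suc j) (e i) x\<bar> * (1/4) * (1/2) ^ j"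
      by (simp add: abs_mult)
    also have "\<dots> \<le> (M * (norm (e i))\<^sup>2 * norm k powr \<delta>) * (1/4) * (1/2) ^ j"
      using q_holder[OF e(1) k] by (intro mult_right_mono) auto
    finally show ?thesis by (simp add: e)
  qed
  moreover have "s \<longlonglongrightarrow> Plim i (x + k) - Plim i x" unfolding s_def by (intro tendsto_intros Plim)
  ultimately have "\<bar>s j - (Plim i (x + k) - Plim i x)\<bar> \<le> M * norm k powr \<delta> / 4 * (1/2) ^ j / (1 - 1/2)"
    by (intro geometric_limit_bound) auto
  also have "\<dots> \<le> M * norm k powr \<delta> * (1/2) ^ j" using M by simp
  finally show ?thesis by (simp add: s_def)
qed

text \<open>Polarisation: a mixed derivative is the second derivative along half the sum minus the
  one along half the difference.\<close>

definition G2 :: "'q \<Rightarrow> 'q \<Rightarrow> ('q, 'r) pt \<Rightarrow> real" where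
  "G2 i j x = Glim ((1/2) *\<^sub>R (e i + e j)) x - Glim ((1/2) *\<^sub>R (e i - e j)) x"

lemma hpm: "hor ((1/2) *\<^sub>R (e i + e j))" "hor ((1/2) *\<^sub>R (e i - e j))"
  "norm ((1/2) *\<^sub>R (e i + e j)) \<le> 1" "norm ((1/2) *\<^sub>R (e i - e j)) \<le> 1"
proof -
  show "hor ((1/2) *\<^sub>R (e i + e j))" "hor ((1/2) *\<^sub>R (e i - e j))" using e by auto
  show "norm ((1/2) *\<^sub>R (e i + e j)) \<le> 1" "norm ((1/2) *\<^sub>R (e i - e j)) \<le> 1"
    using norm_triangle_ineq[of "e i" "e j"] norm_triangle_ineq4[of "e i" "e j"] e(2)[of i] e(2)[of j] by auto
qed

text \<open>Polarisation, exact already for differences. With steps h and k, the second differences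
  along (h + k) / 2 from x and along (h - k) / 2 from x + k have the same midpoint x + (h + k) / 2.
  The midpoint terms cancel, leaving the four corners of the mixed difference.\<close>

lemma second_quotient:
  "2 ^ n * (p i n (x + (1 / 2 ^ n) *\<^sub>R e j) - p i n x) =
     q n ((1/2) *\<^sub>R (e i + e j)) x - q n ((1/2) *\<^sub>R (e i - e j)) (x + (1 / 2 ^ n) *\<^sub>R e j)"
proof -
  define h k where "h = (1 / 2 ^ n) *\<^sub>R e i" and "k = (1 / 2 ^ n) *\<^sub>R e j"
  have "2 *\<^sub>R (1 / 2 ^ n) *\<^sub>R (1/2) *\<^sub>R (e i + e j) = h + k" "(1 / 2 ^ n) *\<^sub>R (1/2) *\<^sub>R (e i + e j) = (1/2) *\<^sub>R (h + k)"
    "2 *\<^sub>R (1 / 2 ^ n) *\<^sub>R (1/2) *\<^sub>R (e i - e j) = h - k" "(1 / 2 ^ n) *\<^sub>R (1/2) *\<^sub>R (e i - e j) = (1/2) *\<^sub>R (h - k)"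
    by (simp_all add: h_def k_def scaleR_add_right scaleR_diff_right mult.commute)
  then have q1: "q n ((1/2) *\<^sub>R (e i + e j)) x = 4 ^ n * (u (x + (h + k)) - 2 * u (x + (1/2) *\<^sub>R (h + k)) + u x)"
    and q2: "q n ((1/2) *\<^sub>R (e i - e j)) (x + k) = 4 ^ n * (u (x + k + (h - k)) - 2 * u (x + k + (1/2) *\<^sub>R (h - k)) + u (x + k))"
    by (simp_all only: q_def diff2_def)
  have e1: "x + k + (h - k) = x + h" by simp
  have e2: "x + k + (1/2) *\<^sub>R (h - k) = x + (1/2) *\<^sub>R (h + k)"
  proof -
    have "k - (1/2) *\<^sub>R k = (1/2) *\<^sub>R k" using scaleR_left_diff_distrib[of 1 "1/2" k] by simp
    then show ?thesis by (simp add: scaleR_add_right scaleR_diff_right algebra_simps)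
  qed
  have e3: "(2::real) ^ n * 2 ^ n = 4 ^ n" by (simp add: power_mult_distrib[symmetric])
  have e4: "x + k + h = x + (h + k)" by simp
  have "2 ^ n * (p i n (x + k) - p i n x) = (2 ^ n * 2 ^ n) * (u (x + k + h) - u (x + k) - (u (x + h) - u x))"
    unfolding p_def h_def[symmetric] by (simp add: algebra_simps)
  then have e5: "2 ^ n * (p i n (x + k) - p i n x) = 4 ^ n * (u (x + (h + k)) - u (x + k) - (u (x + h) - u x))"
    unfolding e3 e4 .
  show ?thesis unfolding k_def[symmetric] q1 q2 e1 e2 e5 by (simp add: ring_distribs)
qed

text \<open>The constant collects four errors: replacing \<open>Plim\<close> by \<open>p\<close>,
  the convergence of the two second quotients, and moving the second of them from x + k back to
  x.\<close>

lemma second_dyadic: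
  "\<exists>c. \<forall>n x. \<bar>2 ^ n * (Plim i (x + (1 / 2 ^ n) *\<^sub>R axis (Inl j) 1) - Plim i x) - G2 i j x\<bar> \<le> c * rate ^ n"
proof -
  let ?a = "(1/2) *\<^sub>R (e i + e j)" and ?b = "(1/2) *\<^sub>R (e i - e j)"
  have "\<bar>2 ^ n * (Plim i (x + (1 / 2 ^ n) *\<^sub>R e j) - Plim i x) - G2 i j x\<bar> \<le> (M + cG ?a + cG ?b + M) * rate ^ n" for n x
  proof -
    let ?k = "(1 / 2 ^ n) *\<^sub>R e j"
    have hk: "hor ?k" using e by auto
    have nk: "norm ?k powr \<delta> = rate ^ n" using rate(3)[of n] e(2)[of j] by simp
    have "\<bar>2 ^ n * (Plim i (x + ?k) - Plim i x) - 2 ^ n * (p i n (x + ?k) - p i n x)\<bar> \<le> M * rate ^ n"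
    proof -
      have "\<bar>2 ^ n * (Plim i (x + ?k) - Plim i x) - 2 ^ n * (p i n (x + ?k) - p i n x)\<bar> =
          2 ^ n * \<bar>(p i n (x + ?k) - p i n x) - (Plim i (x + ?k) - Plim i x)\<bar>"
        by (simp add: right_diff_distrib[symmetric] abs_mult abs_minus_commute)
      also have "\<dots> \<le> 2 ^ n * (M * norm ?k powr \<delta> * (1/2) ^ n)"
        using Plim_increment[OF hk] by (intro mult_left_mono) auto
      also have "\<dots> = M * rate ^ n" unfolding nk by (simp add: power_divide)
      finally show ?thesis .
    qed
    moreover have "\<bar>q n ?a x - Glim ?a x\<bar> \<le> cG ?a * rate ^ n" by (rule Glim(2)[OF hpm(1)])
    moreover have "\<bar>q n ?b x - Glim ?b x\<bar> \<le> cG ?b * rate ^ n" by (rule Glim(2)[OF hpm(2)])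
    moreover have "\<bar>q n ?b (x + ?k) - q n ?b x\<bar> \<le> M * rate ^ n"
    proof -
      have "\<bar>q n ?b (x + ?k) - q n ?b x\<bar> \<le> M * (norm ?b)\<^sup>2 * norm ?k powr \<delta>" by (rule q_holder[OF hpm(2) hk])
      also have "\<dots> \<le> M * 1 * norm ?k powr \<delta>" using M hpm(4)
        by (intro mult_right_mono mult_left_mono power_le_one) auto
      finally show ?thesis using nk by simp
    qed
    ultimately show ?thesis unfolding second_quotient G2_def by (simp add: distrib_right)
  qed
  then show ?thesis by (auto simp: e_def)
qed

lemma G2_cont: "continuous_on UNIV (G2 i j)"
  unfolding G2_def[abs_def] by (intro continuous_intros Glim_cont hpm)

lemma G2_bdd: "\<exists>c. \<forall>x. \<bar>G2 i j x\<bar> \<le> c"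
proof -
  let ?a = "(1/2) *\<^sub>R (e i + e j)" and ?b = "(1/2) *\<^sub>R (e i - e j)"
  have "\<bar>G2 i j x\<bar> \<le> (4 * Ub + 2 * cG ?a) + (4 * Ub + 2 * cG ?b)" for x
    using Glim_bdd[OF hpm(1), of i j x] Glim_bdd[OF hpm(2), of i j x] unfolding G2_def by linarith
  then show ?thesis by blast
qed

lemma G2_holder: "hor k \<Longrightarrow> \<bar>G2 i j (x + k) - G2 i j x\<bar> \<le> 2 * M * norm k powr \<delta>"
proof -
  assume k: "hor k"
  have *: "M * (norm h)\<^sup>2 * norm k powr \<delta> \<le> M * norm k powr \<delta>" if "norm h \<le> 1" for h :: "('q,'r) pt"
  proof -
    have "M * (norm h)\<^sup>2 * norm k powr \<delta> \<le> M * 1 * norm k powr \<delta>"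
      using M that by (intro mult_right_mono mult_left_mono power_le_one) auto
    then show ?thesis by simp
  qed
  show ?thesis
    using Glim_holder[OF hpm(1) k, of i j x] Glim_holder[OF hpm(2) k, of i j x] *[OF hpm(3)[of i j]] *[OF hpm(4)[of i j]]
    unfolding G2_def by linarith
qed

lemma partial_u: "has_partial (Inl i) u" "partial (Inl i) u = Plim i"
  using partial_of_dyadic_limit[OF cont Plim(2)[of i, unfolded p_def e_def] half_lim] by auto

lemma partial_partial_u: "has_partial (Inl j) (Plim i)" "partial (Inl j) (Plim i) = G2 i j"
proof -
  obtain c where "\<And>n x. \<bar>2 ^ n * (Plim i (x + (1 / 2 ^ n) *\<^sub>R axis (Inl j) 1) - Plim i x) - G2 i j x\<bar> \<le> c * rate ^ n"
    using second_dyadic by blast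
  from partial_of_dyadic_limit[OF Plim_cont this rate_lim]
  show "has_partial (Inl j) (Plim i)" "partial (Inl j) (Plim i) = G2 i j" by auto
qed

lemma cont_bddI: "continuous_on UNIV g \<Longrightarrow> (\<And>x. \<bar>g x\<bar> \<le> c) \<Longrightarrow> cont_bdd g"
  unfolding cont_bdd_def by (auto simp: bounded_iff intro: borel_measurable_continuous_onI)

lemma holder2_le: "holder2_xp \<delta> u \<le> ereal (2 * M)"
  unfolding holder2_xp_def holder_xp_def
proof (intro SUP_least, clarsimp simp: partial_u partial_partial_u)
  fix i j and x y :: "('q, 'r) pt" assume xy: "same_xpp x y" "x \<noteq> y"
  have "hor (x - y)" using xy by (simp add: hor_def same_xpp_def)
  then have "\<bar>G2 i j x - G2 i j y\<bar> \<le> 2 * M * norm (x - y) powr \<delta>"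
    using G2_holder[of "x - y" i j y] by simp
  moreover have "0 < norm (x - y) powr \<delta>" using xy by simp
  ultimately show "\<bar>G2 i j x - G2 i j y\<bar> / norm (x - y) powr \<delta> \<le> 2 * M" by (simp add: pos_divide_le_eq)
qed

lemma C2_delta: "C2_delta_xp \<delta> u"
proof -
  have "holder2_xp \<delta> u < \<infinity>" using holder2_le by (rule le_less_trans) simp
  moreover have "cont_bdd u" using cont bdd by (rule cont_bddI)
  moreover have "cont_bdd (Plim i)" for i using Plim_cont Plim_bdd by (rule cont_bddI)
  moreover have "cont_bdd (G2 i j)" for i j using G2_bdd[of i j] cont_bddI[OF G2_cont] by blast
  ultimately show ?thesis unfolding C2_delta_xp_def C2_xp_def
    by (simp add: partial_u partial_partial_u)
qed

end

section \<open>Mollification\<close>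

text \<open>A polynomial, a power of the pole and the exponential of minus the pole: this class is
  closed under differentiation, so that every derivative of the bump is explicit.\<close>

definition bump_term :: "real poly \<Rightarrow> nat \<Rightarrow> real \<Rightarrow> real" where
  "bump_term p m t = (if \<bar>t\<bar> < 1 then poly p t * ((1 / (1 - t\<^sup>2)) ^ m * exp (- (1 / (1 - t\<^sup>2)))) else 0)"

lemma one_minus_sq_pos: "\<bar>t\<bar> < 1 \<Longrightarrow> 0 < 1 - t\<^sup>2" for t :: real
  by (simp add: abs_square_less_1)

lemma power_le_exp:
  fixes s :: real
  assumes s: "0 \<le> s" and K: "0 < K"
  shows "s ^ K \<le> real K ^ K * exp s"
proof -
  have "s ^ K = (real K * (s / real K)) ^ K" using K by simp
  also have "\<dots> = real K ^ K * (s / real K) ^ K" by (rule power_mult_distrib)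
  also have "(s / real K) ^ K \<le> (1 + s / real K) ^ K" using s by (intro power_mono) auto
  also have "\<dots> \<le> exp s" using s K by (intro exp_ge_one_plus_x_over_n_power_n) auto
  finally show ?thesis by (simp add: mult_left_mono)
qed

text \<open>\<open>power_le_exp\<close> at exponent m + 2: the two surplus powers of 1 / y become
  the factor y^2, which is second order decay at the edge of the support.\<close>

lemma inverse_power_exp_le:
  fixes y :: real
  assumes y: "0 < y"
  shows "(1 / y) ^ m * exp (- (1 / y)) \<le> real (m + 2) ^ (m + 2) * y\<^sup>2"
proof -
  define K where "K = m + 2"
  have "(1 / y) ^ K \<le> real K ^ K * exp (1 / y)" using y by (intro power_le_exp) (auto simp: K_def)
  then have "(1 / y) ^ K * exp (- (1 / y)) \<le> real K ^ K * exp (1 / y) * exp (- (1 / y))"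
    by (rule mult_right_mono) simp
  also have "\<dots> = real K ^ K" by (simp add: mult.assoc exp_add[symmetric])
  finally have "y\<^sup>2 * ((1 / y) ^ K * exp (- (1 / y))) \<le> y\<^sup>2 * real K ^ K" by (rule mult_left_mono) simp
  moreover have "(1 / y) ^ K = (1 / y) ^ m * (1 / y)\<^sup>2" unfolding K_def by (rule power_add)
  then have "y\<^sup>2 * ((1 / y) ^ K * exp (- (1 / y))) = (1 / y) ^ m * exp (- (1 / y))"
    using y by (simp add: power2_eq_square)
  ultimately show ?thesis unfolding K_def[symmetric] by (simp only: mult.commute)
qed

text \<open>Quadratic decay at both end points; it yields derivative zero there, where the formula
  inside and the zero outside meet.\<close>

lemma bump_term_le: "\<exists>C\<ge>0. \<forall>t a. \<bar>a\<bar> = 1 \<longrightarrow> \<bar>bump_term p m t\<bar> \<le> C * (t - a)\<^sup>2"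
proof -
  have "compact ((poly p) ` {-1..1})" by (intro compact_continuous_image continuous_intros) auto
  then obtain Q where Q: "\<And>t. t \<in> {-1..1} \<Longrightarrow> \<bar>poly p t\<bar> \<le> Q"
    using compact_imp_bounded bounded_iff by (metis imageI real_norm_def)
  have Q0: "0 \<le> Q" using Q[of 0] by auto
  define C where "C = Q * (real (m + 2) ^ (m + 2) * 4)"
  have "\<bar>bump_term p m t\<bar> \<le> C * (t - a)\<^sup>2" if a: "\<bar>a\<bar> = 1" for t a
  proof (cases "\<bar>t\<bar> < 1")
    case True
    define y where "y = 1 - t\<^sup>2"
    have y: "0 < y" using one_minus_sq_pos[OF True] by (simp add: y_def)
    have "y \<le> 2 * \<bar>t - a\<bar>"
    proof -
      have "a = 1 \<or> a = -1" using a by linarith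
      then have "y = \<bar>a + t\<bar> * \<bar>a - t\<bar>"
        using y by (auto simp: y_def abs_mult[symmetric] power2_eq_square algebra_simps)
      also have "\<dots> \<le> 2 * \<bar>a - t\<bar>" using True a by (intro mult_right_mono) auto
      finally show ?thesis by (simp add: abs_minus_commute)
    qed
    then have y2: "y\<^sup>2 \<le> 4 * (t - a)\<^sup>2" using power_mono[of y "2 * \<bar>t - a\<bar>" 2] y by (simp add: power_mult_distrib)
    have "\<bar>bump_term p m t\<bar> = \<bar>poly p t\<bar> * ((1 / y) ^ m * exp (- (1 / y)))"
      using True y by (simp add: bump_term_def y_def abs_mult)
    also have "\<dots> \<le> Q * (real (m + 2) ^ (m + 2) * y\<^sup>2)"
    proof (rule mult_mono[OF _ inverse_power_exp_le[OF y]])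
      show "\<bar>poly p t\<bar> \<le> Q" using Q[of t] True by (simp add: abs_less_iff)
    qed (use Q0 y in auto)
    also have "\<dots> \<le> Q * (real (m + 2) ^ (m + 2) * (4 * (t - a)\<^sup>2))" using Q0 y2 by (intro mult_left_mono) auto
    finally show ?thesis by (simp add: C_def mult_ac)
  next
    case False
    then show ?thesis using Q0 by (simp add: bump_term_def C_def)
  qed
  moreover have "0 \<le> C" using Q0 by (simp add: C_def)
  ultimately show ?thesis by blast
qed

text \<open>With S = 1 / (1 - t^2) all terms of the derivative are brought to the common factor S^(m
  + 2); missing powers of S are compensated by powers of 1 - t^2 in the new polynomial. At the two
  end points quadratic decay replaces the computation.\<close>

lemma bump_term_derivative:
  assumes m: "0 < m"
  shows "(bump_term p m has_real_derivative
     bump_term (pderiv p * [:1, 0, -1:]\<^sup>2 + [:0, 2 * real m:] * p * [:1, 0, -1:] - [:0, 2:] * p) (m + 2) t) (at t)"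
    (is "(_ has_real_derivative bump_term ?p' _ _) _")
proof -
  consider "\<bar>t\<bar> < 1" | "\<bar>t\<bar> > 1" | "\<bar>t\<bar> = 1" by linarith
  then show ?thesis
  proof cases
    case 1
    define y where "y = 1 - t\<^sup>2"
    have y: "0 < y" using one_minus_sq_pos[OF 1] by (simp add: y_def)
    have "((\<lambda>s. poly p s * ((1 / (1 - s\<^sup>2)) ^ m * exp (- (1 / (1 - s\<^sup>2))))) has_real_derivative bump_term ?p' (m + 2) t) (at t)"
    proof -
      define S where "S = 1 / (1 - t\<^sup>2)"
      have yS: "y * S = 1" using y by (simp add: S_def y_def)
      have d1: "((\<lambda>s. 1 / (1 - s\<^sup>2)) has_real_derivative 2 * t * (S * S)) (at t)"
        using y unfolding S_def y_def by (auto intro!: derivative_eq_intros simp: power2_eq_square)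
      have d2: "((\<lambda>s. s ^ m * exp (- s)) has_real_derivative (real m * S ^ (m - 1) - S ^ m) * exp (- S)) (at S)"
        by (auto intro!: derivative_eq_intros simp: algebra_simps)
      have "((\<lambda>s. (1 / (1 - s\<^sup>2)) ^ m * exp (- (1 / (1 - s\<^sup>2)))) has_real_derivative
          (real m * S ^ (m - 1) - S ^ m) * exp (- S) * (2 * t * (S * S))) (at t)"
        unfolding S_def by (rule DERIV_chain2[OF d2[unfolded S_def] d1[unfolded S_def]])
      from DERIV_mult[OF poly_DERIV[of p t] this]
      have "((\<lambda>s. poly p s * ((1 / (1 - s\<^sup>2)) ^ m * exp (- (1 / (1 - s\<^sup>2))))) has_real_derivative
          poly (pderiv p) t * (S ^ m * exp (- S)) + (real m * S ^ (m - 1) - S ^ m) * exp (- S) * (2 * t * (S * S)) * poly p t) (at t)"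
        unfolding S_def .
      moreover have "poly (pderiv p) t * (S ^ m * exp (- S)) + (real m * S ^ (m - 1) - S ^ m) * exp (- S) * (2 * t * (S * S)) * poly p t
          = bump_term ?p' (m + 2) t"
      proof -
        have py: "poly [:1, 0, -1:] t = y" by (simp add: y_def power2_eq_square)
        have "bump_term ?p' (m + 2) t = (poly (pderiv p) t * y\<^sup>2 + 2 * real m * t * poly p t * y - 2 * t * poly p t) * (S ^ (m + 2) * exp (- S))"
          unfolding bump_term_def S_def[symmetric] using 1 by (simp only: if_True poly_add poly_diff poly_mult poly_power py) simp
        also have "S ^ (m + 2) = S ^ m * (S * S)" by (simp add: power_add power2_eq_square)
        also have "(a * y\<^sup>2 + 2 * real m * t * b * y - 2 * t * b) * (S ^ m * (S * S) * E) =
            a * (S ^ m * E) * (y * S)\<^sup>2 + 2 * real m * t * b * E * (S ^ m * S) * (y * S) - 2 * t * b * E * (S ^ m * (S * S))" for a b E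
          by (simp add: power2_eq_square algebra_simps)
        finally have eq: "bump_term ?p' (m + 2) t = poly (pderiv p) t * (S ^ m * exp (- S)) * (y * S)\<^sup>2
            + 2 * real m * t * poly p t * exp (- S) * (S ^ m * S) * (y * S) - 2 * t * poly p t * exp (- S) * (S ^ m * (S * S))" .
        define T where "T = S ^ (m - 1)"
        have Sm: "S ^ m = T * S" unfolding T_def using m by (metis Suc_diff_1 power_Suc2)
        show ?thesis unfolding eq yS Sm T_def[symmetric] by (simp add: algebra_simps)
      qed
      ultimately show ?thesis by simp
    qed
    moreover have "\<forall>\<^sub>F s in nhds t. poly p s * ((1 / (1 - s\<^sup>2)) ^ m * exp (- (1 / (1 - s\<^sup>2)))) = bump_term p m s"
    proof -
      have "open {s::real. \<bar>s\<bar> < 1}" by (intro open_Collect_less continuous_intros)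
      then have "\<forall>\<^sub>F s in nhds t. s \<in> {s::real. \<bar>s\<bar> < 1}" by (rule eventually_nhds_in_open) (use 1 in simp)
      then show ?thesis by eventually_elim (simp add: bump_term_def)
    qed
    ultimately show ?thesis by (simp add: DERIV_cong_ev[OF refl _ refl])
  next
    case 2
    have "open {s::real. \<bar>s\<bar> > 1}" by (intro open_Collect_less continuous_intros)
    then have "\<forall>\<^sub>F s in nhds t. s \<in> {s::real. \<bar>s\<bar> > 1}" by (rule eventually_nhds_in_open) (use 2 in simp)
    then have ev: "\<forall>\<^sub>F s in nhds t. 0 = bump_term p m s" by eventually_elim (simp add: bump_term_def)
    have "((\<lambda>_. 0) has_real_derivative bump_term ?p' (m + 2) t) (at t)" using 2 by (simp add: bump_term_def)
    then show ?thesis by (rule iffD1[OF DERIV_cong_ev[OF refl ev refl]])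
  next
    case 3
    obtain C where C: "0 \<le> C" "\<And>s. \<bar>bump_term p m s\<bar> \<le> C * (s - t)\<^sup>2" using bump_term_le[of p m] 3 by blast
    have "(bump_term p m has_derivative (\<lambda>h. 0)) (at t)"
      unfolding has_derivative_at_alt
    proof (intro conjI allI impI)
      fix e :: real assume e: "0 < e"
      have C1: "0 < C + 1" using C by simp
      have "\<bar>bump_term p m s\<bar> \<le> e * \<bar>s - t\<bar>" if "\<bar>s - t\<bar> < e / (C + 1)" for s
      proof -
        have "\<bar>bump_term p m s\<bar> \<le> (C * \<bar>s - t\<bar>) * \<bar>s - t\<bar>" using C(2)[of s] by (simp add: power2_eq_square mult.assoc)
        also have "C * \<bar>s - t\<bar> \<le> (C + 1) * (e / (C + 1))" using that C C1 by (intro mult_mono) auto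
        also have "\<dots> = e" using C1 by simp
        finally show ?thesis by (simp add: mult_right_mono)
      qed
      then show "\<exists>d>0. \<forall>s. norm (s - t) < d \<longrightarrow> norm (bump_term p m s - bump_term p m t - 0) \<le> e * norm (s - t)"
        using 3 e C1 by (intro exI[of _ "e / (C + 1)"]) (simp add: bump_term_def)
    qed simp
    moreover have "bump_term ?p' (m + 2) t = 0" using 3 by (simp add: bump_term_def)
    moreover have "(\<lambda>h::real. 0) = (*) 0" by (rule ext) simp
    ultimately show ?thesis unfolding has_field_derivative_def by metis
  qed
qed

lemma bump_sequence:
  "\<exists>\<beta>::nat \<Rightarrow> real \<Rightarrow> real. (\<forall>k t. (\<beta> k has_real_derivative \<beta> (Suc k) t) (at t)) \<and> (\<forall>k t. 1 \<le> \<bar>t\<bar> \<longrightarrow> \<beta> k t = 0) \<and>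
     (\<forall>t. 0 \<le> \<beta> 0 t) \<and> 0 < \<beta> 0 0 \<and> (\<forall>t. \<beta> 0 (- t) = \<beta> 0 t)"
proof -
  \<comment> \<open>Differentiation as a map on pairs of polynomial and exponent. The iteration
    starts from exponent 1, since \<open>bump_term_derivative\<close> asks for a positive
    one.\<close>
  define step :: "real poly \<times> nat \<Rightarrow> real poly \<times> nat" where
    "step = (\<lambda>(p, m). (pderiv p * [:1, 0, -1:]\<^sup>2 + [:0, 2 * real m:] * p * [:1, 0, -1:] - [:0, 2:] * p, m + 2))"
  define \<beta> where "\<beta> k = (case (step ^^ k) (1, 1) of (p, m) \<Rightarrow> bump_term p m)" for k
  have "0 < snd ((step ^^ k) (1, 1))" for k
    by (induction k) (auto simp: step_def split: prod.split)
  then have "(\<beta> k has_real_derivative \<beta> (Suc k) t) (at t)" for k t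
  proof -
    obtain p m where pm: "(step ^^ k) (1, 1) = (p, m)" by (cases "(step ^^ k) (1, 1)") auto
    then have "0 < m" using \<open>0 < snd ((step ^^ k) (1, 1))\<close> by simp
    note d = bump_term_derivative[OF this, of p t]
    have "(step ^^ Suc k) (1, 1) = step (p, m)" by (simp only: funpow.simps o_apply pm)
    then show ?thesis unfolding \<beta>_def pm using d by (simp only: step_def prod.case)
  qed
  moreover have "\<beta> k t = 0" if "1 \<le> \<bar>t\<bar>" for k t
    using that by (simp add: \<beta>_def bump_term_def split: prod.split)
  moreover have "\<beta> 0 = bump_term 1 1" by (simp add: \<beta>_def)
  then have "0 \<le> \<beta> 0 t" "0 < \<beta> 0 0" "\<beta> 0 (- t) = \<beta> 0 t" for t
    using one_minus_sq_pos[of t] by (auto simp: bump_term_def less_imp_le)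
  ultimately show ?thesis by blast
qed

lemma has_derivative_vecI:
  fixes f :: "'a::real_normed_vector \<Rightarrow> real^'n"
  assumes "\<And>i. ((\<lambda>x. f x $ i) has_derivative (\<lambda>v. f' v $ i)) (at x)"
  shows "(f has_derivative f') (at x)"
  unfolding has_derivative_componentwise_within[of f]
  using assms by (auto simp: Basis_vec_def inner_axis)

section \<open>Smooth product kernels and convolution with weak derivatives\<close>

definition inc :: "'i \<Rightarrow> ('i \<Rightarrow> nat) \<Rightarrow> 'i \<Rightarrow> nat" where
  "inc i \<kappa> = \<kappa>(i := Suc (\<kappa> i))"

lemma inc_commute: "inc i (inc j \<kappa>) = inc j (inc i \<kappa>)"
  by (auto simp: inc_def fun_eq_iff)

definition locint :: "('a::euclidean_space \<Rightarrow> real) \<Rightarrow> bool" where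
  "locint g \<longleftrightarrow> g \<in> borel_measurable borel \<and> (\<forall>x R. (\<integral>\<^sup>+ y. ennreal \<bar>g y\<bar> * indicator (cball x R) y \<partial>lborel) < \<infinity>)"

lemma Lp_loc_1_locint: "Lp_loc 1 g \<Longrightarrow> locint g"
proof -
  assume g: "Lp_loc 1 g"
  have "(\<integral>\<^sup>+ y. ennreal \<bar>g y\<bar> * indicator (cball x R) y \<partial>lborel) < \<infinity>" for x R
  proof -
    have "(\<integral>\<^sup>+ y. ennreal (indicator (cball x R) y * \<bar>g y\<bar> powr 1) \<partial>lborel) < \<infinity>"
      using g by (auto simp: Lp_loc_def)
    moreover have "ennreal (indicator (cball x R) y * \<bar>g y\<bar> powr 1) = ennreal \<bar>g y\<bar> * indicator (cball x R) y" for y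
      by (auto simp: indicator_def)
    ultimately show ?thesis by simp
  qed
  then show ?thesis using g by (simp add: locint_def Lp_loc_def)
qed

text \<open>\<open>B k\<close> is the k-th derivative of a one-dimensional profile and the
  multi-index \<open>\<kappa>\<close> counts derivatives per coordinate, so
  \<open>K \<kappa>\<close> is that partial derivative of one fixed product kernel. The factor
  \<open>c\<close> is left free so that the locale covers the kernel both before and after
  normalisation.\<close>

locale smooth_kernel =
  fixes B :: "nat \<Rightarrow> real \<Rightarrow> real" and \<epsilon> c :: real and K :: "('q::finite + 'r::finite \<Rightarrow> nat) \<Rightarrow> ('q, 'r) pt \<Rightarrow> real"
  assumes eps: "0 < \<epsilon>" and B_deriv: "(B k has_real_derivative B (Suc k) t) (at t)"
    and B_zero: "\<epsilon> \<le> \<bar>t\<bar> \<Longrightarrow> B k t = 0" and B_nonneg: "0 \<le> B 0 t" and B_even: "B 0 (- t) = B 0 t"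
    and c0: "0 \<le> c" and K_def: "K \<kappa> y = c * (\<Prod>i\<in>UNIV. B (\<kappa> i) (y $ i))"
begin

text \<open>Comes from comparing the norm with the sum of the coordinates: beyond this radius some
  coordinate has size at least \<epsilon>, so the product vanishes.\<close>

definition rad :: real where "rad = real CARD('q + 'r) * \<epsilon>"

lemma rad_pos: "0 < rad"
  using eps by (simp add: rad_def card_gt_0_iff del: card_sum)

lemma K_deriv: "(K \<kappa> has_derivative (\<lambda>h. \<Sum>i\<in>UNIV. h $ i * K (inc i \<kappa>) y)) (at y)"
proof -
  have comp: "((\<lambda>y. y $ i) has_derivative (\<lambda>h. h $ i)) (at y)" for i
    by (rule bounded_linear_imp_has_derivative) (rule bounded_linear_vec_nth)
  have d: "((\<lambda>y. B (\<kappa> i) (y $ i)) has_derivative (\<lambda>h. h $ i * B (Suc (\<kappa> i)) (y $ i))) (at y)" for i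
    using has_derivative_compose[OF comp[of i] B_deriv[of "\<kappa> i" "y $ i", unfolded has_field_derivative_def]]
    by (simp add: mult.commute)
  have d1: "((\<lambda>y. c * (\<Prod>i\<in>UNIV. B (\<kappa> i) (y $ i))) has_derivative
      (\<lambda>h. c * (\<Sum>i\<in>UNIV. h $ i * B (Suc (\<kappa> i)) (y $ i) * (\<Prod>j\<in>UNIV - {i}. B (\<kappa> j) (y $ j))))) (at y)"
    by (intro has_derivative_mult_right has_derivative_prod d)
  have kk: "K (inc i \<kappa>) y = c * (B (Suc (\<kappa> i)) (y $ i) * (\<Prod>j\<in>UNIV - {i}. B (\<kappa> j) (y $ j)))" for i
  proof -
    have "(\<Prod>j\<in>UNIV. B (inc i \<kappa> j) (y $ j)) = B (inc i \<kappa> i) (y $ i) * (\<Prod>j\<in>UNIV - {i}. B (inc i \<kappa> j) (y $ j))"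
      by (rule prod.remove) auto
    also have "(\<Prod>j\<in>UNIV - {i}. B (inc i \<kappa> j) (y $ j)) = (\<Prod>j\<in>UNIV - {i}. B (\<kappa> j) (y $ j))"
      by (intro prod.cong) (auto simp: inc_def)
    finally show ?thesis by (simp add: K_def inc_def)
  qed
  have "(\<lambda>h. c * (\<Sum>i\<in>UNIV. h $ i * B (Suc (\<kappa> i)) (y $ i) * (\<Prod>j\<in>UNIV - {i}. B (\<kappa> j) (y $ j))))
      = (\<lambda>h. \<Sum>i\<in>UNIV. h $ i * K (inc i \<kappa>) y)"
    by (rule ext) (simp add: kk sum_distrib_left mult_ac)
  moreover have "(\<lambda>y. c * (\<Prod>i\<in>UNIV. B (\<kappa> i) (y $ i))) = K \<kappa>" by (rule ext) (simp add: K_def)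
  ultimately show ?thesis using d1 by simp
qed

lemma K_cont: "continuous_on S (K \<kappa>)"
  using K_deriv by (meson continuous_at_imp_continuous_on has_derivative_continuous)

lemma K_meas [measurable]: "K \<kappa> \<in> borel_measurable borel"
  by (rule borel_measurable_continuous_onI[OF K_cont])

lemma K_zero: "rad \<le> norm y \<Longrightarrow> K \<kappa> y = 0"
proof -
  assume r: "rad \<le> norm y"
  have "\<exists>i. \<epsilon> \<le> \<bar>y $ i\<bar>"
  proof (rule ccontr)
    assume "\<not> ?thesis"
    then have "(\<Sum>i\<in>UNIV. \<bar>y $ i\<bar>) < (\<Sum>i\<in>(UNIV::('q + 'r) set). \<epsilon>)"
      by (intro sum_strict_mono) (auto simp: not_le)
    then show False using norm_le_l1_cart[of y] r by (simp add: rad_def)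
  qed
  then obtain i where "B (\<kappa> i) (y $ i) = 0" using B_zero by blast
  then show ?thesis unfolding K_def by (metis finite_code UNIV_I prod_zero mult_zero_right)
qed

lemma K_bdd: "\<exists>C\<ge>0. \<forall>y. \<bar>K \<kappa> y\<bar> \<le> C"
proof -
  have "compact (K \<kappa> ` cball 0 rad)" by (intro compact_continuous_image K_cont) auto
  then obtain C where C: "\<And>y. y \<in> cball 0 rad \<Longrightarrow> \<bar>K \<kappa> y\<bar> \<le> C"
    using compact_imp_bounded bounded_iff by (metis imageI real_norm_def)
  have "0 \<le> C" using C[of 0] rad_pos by (metis abs_ge_zero centre_in_cball less_imp_le order_trans)
  moreover have "\<bar>K \<kappa> y\<bar> \<le> C" for y
  proof (cases "norm y \<le> rad")
    case False
    then show ?thesis using K_zero[of y \<kappa>] \<open>0 \<le> C\<close> by simp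
  qed (use C in auto)
  ultimately show ?thesis by blast
qed

lemma K_line: "((\<lambda>t. K \<kappa> (y + t *\<^sub>R h)) has_real_derivative (\<Sum>i\<in>UNIV. h $ i * K (inc i \<kappa>) (y + t *\<^sub>R h))) (at t)"
  using has_derivative_along_line[OF K_deriv] by (simp add: has_real_derivative_iff_has_vector_derivative)

lemma K_lip: "\<exists>C\<ge>0. \<forall>y h. \<bar>K \<kappa> (y + h) - K \<kappa> y\<bar> \<le> C * norm h"
proof -
  obtain C where C: "\<And>i. 0 \<le> C i" "\<And>i y. \<bar>K (inc i \<kappa>) y\<bar> \<le> C i" using K_bdd[of "inc _ \<kappa>"] by metis
  have "\<bar>K \<kappa> (y + h) - K \<kappa> y\<bar> \<le> (\<Sum>i\<in>UNIV. C i) * norm h" for y h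
  proof -
    obtain s where "K \<kappa> (y + 1 *\<^sub>R h) - K \<kappa> (y + 0 *\<^sub>R h) = (1 - 0) * (\<Sum>i\<in>UNIV. h $ i * K (inc i \<kappa>) (y + s *\<^sub>R h))"
      using MVT2[OF zero_less_one K_line[of \<kappa> y h]] by blast
    then have "\<bar>K \<kappa> (y + h) - K \<kappa> y\<bar> \<le> (\<Sum>i\<in>UNIV. \<bar>h $ i * K (inc i \<kappa>) (y + s *\<^sub>R h)\<bar>)" by simp
    also have "\<dots> \<le> (\<Sum>i\<in>UNIV. C i * norm h)"
      unfolding abs_mult mult.commute[of "\<bar>h $ _\<bar>"]
      by (intro sum_mono mult_mono C component_le_norm_cart) (auto simp: C)
    finally show ?thesis by (simp add: sum_distrib_right)
  qed
  moreover have "0 \<le> (\<Sum>i\<in>UNIV. C i)" using C by (intro sum_nonneg)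
  ultimately show ?thesis by blast
qed

text \<open>The constant is uniform in the base point, so the remainder can be integrated against
  any locally integrable function; this is how \<open>conv_deriv\<close> differentiates under the
  integral.\<close>

lemma K_taylor: "\<exists>C\<ge>0. \<forall>y h. \<bar>K \<kappa> (y + h) - K \<kappa> y - (\<Sum>i\<in>UNIV. h $ i * K (inc i \<kappa>) y)\<bar> \<le> C * (norm h)\<^sup>2"
proof -
  obtain C where C: "\<And>i. 0 \<le> C i" "\<And>i y h. \<bar>K (inc i \<kappa>) (y + h) - K (inc i \<kappa>) y\<bar> \<le> C i * norm h"
    using K_lip[of "inc _ \<kappa>"] by metis
  have "\<bar>K \<kappa> (y + h) - K \<kappa> y - (\<Sum>i\<in>UNIV. h $ i * K (inc i \<kappa>) y)\<bar> \<le> (\<Sum>i\<in>UNIV. C i) * (norm h)\<^sup>2" for y h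
  proof -
    obtain s where s: "0 < s" "s < 1" and
      eq: "K \<kappa> (y + 1 *\<^sub>R h) - K \<kappa> (y + 0 *\<^sub>R h) = (1 - 0) * (\<Sum>i\<in>UNIV. h $ i * K (inc i \<kappa>) (y + s *\<^sub>R h))"
      using MVT2[OF zero_less_one K_line[of \<kappa> y h]] by blast
    have "K \<kappa> (y + h) - K \<kappa> y - (\<Sum>i\<in>UNIV. h $ i * K (inc i \<kappa>) y) =
       (\<Sum>i\<in>UNIV. h $ i * (K (inc i \<kappa>) (y + s *\<^sub>R h) - K (inc i \<kappa>) y))"
      using eq by (simp add: right_diff_distrib sum_subtractf)
    then have "\<bar>K \<kappa> (y + h) - K \<kappa> y - (\<Sum>i\<in>UNIV. h $ i * K (inc i \<kappa>) y)\<bar> \<le>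
      (\<Sum>i\<in>UNIV. \<bar>h $ i * (K (inc i \<kappa>) (y + s *\<^sub>R h) - K (inc i \<kappa>) y)\<bar>)" by simp
    also have "\<dots> \<le> (\<Sum>i\<in>UNIV. C i * (norm h)\<^sup>2)"
    proof (rule sum_mono)
      fix i
      have "norm (s *\<^sub>R h) \<le> norm h" using s by (simp add: mult_left_le_one_le)
      then have "\<bar>K (inc i \<kappa>) (y + s *\<^sub>R h) - K (inc i \<kappa>) y\<bar> \<le> C i * norm h"
        using C(2)[of i y "s *\<^sub>R h"] C(1)[of i] by (meson mult_left_mono order_trans)
      then have "\<bar>h $ i\<bar> * \<bar>K (inc i \<kappa>) (y + s *\<^sub>R h) - K (inc i \<kappa>) y\<bar> \<le> norm h * (C i * norm h)"
        by (intro mult_mono component_le_norm_cart) auto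
      then show "\<bar>h $ i * (K (inc i \<kappa>) (y + s *\<^sub>R h) - K (inc i \<kappa>) y)\<bar> \<le> C i * (norm h)\<^sup>2"
        by (simp add: abs_mult power2_eq_square mult_ac)
    qed
    finally show ?thesis by (simp add: sum_distrib_right)
  qed
  moreover have "0 \<le> (\<Sum>i\<in>UNIV. C i)" using C by (intro sum_nonneg)
  ultimately show ?thesis by blast
qed

lemma partial_K:
  "has_partial i (\<lambda>y. K \<kappa> (y - x))" "partial i (\<lambda>y. K \<kappa> (y - x)) = (\<lambda>y. K (inc i \<kappa>) (y - x))"
proof -
  have d: "((\<lambda>t. K \<kappa> (y + t *\<^sub>R axis i 1 - x)) has_real_derivative K (inc i \<kappa>) (y - x)) (at 0)" for y
  proof -
    have "(\<Sum>j\<in>UNIV. axis i 1 $ j * K (inc j \<kappa>) (y - x)) = K (inc i \<kappa>) (y - x)"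
      by (simp add: axis_def if_distrib[of "\<lambda>z. z * _"] cong: if_cong)
    then show ?thesis using K_line[of \<kappa> "y - x" "axis i 1" 0] by (simp add: algebra_simps)
  qed
  show "has_partial i (\<lambda>y. K \<kappa> (y - x))"
    unfolding has_partial_def using d real_differentiable_def by blast
  show "partial i (\<lambda>y. K \<kappa> (y - x)) = (\<lambda>y. K (inc i \<kappa>) (y - x))"
    unfolding partial_def using DERIV_imp_deriv[OF d] by auto
qed

lemma K_shift_cont: "continuous_on S (\<lambda>y. K \<kappa> (y - x))"
  by (rule continuous_on_compose2[OF K_cont[of UNIV]]) (auto intro!: continuous_intros)

lemma test_fun_K: "test_fun (\<lambda>y. K \<kappa> (y - x))"
proof -
  have "Ck k (\<lambda>y. K \<kappa> (y - x))" for k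
    by (induction k arbitrary: \<kappa>) (auto simp: partial_K K_shift_cont)
  moreover have "{y. K \<kappa> (y - x) \<noteq> 0} \<subseteq> cball x rad"
    using K_zero[of "_ - x" \<kappa>] by (force simp: dist_norm norm_minus_commute not_le[symmetric])
  then have "compact (closure {y. K \<kappa> (y - x) \<noteq> 0})"
    using bounded_subset[OF bounded_cball] compact_closure by blast
  ultimately show ?thesis by (simp add: test_fun_def)
qed

text \<open>The kernel is taken at y - x, so a derivative in x produces a minus sign, which cancels
  the one in \<open>weak_partial\<close>: derivatives of \<open>conv u\<close> are convolutions of
  weak derivatives.\<close>

definition conv :: "(('q, 'r) pt \<Rightarrow> real) \<Rightarrow> ('q + 'r \<Rightarrow> nat) \<Rightarrow> ('q, 'r) pt \<Rightarrow> real" where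
  "conv g \<kappa> x = (\<integral>y. g y * K \<kappa> (y - x) \<partial>lborel)"

lemma locint_times_integrable:
  assumes g: "locint g" and k: "k \<in> borel_measurable borel" and kb: "\<And>y. \<bar>k y\<bar> \<le> C * indicator (cball x R) y"
  shows "integrable lborel (\<lambda>y. g y * k y)"
    "\<bar>\<integral>y. g y * k y \<partial>lborel\<bar> \<le> C * enn2real (\<integral>\<^sup>+ y. ennreal \<bar>g y\<bar> * indicator (cball x R) y \<partial>lborel)"
proof -
  have gm [measurable]: "g \<in> borel_measurable borel" using g by (simp add: locint_def)
  note [measurable] = k
  have le: "ennreal (norm (g y * k y)) \<le> ennreal \<bar>C\<bar> * (ennreal \<bar>g y\<bar> * indicator (cball x R) y)" for y
  proof -
    have "\<bar>g y * k y\<bar> \<le> \<bar>C\<bar> * (\<bar>g y\<bar> * indicator (cball x R) y)"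
    proof -
      have "\<bar>k y\<bar> \<le> \<bar>C\<bar> * indicator (cball x R) y" using kb[of y] by (auto simp: indicator_def split: if_splits)
      then have "\<bar>g y\<bar> * \<bar>k y\<bar> \<le> \<bar>g y\<bar> * (\<bar>C\<bar> * indicator (cball x R) y)" by (rule mult_left_mono) simp
      then show ?thesis by (simp add: abs_mult mult_ac)
    qed
    then have "ennreal (norm (g y * k y)) \<le> ennreal (\<bar>C\<bar> * (\<bar>g y\<bar> * indicator (cball x R) y))" by (simp add: ennreal_leI)
    also have "\<dots> = ennreal \<bar>C\<bar> * (ennreal \<bar>g y\<bar> * indicator (cball x R) y)"
      by (simp add: ennreal_mult ennreal_indicator)
    finally show ?thesis .
  qed
  have m: "(\<lambda>y. ennreal \<bar>g y\<bar> * indicator (cball x R) y) \<in> borel_measurable lborel"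
    by (intro borel_measurable_times_ennreal borel_measurable_indicator) auto
  let ?I = "\<integral>\<^sup>+ y. ennreal \<bar>g y\<bar> * indicator (cball x R) y \<partial>lborel"
  have fin: "?I < \<infinity>" using g by (simp add: locint_def)
  have "(\<integral>\<^sup>+ y. ennreal (norm (g y * k y)) \<partial>lborel) \<le> (\<integral>\<^sup>+ y. ennreal \<bar>C\<bar> * (ennreal \<bar>g y\<bar> * indicator (cball x R) y) \<partial>lborel)"
    by (rule nn_integral_mono) (rule le)
  also have "\<dots> = ennreal \<bar>C\<bar> * ?I" by (rule nn_integral_cmult[OF m])
  finally have I: "(\<integral>\<^sup>+ y. ennreal (norm (g y * k y)) \<partial>lborel) \<le> ennreal \<bar>C\<bar> * ?I" .
  also have "\<dots> < \<infinity>" using fin by (simp add: ennreal_mult_less_top)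
  finally show int: "integrable lborel (\<lambda>y. g y * k y)" by (intro integrableI_bounded) auto
  have "ennreal (norm (\<integral>y. g y * k y \<partial>lborel)) \<le> (\<integral>\<^sup>+ y. ennreal (norm (g y * k y)) \<partial>lborel)"
    by (rule integral_norm_bound_ennreal[OF int])
  also note I
  also have "ennreal \<bar>C\<bar> * ?I = ennreal (\<bar>C\<bar> * enn2real ?I)"
    using fin by (simp add: ennreal_mult ennreal_enn2real_if)
  finally have "norm (\<integral>y. g y * k y \<partial>lborel) \<le> \<bar>C\<bar> * enn2real ?I"
    by (rule iffD1[OF ennreal_le_iff, rotated]) simp
  \<comment> \<open>\<open>C\<close> can be negative only when R is, and then the ball is empty and
    the integral zero.\<close>
  moreover have "\<bar>C\<bar> * enn2real ?I \<le> C * enn2real ?I"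
  proof (cases "0 \<le> R")
    case True
    then have "0 \<le> C" using kb[of x] by (auto simp: indicator_def intro: order_trans[OF abs_ge_zero])
    then show ?thesis by simp
  next
    case False
    then show ?thesis by (simp add: cball_empty)
  qed
  ultimately show "\<bar>\<integral>y. g y * k y \<partial>lborel\<bar> \<le> C * enn2real ?I" by simp
qed

lemma K_shift_meas [measurable]: "(\<lambda>y. K \<kappa> (y - x)) \<in> borel_measurable borel"
  by (rule borel_measurable_continuous_onI[OF K_shift_cont])

lemma conv_integrable:
  assumes "locint g"
  shows "integrable lborel (\<lambda>y. g y * K \<kappa> (y - x))"
proof -
  obtain C where C: "0 \<le> C" "\<And>y. \<bar>K \<kappa> y\<bar> \<le> C" using K_bdd by blast
  show ?thesis
  proof (rule locint_times_integrable(1)[OF assms K_shift_meas])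
    show "\<bar>K \<kappa> (y - x)\<bar> \<le> C * indicator (cball x rad) y" for y
      using C(2)[of "y - x"] K_zero[of "y - x" \<kappa>] by (auto simp: indicator_def dist_norm norm_minus_commute not_le)
  qed
qed

lemma conv_deriv:
  assumes g: "locint g"
  shows "(conv g \<kappa> has_derivative (\<lambda>h. \<Sum>i\<in>UNIV. h $ i * (- conv g (inc i \<kappa>) x))) (at x)"
proof -
  obtain C where C: "0 \<le> C" "\<And>y h. \<bar>K \<kappa> (y + h) - K \<kappa> y - (\<Sum>i\<in>UNIV. h $ i * K (inc i \<kappa>) y)\<bar> \<le> C * (norm h)\<^sup>2"
    using K_taylor by blast
  \<comment> \<open>For shifts h shorter than 1 both kernels, at x and at x + h, vanish outside the
    ball of radius \<open>rad + 1\<close>.\<close>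
  define I where "I = enn2real (\<integral>\<^sup>+ y. ennreal \<bar>g y\<bar> * indicator (cball x (rad + 1)) y \<partial>lborel)"
  have I0: "0 \<le> I" by (simp add: I_def)
  have est: "\<bar>conv g \<kappa> (x + h) - conv g \<kappa> x - (\<Sum>i\<in>UNIV. h $ i * (- conv g (inc i \<kappa>) x))\<bar> \<le> C * (norm h)\<^sup>2 * I"
    if h: "norm h < 1" for h
  proof -
    let ?k = "\<lambda>y. K \<kappa> (y - (x + h)) - K \<kappa> (y - x) + (\<Sum>i\<in>UNIV. h $ i * K (inc i \<kappa>) (y - x))"
    have "(\<integral>y. g y * ?k y \<partial>lborel) = (\<integral>y. (g y * K \<kappa> (y - (x + h)) - g y * K \<kappa> (y - x)) + (\<Sum>i\<in>UNIV. h $ i * (g y * K (inc i \<kappa>) (y - x))) \<partial>lborel)"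
      by (intro Bochner_Integration.integral_cong) (auto simp: algebra_simps sum_distrib_left)
    also have "\<dots> = (conv g \<kappa> (x + h) - conv g \<kappa> x) + (\<Sum>i\<in>UNIV. h $ i * conv g (inc i \<kappa>) x)"
      unfolding conv_def using conv_integrable[OF g]
      by (subst Bochner_Integration.integral_add) (auto simp: Bochner_Integration.integral_diff Bochner_Integration.integral_sum)
    finally have eq: "conv g \<kappa> (x + h) - conv g \<kappa> x - (\<Sum>i\<in>UNIV. h $ i * (- conv g (inc i \<kappa>) x)) = (\<integral>y. g y * ?k y \<partial>lborel)"
      by (simp add: sum_negf)
    show ?thesis unfolding eq I_def
    proof (rule locint_times_integrable(2)[OF g])
      show "?k \<in> borel_measurable borel" by measurable
      fix y
      show "\<bar>?k y\<bar> \<le> C * (norm h)\<^sup>2 * indicator (cball x (rad + 1)) y"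
      proof (cases "y \<in> cball x (rad + 1)")
        case True
        then show ?thesis using C(2)[of "y - x" "- h"] by (simp add: sum_negf algebra_simps)
      next
        case False
        then have r: "rad + 1 \<le> norm (y - x)" by (simp add: dist_norm norm_minus_commute)
        then have "rad \<le> norm (y - (x + h))" using h norm_triangle_ineq4[of "y - x" h]
            norm_triangle_ineq2[of "y - x" h] by (simp add: diff_diff_eq)
        then show ?thesis using r K_zero C(1) by simp
      qed
    qed
  qed
  show ?thesis
    unfolding has_derivative_at_alt
  proof (intro conjI allI impI)
    show "bounded_linear (\<lambda>h. \<Sum>i\<in>UNIV. h $ i * (- conv g (inc i \<kappa>) x))"
      by (intro bounded_linear_sum bounded_linear_mult_left[THEN bounded_linear_compose] bounded_linear_vec_nth)
    fix e :: real assume e: "0 < e"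
    have CI: "0 < C * I + 1" using C I0 by (simp add: add_nonneg_pos)
    let ?d = "min 1 (e / (C * I + 1))"
    have "norm (conv g \<kappa> y - conv g \<kappa> x - (\<Sum>i\<in>UNIV. (y - x) $ i * (- conv g (inc i \<kappa>) x))) \<le> e * norm (y - x)"
      if y: "norm (y - x) < ?d" for y
    proof -
      have "norm (conv g \<kappa> y - conv g \<kappa> x - (\<Sum>i\<in>UNIV. (y - x) $ i * (- conv g (inc i \<kappa>) x))) \<le> C * (norm (y - x))\<^sup>2 * I"
        using est[of "y - x"] y by simp
      also have "\<dots> = (C * I * norm (y - x)) * norm (y - x)" by (simp add: power2_eq_square)
      also have "\<dots> \<le> e * norm (y - x)"
      proof (rule mult_right_mono)
        have "C * I * norm (y - x) \<le> (C * I + 1) * (e / (C * I + 1))" using y C I0 CI by (intro mult_mono) auto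
        then show "C * I * norm (y - x) \<le> e" using CI by simp
      qed simp
      finally show ?thesis .
    qed
    then show "\<exists>d>0. \<forall>y. norm (y - x) < d \<longrightarrow> norm (conv g \<kappa> y - conv g \<kappa> x - (\<Sum>i\<in>UNIV. (y - x) $ i * (- conv g (inc i \<kappa>) x))) \<le> e * norm (y - x)"
      using e CI by (intro exI[of _ ?d]) auto
  qed
qed

lemma conv_weak:
  assumes "weak_partial i u g"
  shows "conv u (inc i \<kappa>) x = - conv g \<kappa> x"
proof -
  have "(\<integral>y. u y * partial i (\<lambda>y. K \<kappa> (y - x)) y \<partial>lborel) = - (\<integral>y. g y * K \<kappa> (y - x) \<partial>lborel)"
    using assms test_fun_K[of \<kappa> x] unfolding weak_partial_def by blast
  then show ?thesis by (simp add: conv_def partial_K)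
qed

lemma conv_C2_data:
  assumes 1: "\<And>i. weak_partial i u (g1 i)" and 2: "\<And>i j. weak_partial j (g1 i) (g2 i j)"
  shows "C2_data (conv u (\<lambda>_. 0)) (\<lambda>x. \<chi> i. conv (g1 i) (\<lambda>_. 0) x) (\<lambda>x. \<chi> i j. conv (g2 i j) (\<lambda>_. 0) x)"
proof (rule C2_dataI)
  have li: "locint u" "locint (g1 i)" "locint (g2 i j)" for i j
    using 1[of i] 2[of j i] unfolding weak_partial_def by (auto intro: Lp_loc_1_locint)
  fix x
  show "(conv u (\<lambda>_. 0) has_derivative (\<lambda>v. (\<chi> i. conv (g1 i) (\<lambda>_. 0) x) \<bullet> v)) (at x)"
    using conv_deriv[OF li(1), of "\<lambda>_. 0" x] by (simp add: conv_weak[OF 1] inner_vec_def mult.commute)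
  show "((\<lambda>x. \<chi> i. conv (g1 i) (\<lambda>_. 0) x) has_derivative (\<lambda>v. (\<chi> i j. conv (g2 i j) (\<lambda>_. 0) x) *v v)) (at x)"
  proof (rule has_derivative_vecI)
    fix i
    show "((\<lambda>x. (\<chi> i. conv (g1 i) (\<lambda>_. 0) x) $ i) has_derivative (\<lambda>v. ((\<chi> i j. conv (g2 i j) (\<lambda>_. 0) x) *v v) $ i)) (at x)"
      using conv_deriv[OF li(2)[of i], of "\<lambda>_. 0" x] by (simp add: conv_weak[OF 2] matrix_vector_mult_def mult.commute)
  qed
  fix i j
  \<comment> \<open>Both derivatives are moved onto the kernel, where they commute. This makes the
    mollified Hessian symmetric although nothing is assumed about symmetry of
    \<open>g2\<close>.\<close>
  have "conv (g2 i j) (\<lambda>_. 0) x = conv u (inc i (inc j (\<lambda>_. 0))) x" for i j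
    by (simp add: conv_weak[OF 1] conv_weak[OF 2])
  then show "(\<chi> i j. conv (g2 i j) (\<lambda>_. 0) x) $ i $ j = (\<chi> i j. conv (g2 i j) (\<lambda>_. 0) x) $ j $ i"
    using inc_commute[of i j "\<lambda>_. 0"] by simp
next
  have "continuous_on UNIV (conv (g2 i j) (\<lambda>_. 0))" for i j
  proof -
    have "locint (g2 i j)" using 2[of j i] unfolding weak_partial_def by (auto intro: Lp_loc_1_locint)
    from conv_deriv[OF this] show ?thesis
      by (meson continuous_at_imp_continuous_on has_derivative_continuous)
  qed
  then show "continuous_on UNIV (\<lambda>x. \<chi> i j. conv (g2 i j) (\<lambda>_. 0) x)"
    by (intro continuous_on_vec_lambda)
qed

end

text \<open>The n-th power of the L^n norm over \<open>S\<close>, without the root to match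
  \<open>ABP\<close> and \<open>gsol\<close>. The price is a factor 2^n in the triangle inequality
  \<open>Lpn_add\<close>.\<close>

definition Lpn :: "nat \<Rightarrow> 'a::euclidean_space set \<Rightarrow> ('a \<Rightarrow> real) \<Rightarrow> ennreal" where
  "Lpn n S f = (\<integral>\<^sup>+ x. ennreal (\<bar>f x\<bar> ^ n) * indicator S x \<partial>lborel)"

lemma Lpn_integrand_measurable:
  assumes "f \<in> borel_measurable borel" "S \<in> sets borel"
  shows "(\<lambda>x. ennreal (\<bar>f x\<bar> ^ n) * indicator S x) \<in> borel_measurable lborel"
proof -
  note [measurable] = assms(1)
  have "(\<lambda>x. ennreal (\<bar>f x\<bar> ^ n)) \<in> borel_measurable lborel" by measurable
  then show ?thesis using assms(2) by (intro borel_measurable_times_ennreal borel_measurable_indicator) auto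
qed

lemma Lpn_mono: "(\<And>x. x \<in> S \<Longrightarrow> \<bar>f x\<bar> \<le> \<bar>g x\<bar>) \<Longrightarrow> S \<subseteq> T \<Longrightarrow> Lpn n S f \<le> Lpn n T g"
  unfolding Lpn_def
  by (rule nn_integral_mono) (auto simp: indicator_def intro!: ennreal_leI power_mono)

lemma Lpn_add:
  assumes f: "f \<in> borel_measurable borel" "g \<in> borel_measurable borel" and S: "S \<in> sets borel"
  shows "Lpn n S (\<lambda>x. f x + g x) \<le> ennreal (2 ^ n) * (Lpn n S f + Lpn n S g)"
proof -
  note m = Lpn_integrand_measurable[OF f(1) S, of n] Lpn_integrand_measurable[OF f(2) S, of n]
  have "Lpn n S (\<lambda>x. f x + g x) \<le> (\<integral>\<^sup>+ x. ennreal (2 ^ n) * (ennreal (\<bar>f x\<bar> ^ n) * indicator S x + ennreal (\<bar>g x\<bar> ^ n) * indicator S x) \<partial>lborel)"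
    unfolding Lpn_def
  proof (rule nn_integral_mono)
    fix x
    have "\<bar>f x + g x\<bar> ^ n \<le> (\<bar>f x\<bar> + \<bar>g x\<bar>) ^ n" by (intro power_mono) auto
    also have "\<dots> \<le> 2 ^ n * (\<bar>f x\<bar> ^ n + \<bar>g x\<bar> ^ n)" by (intro add_power_le) auto
    finally have "ennreal (\<bar>f x + g x\<bar> ^ n) \<le> ennreal (2 ^ n * (\<bar>f x\<bar> ^ n + \<bar>g x\<bar> ^ n))" by (rule ennreal_leI)
    also have "\<dots> = ennreal (2 ^ n) * (ennreal (\<bar>f x\<bar> ^ n) + ennreal (\<bar>g x\<bar> ^ n))"
      by (simp add: ennreal_mult)
    finally show "ennreal (\<bar>f x + g x\<bar> ^ n) * indicator S x \<le>
        ennreal (2 ^ n) * (ennreal (\<bar>f x\<bar> ^ n) * indicator S x + ennreal (\<bar>g x\<bar> ^ n) * indicator S x)"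
      by (auto simp: indicator_def)
  qed
  also have "\<dots> = ennreal (2 ^ n) * (Lpn n S f + Lpn n S g)"
    unfolding Lpn_def using m by (simp add: nn_integral_cmult nn_integral_add)
  finally show ?thesis .
qed

lemma Lpn_le_const: "S \<in> sets borel \<Longrightarrow> (\<And>x. x \<in> S \<Longrightarrow> \<bar>f x\<bar> \<le> s) \<Longrightarrow> Lpn n S f \<le> ennreal (s ^ n) * emeasure lborel S"
proof -
  assume S: "S \<in> sets borel" and le: "\<And>x. x \<in> S \<Longrightarrow> \<bar>f x\<bar> \<le> s"
  have "Lpn n S f \<le> (\<integral>\<^sup>+ x. ennreal (s ^ n) * indicator S x \<partial>lborel)"
    unfolding Lpn_def by (rule nn_integral_mono) (auto simp: indicator_def intro!: ennreal_leI power_mono le)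
  also have "\<dots> = ennreal (s ^ n) * emeasure lborel S" using S by (simp add: nn_integral_cmult_indicator)
  finally show ?thesis .
qed

definition clamp_real :: "real \<Rightarrow> real \<Rightarrow> real" where
  "clamp_real M t = max (- M) (min M t)"

lemma Lpn_dominated:
  fixes f :: "nat \<Rightarrow> 'a::euclidean_space \<Rightarrow> real"
  assumes n: "0 < n" and S: "S \<in> sets borel" and f: "\<And>k. f k \<in> borel_measurable borel" and w: "w \<in> borel_measurable borel"
    and fin: "Lpn n S w < \<infinity>" and le: "\<And>k x. x \<in> S \<Longrightarrow> \<bar>f k x\<bar> \<le> \<bar>w x\<bar>"
    and lim: "AE x in lborel. x \<in> S \<longrightarrow> (\<lambda>k. f k x) \<longlonglongrightarrow> 0"
  shows "(\<lambda>k. Lpn n S (f k)) \<longlonglongrightarrow> 0"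
proof -
  have "(\<lambda>k. \<integral>\<^sup>+ x. ennreal (\<bar>f k x\<bar> ^ n) * indicator S x \<partial>lborel) \<longlonglongrightarrow> (\<integral>\<^sup>+ x. 0 \<partial>(lborel :: 'a measure))"
  proof (rule nn_integral_dominated_convergence[where w = "\<lambda>x. ennreal (\<bar>w x\<bar> ^ n) * indicator S x"])
    show "(\<lambda>x. ennreal (\<bar>f k x\<bar> ^ n) * indicator S x) \<in> borel_measurable lborel" for k
      by (rule Lpn_integrand_measurable[OF f S])
    show "(\<lambda>x. ennreal (\<bar>w x\<bar> ^ n) * indicator S x) \<in> borel_measurable lborel"
      by (rule Lpn_integrand_measurable[OF w S])
    show "(\<integral>\<^sup>+ x. ennreal (\<bar>w x\<bar> ^ n) * indicator S x \<partial>lborel) < \<infinity>" using fin by (simp add: Lpn_def)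
    show "AE x in lborel. ennreal (\<bar>f k x\<bar> ^ n) * indicator S x \<le> ennreal (\<bar>w x\<bar> ^ n) * indicator S x" for k
      by (rule AE_I2) (auto simp: indicator_def intro!: ennreal_leI power_mono le)
    show "AE x in lborel. (\<lambda>k. ennreal (\<bar>f k x\<bar> ^ n) * indicator S x) \<longlonglongrightarrow> 0"
      using lim
    proof eventually_elim
      case (elim x)
      show ?case
      proof (cases "x \<in> S")
        case True
        then have l: "(\<lambda>k. \<bar>f k x\<bar> ^ n) \<longlonglongrightarrow> \<bar>0\<bar> ^ n" using elim by (intro tendsto_intros) auto
        have "\<bar>0::real\<bar> ^ n = 0" using n by simp
        from tendsto_ennrealI[OF l[unfolded this]]
        have "(\<lambda>k. ennreal (\<bar>f k x\<bar> ^ n)) \<longlonglongrightarrow> ennreal 0" .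
        then show ?thesis using True by simp
      qed simp
    qed
  qed auto
  then show ?thesis by (simp add: Lpn_def)
qed

text \<open>First \<open>g\<close> is truncated, then the continuous functions that converge to
  \<open>g\<close> almost everywhere are truncated at the same level. A constant then dominates the
  differences on the ball, so dominated convergence applies.\<close>

lemma Lpn_continuous_approx:
  fixes g :: "'a::euclidean_space \<Rightarrow> real"
  assumes n: "0 < n" and g: "g \<in> borel_measurable borel" and fin: "Lpn n (ball 0 R) g < \<infinity>" and eta: "0 < (\<eta>::real)"
  shows "\<exists>h. continuous_on UNIV h \<and> Lpn n (ball 0 R) (\<lambda>x. g x - h x) \<le> ennreal \<eta>"
proof -
  let ?S = "ball (0::'a) R"
  have S: "?S \<in> sets borel" by simp
  define \<eta>' where "\<eta>' = \<eta> / (2 * 2 ^ n)"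
  have eta': "0 < \<eta>'" using eta by (simp add: \<eta>'_def)
  have gm: "(\<lambda>x. g x - clamp_real M (g x)) \<in> borel_measurable borel" for M
    using g unfolding clamp_real_def by measurable
  have "(\<lambda>k. Lpn n ?S (\<lambda>x. g x - clamp_real (real k) (g x))) \<longlonglongrightarrow> 0"
  proof (rule Lpn_dominated[OF n S gm g fin])
    show "\<bar>g x - clamp_real (real k) (g x)\<bar> \<le> \<bar>g x\<bar>" for k x by (auto simp: clamp_real_def)
    show "AE x in lborel. x \<in> ?S \<longrightarrow> (\<lambda>k. g x - clamp_real (real k) (g x)) \<longlonglongrightarrow> 0"
    proof (rule AE_I2, rule impI)
      fix x
      obtain k0 :: nat where k0: "\<bar>g x\<bar> \<le> real k0" using real_arch_simple by blast
      have "\<forall>\<^sub>F k in sequentially. g x - clamp_real (real k) (g x) = 0"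
        using eventually_ge_at_top[of k0]
      proof eventually_elim
        case (elim k)
        then have "real k0 \<le> real k" by simp
        then show ?case using k0 by (auto simp: clamp_real_def)
      qed
      then show "(\<lambda>k. g x - clamp_real (real k) (g x)) \<longlonglongrightarrow> 0" by (rule tendsto_eventually)
    qed
  qed
  then have "\<forall>\<^sub>F k in sequentially. Lpn n ?S (\<lambda>x. g x - clamp_real (real k) (g x)) < ennreal \<eta>'"
    using eta' by (intro order_tendstoD) auto
  then obtain k where k: "Lpn n ?S (\<lambda>x. g x - clamp_real (real k) (g x)) < ennreal \<eta>'"
    using eventually_happens'[OF sequentially_bot] by blast
  define M where "M = real k"
  have M0: "0 \<le> M" by (simp add: M_def)
  have "g \<in> borel_measurable lebesgue" using g by (simp add: measurable_completion)
  then have "g measurable_on UNIV" by (intro lebesgue_measurable_imp_measurable_on) auto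
  then obtain N h where N: "negligible N" and h: "\<And>k. continuous_on UNIV (h k)" "\<And>x. x \<notin> N \<Longrightarrow> (\<lambda>k. h k x) \<longlonglongrightarrow> g x"
    unfolding measurable_on_def by auto
  have hm: "h k \<in> borel_measurable borel" for k using h(1) by (rule borel_measurable_continuous_onI)
  have hc: "continuous_on UNIV (\<lambda>x. clamp_real M (h k x))" for k
    unfolding clamp_real_def by (intro continuous_intros h)
  have dm: "(\<lambda>x. clamp_real M (g x) - clamp_real M (h k x)) \<in> borel_measurable borel" for k
    using g hm[of k] unfolding clamp_real_def by measurable
  have "(\<lambda>k. Lpn n ?S (\<lambda>x. clamp_real M (g x) - clamp_real M (h k x))) \<longlonglongrightarrow> 0"
  proof (rule Lpn_dominated[OF n S dm, where w = "\<lambda>x. 2 * M"])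
    have "Lpn n ?S (\<lambda>x. 2 * M) \<le> ennreal ((2 * M) ^ n) * emeasure lborel ?S"
      using M0 by (intro Lpn_le_const) auto
    also have "\<dots> < \<infinity>" using emeasure_lborel_ball_finite[of "0 :: 'a" R] by (simp add: ennreal_mult_less_top)
    finally show "Lpn n ?S (\<lambda>x. 2 * M) < \<infinity>" .
    show "\<bar>clamp_real M (g x) - clamp_real M (h k x)\<bar> \<le> \<bar>2 * M\<bar>" for k x using M0 by (auto simp: clamp_real_def)
    have "AE x in lebesgue. x \<notin> N" using N by (intro AE_not_in) (simp add: negligible_iff_null_sets)
    then have "AE x in lborel. x \<notin> N" by (simp add: AE_completion_iff)
    then show "AE x in lborel. x \<in> ?S \<longrightarrow> (\<lambda>k. clamp_real M (g x) - clamp_real M (h k x)) \<longlonglongrightarrow> 0"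
    proof eventually_elim
      case (elim x)
      then have "(\<lambda>k. clamp_real M (g x) - clamp_real M (h k x)) \<longlonglongrightarrow> clamp_real M (g x) - clamp_real M (g x)"
        unfolding clamp_real_def by (intro tendsto_intros h)
      then show ?case by simp
    qed
  qed simp
  then have "\<forall>\<^sub>F k in sequentially. Lpn n ?S (\<lambda>x. clamp_real M (g x) - clamp_real M (h k x)) < ennreal \<eta>'"
    using eta' by (intro order_tendstoD) auto
  then obtain j where j: "Lpn n ?S (\<lambda>x. clamp_real M (g x) - clamp_real M (h j x)) < ennreal \<eta>'"
    using eventually_happens'[OF sequentially_bot] by blast
  have "Lpn n ?S (\<lambda>x. g x - clamp_real M (h j x)) = Lpn n ?S (\<lambda>x. (g x - clamp_real M (g x)) + (clamp_real M (g x) - clamp_real M (h j x)))"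
    by simp
  also have "\<dots> \<le> ennreal (2 ^ n) * (Lpn n ?S (\<lambda>x. g x - clamp_real M (g x)) + Lpn n ?S (\<lambda>x. clamp_real M (g x) - clamp_real M (h j x)))"
    by (rule Lpn_add[OF gm dm S])
  also have "\<dots> \<le> ennreal (2 ^ n) * (ennreal \<eta>' + ennreal \<eta>')"
    using k j by (intro mult_left_mono add_mono) (auto simp: M_def)
  also have "\<dots> = ennreal \<eta>"
    using eta' by (simp add: ennreal_plus[symmetric] ennreal_mult[symmetric] \<eta>'_def del: ennreal_plus)
  finally show ?thesis using hc by blast
qed

text \<open>The graph of t^(m + 1) lies above its tangent at a, rearranged so that no term is
  subtracted.\<close>

lemma power_tangent_le:
  fixes a t :: real
  assumes "0 \<le> a" "0 \<le> t"
  shows "real (Suc m) * a ^ m * t \<le> t ^ Suc m + real m * a ^ Suc m"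
proof (induction m)
  case (Suc m)
  have "t * (real (Suc m) * a ^ m * t) \<le> t * (t ^ Suc m + real m * a ^ Suc m)"
    using Suc assms by (intro mult_left_mono) auto
  moreover have "2 * (a * t) \<le> t\<^sup>2 + a\<^sup>2" using sum_squares_bound[of a t] by (simp add: mult_ac)
  then have "real (Suc m) * a ^ m * (2 * (a * t)) \<le> real (Suc m) * a ^ m * (t\<^sup>2 + a\<^sup>2)"
    using assms by (intro mult_left_mono) auto
  ultimately show ?case by (simp add: power2_eq_square algebra_simps)
qed simp

lemma continuous_locint: "continuous_on UNIV h \<Longrightarrow> locint h"
proof -
  assume h: "continuous_on UNIV h"
  have "(\<integral>\<^sup>+ y. ennreal \<bar>h y\<bar> * indicator (cball x R) y \<partial>lborel) < \<infinity>" for x R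
  proof -
    have "compact (h ` cball x R)" by (intro compact_continuous_image continuous_on_subset[OF h]) auto
    then obtain C where C: "\<And>y. y \<in> cball x R \<Longrightarrow> \<bar>h y\<bar> \<le> C"
      using compact_imp_bounded bounded_iff by (metis imageI real_norm_def)
    have "(\<integral>\<^sup>+ y. ennreal \<bar>h y\<bar> * indicator (cball x R) y \<partial>lborel) \<le> (\<integral>\<^sup>+ y. ennreal C * indicator (cball x R) y \<partial>lborel)"
      by (rule nn_integral_mono) (use C in \<open>auto simp: indicator_def intro!: ennreal_leI\<close>)
    also have "\<dots> < \<infinity>" using emeasure_lborel_cball_finite[of x R] by (simp add: nn_integral_cmult_indicator ennreal_mult_less_top)
    finally show ?thesis .
  qed
  then show ?thesis using h by (simp add: locint_def borel_measurable_continuous_onI)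
qed

section \<open>Normalised mollifiers\<close>

locale mollifier = smooth_kernel +
  assumes K_total: "(\<integral>\<^sup>+ y. ennreal (K (\<lambda>_. 0) y) \<partial>lborel) = 1"
begin

abbreviation K0 :: "('a, 'b) pt \<Rightarrow> real" where "K0 \<equiv> K (\<lambda>_. 0)"
abbreviation mol :: "(('a, 'b) pt \<Rightarrow> real) \<Rightarrow> ('a, 'b) pt \<Rightarrow> real" where "mol g \<equiv> conv g (\<lambda>_. 0)"

lemma K0_nonneg: "0 \<le> K0 y"
  unfolding K_def using c0 B_nonneg by (intro mult_nonneg_nonneg prod_nonneg) auto

lemma K0_even: "K0 (x - y) = K0 (y - x)"
proof -
  have "B 0 (x $ i - y $ i) = B 0 (y $ i - x $ i)" for i using B_even[of "y $ i - x $ i"] by simp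
  then show ?thesis by (simp add: K_def)
qed

lemma K0_total: "(\<integral>\<^sup>+ y. ennreal (K0 (y - x)) \<partial>lborel) = 1" "(\<integral>\<^sup>+ x. ennreal (K0 (y - x)) \<partial>lborel) = 1"
proof -
  have *: "(\<integral>\<^sup>+ y. ennreal (K0 (y - x)) \<partial>lborel) = 1" for x
    using nn_integral_lborel_translate[of "\<lambda>y. ennreal (K0 y)" "- x"] K_total by simp
  show "(\<integral>\<^sup>+ y. ennreal (K0 (y - x)) \<partial>lborel) = 1" by (rule *)
  show "(\<integral>\<^sup>+ x. ennreal (K0 (y - x)) \<partial>lborel) = 1" unfolding K0_even[of y] by (rule *)
qed

lemma mol_abs_le_nn_integral: "locint g \<Longrightarrow> ennreal \<bar>mol g x\<bar> \<le> (\<integral>\<^sup>+ y. ennreal (\<bar>g y\<bar> * K0 (y - x)) \<partial>lborel)"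
  using integral_norm_bound_ennreal[OF conv_integrable, of g "\<lambda>_. 0" x] K0_nonneg
  by (simp add: conv_def abs_mult)

lemma mol_le:
  assumes g: "locint g" and le: "\<And>y. norm (y - x) \<le> rad \<Longrightarrow> \<bar>g y\<bar> \<le> b" and b: "0 \<le> b"
  shows "\<bar>mol g x\<bar> \<le> b"
proof -
  have "ennreal \<bar>mol g x\<bar> \<le> (\<integral>\<^sup>+ y. ennreal (\<bar>g y\<bar> * K0 (y - x)) \<partial>lborel)" by (rule mol_abs_le_nn_integral[OF g])
  also have "\<dots> \<le> (\<integral>\<^sup>+ y. ennreal b * ennreal (K0 (y - x)) \<partial>lborel)"
  proof (rule nn_integral_mono)
    fix y
    have "\<bar>g y\<bar> * K0 (y - x) \<le> b * K0 (y - x)"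
    proof (cases "norm (y - x) \<le> rad")
      case True
      then show ?thesis using le K0_nonneg by (intro mult_right_mono) auto
    next
      case False
      then show ?thesis using K_zero[of "y - x" "\<lambda>_. 0"] by simp
    qed
    then have "ennreal (\<bar>g y\<bar> * K0 (y - x)) \<le> ennreal (b * K0 (y - x))" by (rule ennreal_leI)
    then show "ennreal (\<bar>g y\<bar> * K0 (y - x)) \<le> ennreal b * ennreal (K0 (y - x))" using b K0_nonneg by (simp add: ennreal_mult)
  qed
  also have "\<dots> = ennreal b" by (subst nn_integral_cmult) (auto simp: K0_total)
  finally show ?thesis using b by simp
qed

lemma mol_diff: "locint g \<Longrightarrow> locint h \<Longrightarrow> mol (\<lambda>y. g y - h y) x = mol g x - mol h x"
  unfolding conv_def left_diff_distrib
  by (rule Bochner_Integration.integral_diff) (rule conv_integrable, assumption)+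

lemma mol_const: "mol (\<lambda>y. b) x = b"
proof -
  have int: "integrable lborel (\<lambda>y. K0 (y - x))"
    using conv_integrable[OF continuous_locint[OF continuous_on_const], of 1 "\<lambda>_. 0" x] by simp
  have "ennreal (\<integral>y. K0 (y - x) \<partial>lborel) = 1"
    using nn_integral_eq_integral[OF int] K0_nonneg K0_total(1)[of x] by simp
  then have "(\<integral>y. K0 (y - x) \<partial>lborel) = 1" by (simp add: ennreal_eq_1)
  then show ?thesis by (simp add: conv_def)
qed

text \<open>Jensen by the tangent at a = |\<open>mol g x\<close>|: integrating
  \<open>power_tangent_le\<close> against the kernel gives (m + 1) a^(m + 1) \<le> J + m a^(m + 1).
  The case of an infinite J is set aside so that the subtraction takes place in the reals.\<close>

lemma mol_jensen:
  assumes g: "locint g"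
  shows "ennreal (\<bar>mol g x\<bar> ^ Suc m) \<le> (\<integral>\<^sup>+ y. ennreal (\<bar>g y\<bar> ^ Suc m) * ennreal (K0 (y - x)) \<partial>lborel)" (is "_ \<le> ?J")
proof (cases "?J = \<infinity>")
  case False
  have gm [measurable]: "g \<in> borel_measurable borel" using g by (simp add: locint_def)
  define a where "a = \<bar>mol g x\<bar>"
  have a0: "0 \<le> a" by (simp add: a_def)
  obtain J where J: "?J = ennreal J" "0 \<le> J" using False by (cases ?J) auto
  have "ennreal (real (Suc m) * a ^ m) * ennreal a \<le> ennreal (real (Suc m) * a ^ m) * (\<integral>\<^sup>+ y. ennreal (\<bar>g y\<bar> * K0 (y - x)) \<partial>lborel)"
    unfolding a_def by (intro mult_left_mono mol_abs_le_nn_integral[OF g]) simp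
  also have "\<dots> = (\<integral>\<^sup>+ y. ennreal (real (Suc m) * a ^ m) * ennreal (\<bar>g y\<bar> * K0 (y - x)) \<partial>lborel)"
    by (rule nn_integral_cmult[symmetric]) measurable
  also have "\<dots> \<le> (\<integral>\<^sup>+ y. ennreal (\<bar>g y\<bar> ^ Suc m) * ennreal (K0 (y - x)) + ennreal (real m * a ^ Suc m) * ennreal (K0 (y - x)) \<partial>lborel)"
  proof (rule nn_integral_mono)
    fix y
    have "(real (Suc m) * a ^ m * \<bar>g y\<bar>) * K0 (y - x) \<le> (\<bar>g y\<bar> ^ Suc m + real m * a ^ Suc m) * K0 (y - x)"
      using a0 K0_nonneg by (intro mult_right_mono power_tangent_le) auto
    then have "ennreal ((real (Suc m) * a ^ m * \<bar>g y\<bar>) * K0 (y - x)) \<le> ennreal ((\<bar>g y\<bar> ^ Suc m + real m * a ^ Suc m) * K0 (y - x))"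
      by (rule ennreal_leI)
    then show "ennreal (real (Suc m) * a ^ m) * ennreal (\<bar>g y\<bar> * K0 (y - x)) \<le>
       ennreal (\<bar>g y\<bar> ^ Suc m) * ennreal (K0 (y - x)) + ennreal (real m * a ^ Suc m) * ennreal (K0 (y - x))"
      using a0 K0_nonneg by (simp only: ennreal_mult[symmetric] ennreal_plus[symmetric] distrib_right mult.assoc
          mult_nonneg_nonneg zero_le_power abs_ge_zero of_nat_0_le_iff)
  qed
  also have "\<dots> = ?J + ennreal (real m * a ^ Suc m)"
    by (subst nn_integral_add) (auto simp: nn_integral_cmult K0_total)
  also have "\<dots> = ennreal (J + real m * a ^ Suc m)" using J a0 by simp
  finally have "ennreal (real (Suc m) * a ^ m * a) \<le> ennreal (J + real m * a ^ Suc m)" using a0 by (simp only: ennreal_mult mult_nonneg_nonneg zero_le_power of_nat_0_le_iff)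
  then have "real (Suc m) * a ^ m * a \<le> J + real m * a ^ Suc m"
    by (rule iffD1[OF ennreal_le_iff, rotated]) (use J a0 in simp)
  then have "a ^ Suc m \<le> J" by (simp add: algebra_simps)
  then show ?thesis using J by (simp add: a_def ennreal_leI)
qed simp

lemma mol_cont: "locint g \<Longrightarrow> continuous_on S (mol g)"
  using conv_deriv by (meson continuous_at_imp_continuous_on has_derivative_continuous)

lemma mol_meas: "locint g \<Longrightarrow> mol g \<in> borel_measurable borel"
  by (rule borel_measurable_continuous_onI[OF mol_cont])

text \<open>Jensen pointwise, then Fubini and the unit mass of the kernel in its other variable; the
  ball grows by the support radius.\<close>

lemma Lpn_mol_le:
  assumes g: "locint g"
  shows "Lpn (Suc m) (ball x0 R) (mol g) \<le> Lpn (Suc m) (ball x0 (R + rad)) g"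
proof -
  have gm [measurable]: "g \<in> borel_measurable borel" using g by (simp add: locint_def)
  have Km: "(\<lambda>p. K0 (snd p - fst p)) \<in> borel_measurable borel"
    by (rule borel_measurable_continuous_onI, rule continuous_on_compose2[OF K_cont[of UNIV]]) (auto intro!: continuous_intros)
  have Km': "(\<lambda>(x, y). K0 (y - x)) \<in> borel_measurable (lborel \<Otimes>\<^sub>M lborel)"
    using Km by (simp add: borel_prod[symmetric] case_prod_unfold)
  have "Lpn (Suc m) (ball x0 R) (mol g) \<le> (\<integral>\<^sup>+ x. (\<integral>\<^sup>+ y. ennreal (\<bar>g y\<bar> ^ Suc m) * ennreal (K0 (y - x)) * indicator (ball x0 R) x \<partial>lborel) \<partial>lborel)"
    unfolding Lpn_def
  proof (rule nn_integral_mono)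
    fix x
    show "ennreal (\<bar>mol g x\<bar> ^ Suc m) * indicator (ball x0 R) x \<le>
       (\<integral>\<^sup>+ y. ennreal (\<bar>g y\<bar> ^ Suc m) * ennreal (K0 (y - x)) * indicator (ball x0 R) x \<partial>lborel)"
      using mol_jensen[OF g, of x m] by (cases "x \<in> ball x0 R") auto
  qed
  also have "\<dots> \<le> (\<integral>\<^sup>+ x. (\<integral>\<^sup>+ y. ennreal (\<bar>g y\<bar> ^ Suc m) * indicator (ball x0 (R + rad)) y * ennreal (K0 (y - x)) \<partial>lborel) \<partial>lborel)"
  proof (intro nn_integral_mono)
    fix x y
    show "ennreal (\<bar>g y\<bar> ^ Suc m) * ennreal (K0 (y - x)) * indicator (ball x0 R) x \<le>
       ennreal (\<bar>g y\<bar> ^ Suc m) * indicator (ball x0 (R + rad)) y * ennreal (K0 (y - x))"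
    proof (cases "x \<in> ball x0 R \<and> y \<notin> ball x0 (R + rad)")
      case True
      then have "rad \<le> norm (y - x)"
        using dist_triangle[of x0 y x] by (simp add: dist_norm norm_minus_commute)
      then show ?thesis using K_zero[of "y - x" "\<lambda>_. 0"] by simp
    qed (auto simp: indicator_def)
  qed
  also have "\<dots> = (\<integral>\<^sup>+ y. (\<integral>\<^sup>+ x. ennreal (\<bar>g y\<bar> ^ Suc m) * indicator (ball x0 (R + rad)) y * ennreal (K0 (y - x)) \<partial>lborel) \<partial>lborel)"
  proof (rule lborel_pair.Fubini'[symmetric])
    have m1: "(\<lambda>y. ennreal (\<bar>g y\<bar> ^ Suc m) * indicator (ball x0 (R + rad)) y) \<in> borel_measurable lborel"
      by (rule Lpn_integrand_measurable[OF gm]) simp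
    have "(\<lambda>p. (ennreal (\<bar>g (snd p)\<bar> ^ Suc m) * indicator (ball x0 (R + rad)) (snd p)) * ennreal (case p of (x, y) \<Rightarrow> K0 (y - x)))
        \<in> borel_measurable (lborel \<Otimes>\<^sub>M lborel)"
      by (rule borel_measurable_times_ennreal[OF measurable_compose[OF measurable_snd m1] measurable_compose[OF Km' measurable_ennreal]])
    then show "(\<lambda>(x, y). ennreal (\<bar>g y\<bar> ^ Suc m) * indicator (ball x0 (R + rad)) y * ennreal (K0 (y - x))) \<in> borel_measurable (lborel \<Otimes>\<^sub>M lborel)"
      by (simp add: case_prod_unfold)
  qed
  also have "\<dots> = Lpn (Suc m) (ball x0 (R + rad)) g"
    unfolding Lpn_def by (intro nn_integral_cong) (subst nn_integral_cmult, auto simp: K0_total)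
  finally show ?thesis .
qed

end

lemma mollifier_exists:
  assumes eps: "0 < \<epsilon>"
  shows "\<exists>B c (K :: ('q::finite + 'r::finite \<Rightarrow> nat) \<Rightarrow> ('q, 'r) pt \<Rightarrow> real). mollifier B \<epsilon> c K"
proof -
  obtain \<beta> :: "nat \<Rightarrow> real \<Rightarrow> real" where b: "\<And>k t. (\<beta> k has_real_derivative \<beta> (Suc k) t) (at t)"
    "\<And>k t. 1 \<le> \<bar>t\<bar> \<Longrightarrow> \<beta> k t = 0" "\<And>t. 0 \<le> \<beta> 0 t" "0 < \<beta> 0 0" "\<And>t. \<beta> 0 (- t) = \<beta> 0 t"
    using bump_sequence by blast
  define B where "B k t = (1 / \<epsilon>) ^ k * \<beta> k (t / \<epsilon>)" for k t
  have dB: "(B k has_real_derivative B (Suc k) t) (at t)" for k t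
  proof -
    have "((\<lambda>t. \<beta> k (t / \<epsilon>)) has_real_derivative \<beta> (Suc k) (t / \<epsilon>) * (1 / \<epsilon>)) (at t)"
      using eps by (intro DERIV_chain2[OF b(1)]) (auto intro!: derivative_eq_intros)
    then have "((\<lambda>t. (1 / \<epsilon>) ^ k * \<beta> k (t / \<epsilon>)) has_real_derivative (1 / \<epsilon>) ^ k * (\<beta> (Suc k) (t / \<epsilon>) * (1 / \<epsilon>))) (at t)"
      by (rule DERIV_cmult)
    then show ?thesis unfolding B_def by (simp add: mult_ac)
  qed
  have zB: "B k t = 0" if "\<epsilon> \<le> \<bar>t\<bar>" for k t using that eps b(2)[of "t / \<epsilon>" k] by (simp add: B_def)
  have nB: "0 \<le> B 0 t" and eB: "B 0 (- t) = B 0 t" for t using b(3,5) by (simp_all add: B_def)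
  define P :: "('q + 'r \<Rightarrow> nat) \<Rightarrow> ('q, 'r) pt \<Rightarrow> real" where "P \<kappa> y = 1 * (\<Prod>i\<in>UNIV. B (\<kappa> i) (y $ i))" for \<kappa> y
  \<comment> \<open>The kernel with factor 1 is interpreted first, to show that its integral is
    finite and positive; the inverse of that integral is the factor of the mollifier.\<close>
  interpret P: smooth_kernel B \<epsilon> 1 P
    by unfold_locales (use eps dB zB nB eB in \<open>auto simp: P_def\<close>)
  let ?P = "P (\<lambda>_. 0)"
  let ?I = "\<integral>\<^sup>+ y. ennreal (?P y) \<partial>lborel"
  have P0: "0 \<le> ?P y" for y unfolding P_def using nB by (intro mult_nonneg_nonneg prod_nonneg) auto
  obtain C where C: "0 \<le> C" "\<And>y. \<bar>?P y\<bar> \<le> C" using P.K_bdd by blast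
  have "?I \<le> (\<integral>\<^sup>+ y. ennreal C * indicator (cball (0 :: ('q, 'r) pt) P.rad) y \<partial>lborel)"
  proof (rule nn_integral_mono)
    fix y
    show "ennreal (?P y) \<le> ennreal C * indicator (cball (0 :: ('q, 'r) pt) P.rad) y"
      using C(2)[of y] P0[of y] P.K_zero[of y "\<lambda>_. 0"] by (auto simp: indicator_def intro!: ennreal_leI)
  qed
  also have "\<dots> < \<infinity>" using emeasure_lborel_cball_finite[of "0 :: ('q, 'r) pt" P.rad] by (simp add: nn_integral_cmult_indicator ennreal_mult_less_top)
  finally have fin: "?I < \<infinity>" .
  have pos0: "0 < ?P 0" using b(4) by (simp add: P_def B_def)
  then obtain d where d: "d > 0" "\<And>y. dist y 0 < d \<Longrightarrow> dist (?P y) (?P 0) < ?P 0 / 2"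
    using P.K_cont[of UNIV "\<lambda>_. 0"] unfolding continuous_on_iff by (metis UNIV_I half_gt_zero)
  have "0 < ennreal (?P 0 / 2) * emeasure lborel (ball (0 :: ('q, 'r) pt) d)"
    using pos0 d(1) by (simp add: ennreal_zero_less_mult_iff emeasure_ball)
  also have "\<dots> = (\<integral>\<^sup>+ y. ennreal (?P 0 / 2) * indicator (ball (0 :: ('q, 'r) pt) d) y \<partial>lborel)"
    by (simp add: nn_integral_cmult_indicator)
  also have "\<dots> \<le> ?I"
  proof (rule nn_integral_mono)
    fix y
    show "ennreal (?P 0 / 2) * indicator (ball (0 :: ('q, 'r) pt) d) y \<le> ennreal (?P y)"
    proof (cases "dist y 0 < d")
      case True
      then have "\<bar>?P y - ?P 0\<bar> < ?P 0 / 2" using d(2) by (simp add: dist_real_def)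
      then have "?P 0 / 2 \<le> ?P y" by linarith
      then show ?thesis by (auto simp: indicator_def intro!: ennreal_leI)
    qed (simp add: dist_commute)
  qed
  finally have pos: "0 < ?I" .
  define I where "I = enn2real ?I"
  have I: "?I = ennreal I" "0 < I" using fin pos unfolding I_def
    by (auto simp: enn2real_positive_iff less_top)
  define K :: "('q + 'r \<Rightarrow> nat) \<Rightarrow> ('q, 'r) pt \<Rightarrow> real" where "K \<kappa> y = 1 / I * (\<Prod>i\<in>UNIV. B (\<kappa> i) (y $ i))" for \<kappa> y
  have "mollifier B \<epsilon> (1 / I) K"
  proof unfold_locales
    have "(\<integral>\<^sup>+ y. ennreal (K (\<lambda>_. 0) y) \<partial>lborel) = (\<integral>\<^sup>+ y. ennreal (1 / I) * ennreal (?P y) \<partial>lborel)"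
      using I P0 by (simp add: ennreal_mult'[symmetric] K_def P_def)
    also have "\<dots> = ennreal (1 / I) * ?I" by (rule nn_integral_cmult) (simp add: P.K_meas)
    also have "\<dots> = 1" unfolding I(1) using I(2) by (simp add: ennreal_mult[symmetric])
    finally show "(\<integral>\<^sup>+ y. ennreal (K (\<lambda>_. 0) y) \<partial>lborel) = 1" .
  qed (use eps dB zB nB eB I in \<open>auto simp: K_def\<close>)
  then show ?thesis by blast
qed

text \<open>The scale \<open>\<epsilon>0\<close> comes from uniform continuity of a continuous
  approximant \<open>h\<close>. The other two pieces, g - h and its mollification, are small for
  every kernel of support radius at most 1, which makes the result uniform over mollifiers.\<close>

lemma mol_approx:
  fixes g :: "('q::finite, 'r::finite) pt \<Rightarrow> real"
  assumes g: "locint g" and fin: "\<And>R. Lpn (Suc m) (ball 0 R) g < \<infinity>" and eta: "0 < (\<eta>::real)"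
  shows "\<exists>\<epsilon>0>0. \<forall>B \<epsilon> c K. mollifier B \<epsilon> c K \<longrightarrow> \<epsilon> \<le> \<epsilon>0 \<longrightarrow>
    Lpn (Suc m) (ball 0 R) (\<lambda>x. smooth_kernel.conv K g (\<lambda>_. 0) x - g x) \<le> ennreal \<eta>"
proof -
  let ?n = "Suc m" and ?S = "ball (0 :: ('q, 'r) pt) R" and ?N = "real CARD('q + 'r)"
  have gm: "g \<in> borel_measurable borel" using g by (simp add: locint_def)
  \<comment> \<open>Three pieces are joined by two uses of \<open>Lpn_add\<close>, with total factor
    2^n + 2 * 4^n, at most 3 * 4^n.\<close>
  define \<alpha> where "\<alpha> = \<eta> / (3 * 4 ^ ?n)"
  have al: "0 < \<alpha>" using eta by (simp add: \<alpha>_def)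
  obtain h where h: "continuous_on UNIV h" "Lpn ?n (ball 0 (R + 1)) (\<lambda>x. g x - h x) \<le> ennreal \<alpha>"
    using Lpn_continuous_approx[OF _ gm fin al] by blast
  have hl: "locint h" and hm: "h \<in> borel_measurable borel"
    using h(1) by (auto intro: continuous_locint borel_measurable_continuous_onI)
  have ghl: "locint (\<lambda>x. g x - h x)"
  proof -
    have "(\<integral>\<^sup>+ y. ennreal \<bar>g y - h y\<bar> * indicator (cball x T) y \<partial>lborel) < \<infinity>" for x T
    proof -
      have L: "Lpn 1 (cball x T) f = (\<integral>\<^sup>+ y. ennreal \<bar>f y\<bar> * indicator (cball x T) y \<partial>lborel)" for f :: "('q, 'r) pt \<Rightarrow> real"
        by (simp add: Lpn_def)
      have "Lpn 1 (cball x T) (\<lambda>y. g y + (- h y)) \<le> ennreal (2 ^ 1) * (Lpn 1 (cball x T) g + Lpn 1 (cball x T) (\<lambda>y. - h y))"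
        using gm hm by (intro Lpn_add) auto
      also have "\<dots> < \<infinity>" unfolding L using g hl by (simp add: locint_def ennreal_mult_less_top)
      finally show ?thesis unfolding L by simp
    qed
    then show ?thesis using gm hm by (simp add: locint_def)
  qed
  define V where "V = measure lborel ?S"
  have V: "emeasure lborel ?S = ennreal V" unfolding V_def
    by (intro emeasure_eq_ennreal_measure) (use emeasure_lborel_ball_finite[of "0 :: ('q, 'r) pt" R] in auto)
  have V0: "0 \<le> V" by (simp add: V_def)
  define s where "s = min 1 (\<alpha> / (V + 1))"
  have s: "0 < s" "s \<le> 1" "s \<le> \<alpha> / (V + 1)" using al V0 by (auto simp: s_def)
  have sV: "s ^ ?n * V \<le> \<alpha>"
  proof -
    have "s ^ ?n \<le> s" using s power_decreasing[of 1 ?n s] by simp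
    then have "s ^ ?n \<le> \<alpha> / (V + 1)" using s(3) by (rule order_trans)
    then have "s ^ ?n * V \<le> \<alpha> / (V + 1) * V" using V0 by (rule mult_right_mono)
    also have "\<dots> \<le> \<alpha> / (V + 1) * (V + 1)" using al V0 by (intro mult_left_mono) auto
    finally show ?thesis using V0 by simp
  qed
  have "uniformly_continuous_on (cball 0 (R + 1)) h"
    by (intro compact_uniformly_continuous continuous_on_subset[OF h(1)]) auto
  then obtain d where d: "d > 0" "\<And>x y. x \<in> cball 0 (R + 1) \<Longrightarrow> y \<in> cball 0 (R + 1) \<Longrightarrow> dist y x < d \<Longrightarrow> dist (h y) (h x) < s"
    using s(1) unfolding uniformly_continuous_on_def by metis
  have N0: "0 < ?N" by (simp add: card_gt_0_iff del: card_sum)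
  define \<epsilon>0 where "\<epsilon>0 = min 1 d / (2 * ?N)"
  have e0: "0 < \<epsilon>0" using d N0 by (simp add: \<epsilon>0_def del: card_sum)
  have "Lpn ?n ?S (\<lambda>x. smooth_kernel.conv K g (\<lambda>_. 0) x - g x) \<le> ennreal \<eta>"
    if M: "mollifier B \<epsilon> c K" and e: "\<epsilon> \<le> \<epsilon>0" for B \<epsilon> c and K :: "('q + 'r \<Rightarrow> nat) \<Rightarrow> ('q, 'r) pt \<Rightarrow> real"
  proof -
    interpret mollifier B \<epsilon> c K by (rule M)
    have "rad \<le> ?N * \<epsilon>0" unfolding rad_def using e N0 by (intro mult_left_mono) auto
    also have "\<dots> = min 1 d / 2" using N0 by (simp add: \<epsilon>0_def del: card_sum)
    finally have rad: "rad \<le> 1" "rad < d" using d by auto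
    have hs: "\<bar>mol h x - h x\<bar> \<le> s" if x: "x \<in> ?S" for x
    proof -
      have "mol h x - h x = mol (\<lambda>y. h y - h x) x"
        using mol_diff[OF hl continuous_locint[OF continuous_on_const], of "h x" x] by (simp add: mol_const)
      moreover have "\<bar>mol (\<lambda>y. h y - h x) x\<bar> \<le> s"
      proof (rule mol_le)
        show "locint (\<lambda>y. h y - h x)" by (intro continuous_locint continuous_intros h)
        fix y assume y: "norm (y - x) \<le> rad"
        have "norm y \<le> norm x + norm (y - x)" by (rule norm_triangle_sub)
        then have "y \<in> cball 0 (R + 1)" using y rad x by simp
        moreover have "x \<in> cball 0 (R + 1)" using x by simp
        moreover have "dist y x < d" using y rad by (simp add: dist_norm)
        ultimately have "dist (h y) (h x) < s" using d(2) by blast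
        then show "\<bar>h y - h x\<bar> \<le> s" by (simp add: dist_real_def)
      qed (use s in simp)
      ultimately show ?thesis by simp
    qed
    have mm: "mol g \<in> borel_measurable borel" "mol h \<in> borel_measurable borel" "mol (\<lambda>y. g y - h y) \<in> borel_measurable borel"
      using mol_meas g hl ghl by auto
    have 1: "Lpn ?n ?S (mol (\<lambda>y. g y - h y)) \<le> ennreal \<alpha>"
    proof -
      have "Lpn ?n ?S (mol (\<lambda>y. g y - h y)) \<le> Lpn ?n (ball 0 (R + rad)) (\<lambda>y. g y - h y)" by (rule Lpn_mol_le[OF ghl])
      also have "\<dots> \<le> Lpn ?n (ball 0 (R + 1)) (\<lambda>y. g y - h y)" using rad by (intro Lpn_mono) auto
      finally show ?thesis using h(2) by simp
    qed
    have 2: "Lpn ?n ?S (\<lambda>x. mol h x - h x) \<le> ennreal \<alpha>"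
    proof -
      have "Lpn ?n ?S (\<lambda>x. mol h x - h x) \<le> ennreal (s ^ ?n) * emeasure lborel ?S" using hs by (intro Lpn_le_const) auto
      also have "\<dots> = ennreal (s ^ ?n * V)" using V V0 s by (simp add: ennreal_mult)
      finally show ?thesis using sV by (meson ennreal_leI order_trans)
    qed
    have 3: "Lpn ?n ?S (\<lambda>x. h x - g x) \<le> ennreal \<alpha>"
    proof -
      have "Lpn ?n ?S (\<lambda>x. h x - g x) \<le> Lpn ?n (ball 0 (R + 1)) (\<lambda>x. g x - h x)" by (intro Lpn_mono) auto
      then show ?thesis using h(2) by simp
    qed
    have "Lpn ?n ?S (\<lambda>x. mol g x - g x) = Lpn ?n ?S (\<lambda>x. mol (\<lambda>y. g y - h y) x + ((mol h x - h x) + (h x - g x)))"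
      by (simp add: mol_diff[OF g hl])
    also have "\<dots> \<le> ennreal (2 ^ ?n) * (Lpn ?n ?S (mol (\<lambda>y. g y - h y)) + Lpn ?n ?S (\<lambda>x. (mol h x - h x) + (h x - g x)))"
      using mm gm hm by (intro Lpn_add) auto
    also have "\<dots> \<le> ennreal (2 ^ ?n) * (ennreal \<alpha> + ennreal (2 ^ ?n) * (Lpn ?n ?S (\<lambda>x. mol h x - h x) + Lpn ?n ?S (\<lambda>x. h x - g x)))"
      using mm gm hm 1 by (intro mult_left_mono add_mono Lpn_add) auto
    also have "\<dots> \<le> ennreal (2 ^ ?n) * (ennreal \<alpha> + ennreal (2 ^ ?n) * (ennreal \<alpha> + ennreal \<alpha>))"
      using 2 3 by (intro mult_left_mono add_mono) auto
    also have "\<dots> = ennreal (2 ^ ?n * (\<alpha> + 2 ^ ?n * (\<alpha> + \<alpha>)))"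
    proof -
      have "ennreal p * (ennreal \<alpha> + ennreal p * (ennreal \<alpha> + ennreal \<alpha>)) = ennreal (p * (\<alpha> + p * (\<alpha> + \<alpha>)))"
        if "0 \<le> p" for p using that al
        by (simp only: ennreal_mult ennreal_plus add_nonneg_nonneg mult_nonneg_nonneg less_imp_le)
      from this[of "2 ^ ?n"] show ?thesis by simp
    qed
    also have "\<dots> \<le> ennreal \<eta>"
    proof (rule ennreal_leI)
      have p: "(2::real) ^ ?n * 2 ^ ?n = 4 ^ ?n" by (simp only: power_mult_distrib[symmetric]) simp
      have "(2::real) ^ ?n \<le> 4 ^ ?n" by (rule power_mono) auto
      then have "2 ^ ?n * \<alpha> \<le> 4 ^ ?n * \<alpha>" using al by (intro mult_right_mono) auto
      moreover have "2 ^ ?n * (\<alpha> + 2 ^ ?n * (\<alpha> + \<alpha>)) = 2 ^ ?n * \<alpha> + (2 ^ ?n * 2 ^ ?n) * (2 * \<alpha>)" by (simp only: ring_distribs mult.assoc mult_2_right mult_2) 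
      ultimately have "2 ^ ?n * (\<alpha> + 2 ^ ?n * (\<alpha> + \<alpha>)) \<le> 3 * (4 ^ ?n * \<alpha>)" unfolding p by linarith
      also have "\<dots> = \<eta>" by (simp add: \<alpha>_def)
      finally show "2 ^ ?n * (\<alpha> + 2 ^ ?n * (\<alpha> + \<alpha>)) \<le> \<eta>" .
    qed
    finally show ?thesis .
  qed
  then show ?thesis using e0 by blast
qed

section \<open>Strong solutions as limits of smooth functions\<close>

lemma Lpn_cmult_le:
  assumes f: "f \<in> borel_measurable borel" and S: "S \<in> sets borel" and le: "\<And>x. x \<in> S \<Longrightarrow> \<bar>c x\<bar> \<le> b" and b: "0 \<le> b"
  shows "Lpn n S (\<lambda>x. c x * f x) \<le> ennreal (b ^ n) * Lpn n S f"
proof -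
  have "Lpn n S (\<lambda>x. c x * f x) \<le> (\<integral>\<^sup>+ x. ennreal (b ^ n) * (ennreal (\<bar>f x\<bar> ^ n) * indicator S x) \<partial>lborel)"
    unfolding Lpn_def
  proof (rule nn_integral_mono)
    fix x
    show "ennreal (\<bar>c x * f x\<bar> ^ n) * indicator S x \<le> ennreal (b ^ n) * (ennreal (\<bar>f x\<bar> ^ n) * indicator S x)"
    proof (cases "x \<in> S")
      case True
      have "\<bar>c x * f x\<bar> ^ n \<le> b ^ n * \<bar>f x\<bar> ^ n"
        unfolding abs_mult power_mult_distrib using le[OF True] by (intro mult_right_mono power_mono) auto
      then have "ennreal (\<bar>c x * f x\<bar> ^ n) \<le> ennreal (b ^ n * \<bar>f x\<bar> ^ n)" by (rule ennreal_leI)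
      then show ?thesis using True b by (simp add: ennreal_mult)
    qed simp
  qed
  also have "\<dots> = ennreal (b ^ n) * Lpn n S f"
    unfolding Lpn_def by (rule nn_integral_cmult[OF Lpn_integrand_measurable[OF f S]])
  finally show ?thesis .
qed

lemma Lpn_sum:
  assumes S: "S \<in> sets borel" and n: "0 < n" and I: "finite I"
  shows "\<exists>C\<ge>0. \<forall>f. (\<forall>i\<in>I. f i \<in> borel_measurable borel) \<longrightarrow> Lpn n S (\<lambda>x. \<Sum>i\<in>I. f i x) \<le> ennreal C * (\<Sum>i\<in>I. Lpn n S (f i))"
  using I
proof (induction I rule: finite_induct)
  case empty
  have "Lpn n S (\<lambda>x. 0) = 0" using n by (simp add: Lpn_def power_0_left)
  then show ?case by (intro exI[of _ 0]) simp
next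
  case (insert k I)
  then obtain C where C: "0 \<le> C" and IH: "\<And>f. (\<forall>i\<in>I. f i \<in> borel_measurable borel) \<Longrightarrow> Lpn n S (\<lambda>x. \<Sum>i\<in>I. f i x) \<le> ennreal C * (\<Sum>i\<in>I. Lpn n S (f i))"
    by blast
  have "Lpn n S (\<lambda>x. \<Sum>i\<in>insert k I. f i x) \<le> ennreal (2 ^ n * (1 + C)) * (\<Sum>i\<in>insert k I. Lpn n S (f i))"
    if f: "\<forall>i\<in>insert k I. f i \<in> borel_measurable borel" for f
  proof -
    have "Lpn n S (\<lambda>x. \<Sum>i\<in>insert k I. f i x) = Lpn n S (\<lambda>x. f k x + (\<Sum>i\<in>I. f i x))"
      using insert by simp
    also have "\<dots> \<le> ennreal (2 ^ n) * (Lpn n S (f k) + Lpn n S (\<lambda>x. \<Sum>i\<in>I. f i x))"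
      using f S by (intro Lpn_add borel_measurable_sum) auto
    also have "\<dots> \<le> ennreal (2 ^ n) * (ennreal 1 * Lpn n S (f k) + ennreal C * (\<Sum>i\<in>I. Lpn n S (f i)))"
      using IH f by (intro mult_left_mono add_mono) auto
    also have "\<dots> \<le> ennreal (2 ^ n) * (ennreal (1 + C) * Lpn n S (f k) + ennreal (1 + C) * (\<Sum>i\<in>I. Lpn n S (f i)))"
      using C by (intro mult_left_mono add_mono mult_right_mono ennreal_leI) auto
    also have "\<dots> = ennreal (2 ^ n * (1 + C)) * (\<Sum>i\<in>insert k I. Lpn n S (f i))"
      using C insert by (simp add: ennreal_mult distrib_left[symmetric] mult.assoc del: ennreal_plus)
    finally show ?thesis .
  qed
  moreover have "0 \<le> 2 ^ n * (1 + C)" using C by simp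
  ultimately show ?case by blast
qed

lemma Lp_loc_dim_finite:
  fixes g :: "('q::finite, 'r::finite) pt \<Rightarrow> real"
  assumes "Lp_loc (real n) g" and n: "0 < n"
  shows "Lpn n (ball 0 R) g < \<infinity>"
proof -
  have "Lpn n (ball 0 R) g \<le> (\<integral>\<^sup>+ x. ennreal (indicator (cball 0 R) x * \<bar>g x\<bar> powr real n) \<partial>lborel)"
    unfolding Lpn_def
  proof (rule nn_integral_mono)
    fix x :: "('q, 'r) pt"
    have "\<bar>g x\<bar> powr real n = \<bar>g x\<bar> ^ n" using n by (cases "g x = 0") (auto simp: powr_realpow)
    then show "ennreal (\<bar>g x\<bar> ^ n) * indicator (ball 0 R) x \<le> ennreal (indicator (cball 0 R) x * \<bar>g x\<bar> powr real n)"
      by (auto simp: indicator_def)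
  qed
  also have "\<dots> < \<infinity>" using assms(1) by (auto simp: Lp_loc_def)
  finally show ?thesis .
qed

text \<open>The embedding of W^(2,n) into the bounded functions, with interior estimate, obtained
  from \<open>ABP\<close> applied to \<zeta> W with \<zeta> = 4 \<rho>^2 - |y|^2. \<open>ABP\<close>
  sees the Hessian through its trace, so \<open>D\<close> has to dominate only diagonal second
  derivatives. Applied to differences of mollifications it turns convergence in L^n into locally
  uniform convergence.\<close>

lemma uniform_Cauchy_of_Lpn_Cauchy:
  "\<exists>C\<ge>0. \<forall>(W :: real^'n \<Rightarrow> real) G H D. C2_data W G H \<longrightarrow> continuous_on UNIV D \<longrightarrow>
     (\<forall>x. \<bar>W x\<bar> \<le> D x \<and> (\<forall>i. \<bar>G x $ i\<bar> \<le> D x) \<and> (\<forall>i. \<bar>H x $ i $ i\<bar> \<le> D x)) \<longrightarrow> (\<forall>x\<in>ball 0 \<rho>. \<forall>e>0.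
       Lpn CARD('n) (ball 0 (2 * \<rho>)) D \<le> ennreal (e ^ CARD('n)) \<longrightarrow> \<bar>W x\<bar> \<le> C * e)"
proof (cases "0 < \<rho>")
  case False
  then show ?thesis by (intro exI[of _ 0]) (simp add: ball_empty)
next
  case rho: True
  let ?n = "CARD('n)"
  have n0: "0 < ?n" by simp
  define C where C0: "C = ABP_const ?n"
  have C: "0 \<le> C" by (simp add: C0 ABP_const_nonneg)
  \<comment> \<open>n diagonal entries, each with 4 \<rho>^2 from \<zeta> times the Hessian of W, 2
    from W times the Hessian of \<zeta>, and 8 \<rho> from the two products of gradients.\<close>
  define c1 where "c1 = 4 * \<rho>\<^sup>2 * real ?n + 2 * real ?n + 8 * \<rho> * real ?n"
  have c10: "0 \<le> c1" using rho by (simp add: c1_def)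
  define C2 where "C2 = (C + 1) * (2 * \<rho>) * c1 / (3 * \<rho>\<^sup>2)"
  have one: "W x \<le> C2 * e"
    if CW: "C2_data W G H" and cD: "continuous_on UNIV D"
      and D: "\<And>x. \<bar>W x\<bar> \<le> D x" "\<And>x i. \<bar>G x $ i\<bar> \<le> D x" "\<And>x i. \<bar>H x $ i $ i\<bar> \<le> D x"
      and x: "x \<in> ball 0 \<rho>" and e: "0 < e" and I: "Lpn ?n (ball 0 (2 * \<rho>)) D \<le> ennreal (e ^ ?n)"
    for W :: "real^'n \<Rightarrow> real" and G H D x e
  proof (cases "0 \<le> W x")
    case False
    have "0 \<le> C2 * e" using C rho c10 e by (simp add: C2_def)
    then show ?thesis using False by linarith
  next
    case Wx: True
    have D0: "0 \<le> D y" for y using D(1)[of y] by linarith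
    define \<zeta> where "\<zeta> y = (4 * \<rho>\<^sup>2) * 1 + (-1) * (norm (y - 0))\<^sup>2" for y :: "real^'n"
    define G\<zeta> where "G\<zeta> y = (4 * \<rho>\<^sup>2) *\<^sub>R 0 + (-1) *\<^sub>R (2 *\<^sub>R (y - 0))" for y :: "real^'n"
    define H\<zeta> where "H\<zeta> y = (4 * \<rho>\<^sup>2) *\<^sub>R 0 + (-1) *\<^sub>R (2 *\<^sub>R mat 1 :: real^'n^'n)" for y :: "real^'n"
    have C\<zeta>: "C2_data \<zeta> G\<zeta> H\<zeta>"
      unfolding \<zeta>_def[abs_def] G\<zeta>_def[abs_def] H\<zeta>_def[abs_def] by (intro C2_data_lincomb C2_data_const C2_data_norm_sq)
    define Hw where "Hw y = \<zeta> y *\<^sub>R H y + W y *\<^sub>R H\<zeta> y + outer (G\<zeta> y) (G y) + outer (G y) (G\<zeta> y)" for y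
    have Cw: "C2_data (\<lambda>y. \<zeta> y * W y) (\<lambda>y. \<zeta> y *\<^sub>R G y + W y *\<^sub>R G\<zeta> y) Hw"
      unfolding Hw_def[abs_def] by (rule C2_data_mult[OF C\<zeta> CW])
    have tr: "- trace (Hw y) \<le> c1 * D y" if y: "dist 0 y < 2 * \<rho>" for y
    proof -
      have ny: "norm y < 2 * \<rho>" using y by simp
      have z: "\<bar>\<zeta> y\<bar> \<le> 4 * \<rho>\<^sup>2"
      proof -
        have "(norm y)\<^sup>2 \<le> (2 * \<rho>)\<^sup>2" using ny by (intro power_mono) auto
        then show ?thesis by (simp add: \<zeta>_def power_mult_distrib abs_le_iff)
      qed
      have t: "\<bar>Hw y $ i $ i\<bar> \<le> (4 * \<rho>\<^sup>2 + 2 + 8 * \<rho>) * D y" for i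
      proof -
        have "Hw y $ i $ i = \<zeta> y * H y $ i $ i + W y * (- 2) + 2 * ((- 2 * y $ i) * G y $ i)"
          by (simp add: Hw_def H\<zeta>_def G\<zeta>_def outer_def mat_def algebra_simps)
        moreover have "\<bar>\<zeta> y * H y $ i $ i\<bar> \<le> 4 * \<rho>\<^sup>2 * D y"
          unfolding abs_mult using z D(3)[of y i] by (intro mult_mono) auto
        moreover have "\<bar>W y * (- 2)\<bar> \<le> 2 * D y" using D(1)[of y] by (simp add: abs_mult)
        moreover have "\<bar>2 * ((- 2 * y $ i) * G y $ i)\<bar> \<le> 8 * \<rho> * D y"
        proof -
          have "\<bar>y $ i\<bar> * \<bar>G y $ i\<bar> \<le> (2 * \<rho>) * D y"
            using component_le_norm_cart[of y i] ny D(2)[of y i] rho by (intro mult_mono) auto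
          then show ?thesis by (simp add: abs_mult)
        qed
        ultimately have "\<bar>Hw y $ i $ i\<bar> \<le> 4 * \<rho>\<^sup>2 * D y + 2 * D y + 8 * \<rho> * D y" by linarith
        then show ?thesis by (simp add: distrib_right)
      qed
      have "- trace (Hw y) \<le> (\<Sum>i\<in>UNIV. \<bar>Hw y $ i $ i\<bar>)"
        unfolding trace_def sum_negf[symmetric] by (intro sum_mono) auto
      also have "\<dots> \<le> (\<Sum>i\<in>(UNIV :: 'n set). (4 * \<rho>\<^sup>2 + 2 + 8 * \<rho>) * D y)" using t by (intro sum_mono)
      also have "\<dots> = c1 * D y" by (simp add: c1_def algebra_simps)
      finally show ?thesis .
    qed
    have xb: "dist 0 x < \<rho>" "norm x < \<rho>" using x by auto
    have zx: "3 * \<rho>\<^sup>2 \<le> \<zeta> x"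
    proof -
      have "(norm x)\<^sup>2 \<le> \<rho>\<^sup>2" using xb by (intro power_mono) auto
      then show ?thesis by (simp add: \<zeta>_def)
    qed
    have "ennreal ((\<zeta> x * W x) ^ ?n) \<le> ennreal (C * (2 * \<rho>) ^ ?n) *
        (\<integral>\<^sup>+ y. ennreal ((c1 * D y) ^ ?n) * indicator (ball 0 (2 * \<rho>)) y \<partial>lborel)"
    unfolding C0
    proof (rule ABP[OF Cw])
      show "0 < 2 * \<rho>" using rho by simp
      show "\<zeta> y * W y \<le> 0" if "dist 0 y = 2 * \<rho>" for y
        using that by (simp add: \<zeta>_def power_mult_distrib)
      show "continuous_on UNIV (\<lambda>y. c1 * D y)" by (intro continuous_intros cD)
      show "0 \<le> c1 * D y" for y using c10 D0 by simp
      show "- trace (Hw y) \<le> c1 * D y" if "dist 0 y < 2 * \<rho>" "0 < \<zeta> y * W y" "nsd (Hw y)" for y by (rule tr[OF that(1)])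
      show "dist 0 x < 2 * \<rho>" using xb rho by simp
      show "0 \<le> \<zeta> x * W x" using zx Wx rho by (intro mult_nonneg_nonneg order_trans[OF _ zx]) auto
    qed
    also have "(\<integral>\<^sup>+ y. ennreal ((c1 * D y) ^ ?n) * indicator (ball 0 (2 * \<rho>)) y \<partial>lborel) = Lpn ?n (ball 0 (2 * \<rho>)) (\<lambda>y. c1 * D y)"
      using c10 D0 by (simp add: Lpn_def abs_mult)
    also have "\<dots> \<le> ennreal (c1 ^ ?n) * Lpn ?n (ball 0 (2 * \<rho>)) D"
      using c10 by (intro Lpn_cmult_le borel_measurable_continuous_onI[OF cD]) auto
    also have "\<dots> \<le> ennreal (c1 ^ ?n) * ennreal (e ^ ?n)" using I by (intro mult_left_mono) auto
    finally have "ennreal ((\<zeta> x * W x) ^ ?n) \<le> ennreal (C * (2 * \<rho>) ^ ?n) * (ennreal (c1 ^ ?n) * ennreal (e ^ ?n))"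
      by (simp add: mult_left_mono)
    also have "\<dots> = ennreal (C * (2 * \<rho>) ^ ?n * c1 ^ ?n * e ^ ?n)"
      using C rho c10 e by (simp add: ennreal_mult mult.assoc)
    finally have "(\<zeta> x * W x) ^ ?n \<le> C * (2 * \<rho>) ^ ?n * c1 ^ ?n * e ^ ?n"
      by (rule iffD1[OF ennreal_le_iff, rotated]) (use C rho c10 e in simp)
    also have "\<dots> = C * ((2 * \<rho>) * c1 * e) ^ ?n" by (simp only: power_mult_distrib mult.assoc)
    \<comment> \<open>Enlarging \<open>C\<close> to an n-th power makes the right side a pure power,
      so the bases can be compared.\<close>
    also have "\<dots> \<le> (C + 1) ^ ?n * ((2 * \<rho>) * c1 * e) ^ ?n"
    proof (rule mult_right_mono)
      have "C \<le> C + 1" by simp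
      also have "C + 1 \<le> (C + 1) ^ ?n" using C n0 power_increasing[of 1 ?n "C + 1"] by simp
      finally show "C \<le> (C + 1) ^ ?n" .
    qed (use rho c10 e in simp)
    also have "\<dots> = ((C + 1) * ((2 * \<rho>) * c1 * e)) ^ ?n" by (simp only: power_mult_distrib)
    finally have "(\<zeta> x * W x) ^ ?n \<le> ((C + 1) * ((2 * \<rho>) * c1 * e)) ^ ?n" .
    moreover have "0 \<le> (C + 1) * ((2 * \<rho>) * c1 * e)" using C rho c10 e by simp
    ultimately have "\<zeta> x * W x \<le> (C + 1) * ((2 * \<rho>) * c1 * e)"
      using power_strict_mono[of "(C + 1) * ((2 * \<rho>) * c1 * e)" "\<zeta> x * W x" ?n] n0 by linarith
    moreover have "3 * \<rho>\<^sup>2 * W x \<le> \<zeta> x * W x" using zx Wx by (rule mult_right_mono)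
    ultimately have "W x * (3 * \<rho>\<^sup>2) \<le> (C + 1) * ((2 * \<rho>) * c1 * e)" by (simp add: mult.commute)
    then have "W x \<le> (C + 1) * ((2 * \<rho>) * c1 * e) / (3 * \<rho>\<^sup>2)" using rho by (subst pos_le_divide_eq) auto
    then show ?thesis by (simp add: C2_def mult_ac)
  qed
  show ?thesis
  proof (intro exI[of _ C2] conjI allI impI ballI)
    show "0 \<le> C2" using C rho c10 by (simp add: C2_def)
    fix W :: "real^'n \<Rightarrow> real" and G H D and x :: "real^'n" and e
    assume CW: "C2_data W G H" and cD: "continuous_on UNIV D"
      and D: "\<forall>x. \<bar>W x\<bar> \<le> D x \<and> (\<forall>i. \<bar>G x $ i\<bar> \<le> D x) \<and> (\<forall>i. \<bar>H x $ i $ i\<bar> \<le> D x)"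
      and x: "x \<in> ball 0 \<rho>" and e: "0 < (e::real)" and I: "Lpn ?n (ball 0 (2 * \<rho>)) D \<le> ennreal (e ^ ?n)"
    have "W x \<le> C2 * e" using D by (intro one[OF CW cD _ _ _ x e I]) auto
    moreover have "- 1 * W x \<le> C2 * e"
      using D by (intro one[OF C2_data_scale[OF CW, of "- 1"] cD _ _ _ x e I]) auto
    ultimately show "\<bar>W x\<bar> \<le> C2 * e" by linarith
  qed
qed

context coeffs
begin

text \<open>The mollifications of u are Cauchy locally uniformly, and their limit \<open>v\<close>
  is the continuous representative of u. They also serve as the approximants in \<open>gsol\<close>.
  Outside this lemma the strong solution is used only through \<open>v\<close>.\<close>

lemma strong_solution_gsol:
  fixes f u :: "('q, 'r) pt \<Rightarrow> real"
  assumes sol: "strong_solution a f u" and f: "continuous_on UNIV f" and ub: "\<And>x. \<bar>u x\<bar> \<le> Ub"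
    and ab: "\<And>i j. bounded (range (a i j))"
  shows "\<exists>v. (AE x in lborel. v x = u x) \<and> gsol v f \<and> (\<forall>x. \<bar>v x\<bar> \<le> Ub)"
proof -
  let ?n = "CARD('q + 'r)"
  have cancel: "y * (t / y) = t" if "0 < y" for y t :: real using that by simp
  have n0: "0 < ?n" by (simp add: card_gt_0_iff del: card_sum)
  then obtain m where m: "?n = Suc m" using gr0_implies_Suc by blast
  obtain g1 g2 where Lu: "Lp_loc (real ?n) u" and w1: "\<And>i. weak_partial i u (g1 i)" and L1: "\<And>i. Lp_loc (real ?n) (g1 i)"
    and w2: "\<And>i j. weak_partial j (g1 i) (g2 i j)" and L2: "\<And>i j. Lp_loc (real ?n) (g2 i j)"
    and eq: "AE x in lborel. (\<Sum>i\<in>UNIV. \<Sum>j\<in>UNIV. a i j x * g2 i j x) = f x"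
    using sol unfolding strong_solution_def Let_def by blast
  \<comment> \<open>One finite set holds u and all its weak derivatives, so that a single
    mollification index serves all of them.\<close>
  define F where "F = insert u (range g1 \<union> range (\<lambda>p. g2 (fst p) (snd p)))"
  have finF: "finite F" by (simp add: F_def)
  have inF: "u \<in> F" "g1 i \<in> F" "g2 i j \<in> F" for i j
    unfolding F_def by (auto intro: image_eqI[of _ _ "(i, j)"])
  have loc: "locint g" if "g \<in> F" for g
    using that w1 w2 unfolding F_def weak_partial_def by (auto intro: Lp_loc_1_locint)
  have fin: "Lpn ?n (ball 0 R) g < \<infinity>" if "g \<in> F" for g R
  proof (rule Lp_loc_dim_finite[OF _ n0])
    show "Lp_loc (real ?n) g" using that Lu L1 L2 unfolding F_def by auto
  qed
  have gm: "g \<in> borel_measurable borel" if "g \<in> F" for g using loc[OF that] by (simp add: locint_def)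
  have "\<forall>k. \<exists>B c (K :: ('q + 'r \<Rightarrow> nat) \<Rightarrow> ('q, 'r) pt \<Rightarrow> real). mollifier B (1 / real (Suc k)) c K"
    by (intro allI mollifier_exists) simp
  then obtain B c and K :: "nat \<Rightarrow> ('q + 'r \<Rightarrow> nat) \<Rightarrow> ('q, 'r) pt \<Rightarrow> real"
    where mol: "\<And>k. mollifier (B k) (1 / real (Suc k)) (c k) (K k)" by metis
  define M where "M k g = smooth_kernel.conv (K k) g (\<lambda>_. 0)" for k g
  have sk: "smooth_kernel (B k) (1 / real (Suc k)) (c k) (K k)" for k using mol[of k] by (simp add: mollifier_def)
  have M_C2: "C2_data (M k u) (\<lambda>x. \<chi> i. M k (g1 i) x) (\<lambda>x. \<chi> i j. M k (g2 i j) x)" for k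
    unfolding M_def by (rule smooth_kernel.conv_C2_data[OF sk w1 w2])
  have M_cont: "continuous_on S (M k g)" if "g \<in> F" for k g S
    unfolding M_def by (rule mollifier.mol_cont[OF mol loc[OF that]])
  have M_meas: "M k g \<in> borel_measurable borel" if "g \<in> F" for k g
    by (rule borel_measurable_continuous_onI[OF M_cont[OF that]])
  have Ub0: "0 \<le> Ub" using ub[of 0] by linarith
  have M_le: "\<bar>M k u x\<bar> \<le> Ub" for k x
    unfolding M_def using mollifier.mol_le[OF mol loc[OF inF(1)] _ Ub0] ub by blast
  have lim1: "\<forall>\<^sub>F k in sequentially. Lpn ?n (ball 0 R) (\<lambda>x. M k g x - g x) \<le> ennreal \<eta>"
    if g: "g \<in> F" and eta: "0 < \<eta>" for g R \<eta>
  proof -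
    obtain \<epsilon>0 where e0: "\<epsilon>0 > 0" and M': "\<And>B \<epsilon> c (K :: ('q + 'r \<Rightarrow> nat) \<Rightarrow> ('q, 'r) pt \<Rightarrow> real). mollifier B \<epsilon> c K \<Longrightarrow> \<epsilon> \<le> \<epsilon>0 \<Longrightarrow>
       Lpn ?n (ball 0 R) (\<lambda>x. smooth_kernel.conv K g (\<lambda>_. 0) x - g x) \<le> ennreal \<eta>"
      using mol_approx[OF loc[OF g] _ eta, of m R] fin[OF g] unfolding m by blast
    have "(\<lambda>k. 1 / real (Suc k)) \<longlonglongrightarrow> 0" by (rule LIMSEQ_Suc[OF lim_1_over_n])
    then have "\<forall>\<^sub>F k in sequentially. 1 / real (Suc k) < \<epsilon>0" using e0 by (rule order_tendstoD)
    then show ?thesis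
    proof eventually_elim
      case (elim k)
      show ?case unfolding M_def by (rule M'[OF mol]) (use elim in simp)
    qed
  qed
  have lim: "\<forall>\<^sub>F k in sequentially. \<forall>g\<in>F. Lpn ?n (ball 0 R) (\<lambda>x. M k g x - g x) \<le> ennreal \<eta>" if "0 < \<eta>" for R \<eta>
    using finF lim1[OF _ that] by (intro eventually_ball_finite) auto
  have cauchy: "\<exists>k0. \<forall>k\<ge>k0. \<forall>l\<ge>k0. \<forall>x\<in>ball 0 \<rho>. \<bar>M k u x - M l u x\<bar> \<le> \<epsilon>" if eps: "0 < \<epsilon>" for \<rho> \<epsilon>
  proof -
    obtain C where C: "0 \<le> C" and UC: "\<And>W G H D x e. C2_data W G H \<Longrightarrow> continuous_on UNIV D \<Longrightarrow>
       (\<forall>x. \<bar>W x\<bar> \<le> D x \<and> (\<forall>i. \<bar>G x $ i\<bar> \<le> D x) \<and> (\<forall>i. \<bar>H x $ i $ i\<bar> \<le> D x)) \<Longrightarrow> x \<in> ball 0 \<rho> \<Longrightarrow> 0 < e \<Longrightarrow>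
       Lpn ?n (ball 0 (2 * \<rho>)) D \<le> ennreal (e ^ ?n) \<Longrightarrow> \<bar>W (x :: ('q, 'r) pt)\<bar> \<le> C * e"
      using uniform_Cauchy_of_Lpn_Cauchy[where 'n = "'q + 'r" and \<rho> = \<rho>] by blast
    obtain C' where C': "0 \<le> C'" and LS: "\<And>h. (\<forall>g\<in>F. h g \<in> borel_measurable borel) \<Longrightarrow>
       Lpn ?n (ball (0 :: ('q, 'r) pt) (2 * \<rho>)) (\<lambda>x. \<Sum>g\<in>F. h g x) \<le> ennreal C' * (\<Sum>g\<in>F. Lpn ?n (ball 0 (2 * \<rho>)) (h g))"
      using Lpn_sum[OF _ n0 finF, of "ball 0 (2 * \<rho>)"] by auto
    define e where "e = \<epsilon> / (C + 1)"
    have e: "0 < e" using eps C by (simp add: e_def)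
    \<comment> \<open>Chosen to undo the losses below: \<open>C' + 1\<close> and the cardinality
      come from \<open>Lpn_sum\<close>, the factor 2^n * 2 from comparing two mollifications through
      \<open>g\<close>.\<close>
    define \<eta> where "\<eta> = e ^ ?n / ((C' + 1) * (real (card F) * (2 ^ ?n * 2)))"
    have cF: "0 < real (card F)" using finF inF(1) by (auto simp: card_gt_0_iff)
    have den: "0 < (C' + 1) * (real (card F) * (2 ^ ?n * 2))" using C' cF by simp
    have eta: "0 < \<eta>" unfolding \<eta>_def using e den by (intro divide_pos_pos) auto
    obtain k0 where k0: "\<And>k g. k \<ge> k0 \<Longrightarrow> g \<in> F \<Longrightarrow> Lpn ?n (ball 0 (2 * \<rho>)) (\<lambda>x. M k g x - g x) \<le> ennreal \<eta>"
      using lim[OF eta, of "2 * \<rho>"] unfolding eventually_sequentially by blast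
    have "\<bar>M k u x - M l u x\<bar> \<le> \<epsilon>" if k: "k \<ge> k0" and l: "l \<ge> k0" and x: "x \<in> ball 0 \<rho>" for k l x
    proof -
      define D where "D x = (\<Sum>g\<in>F. \<bar>M k g x - M l g x\<bar>)" for x
      have le_D: "\<bar>M k g x - M l g x\<bar> \<le> D x" if "g \<in> F" for g x
        unfolding D_def using finF that by (intro member_le_sum) auto
      have "\<bar>1 * M k u x + (-1) * M l u x\<bar> \<le> C * e"
      proof (rule UC[OF C2_data_lincomb[OF M_C2[of k] M_C2[of l], of 1 "-1"] _ _ x e])
        show "continuous_on UNIV D" unfolding D_def by (intro continuous_intros M_cont)
        show "\<forall>x. \<bar>1 * M k u x + - 1 * M l u x\<bar> \<le> D x \<and>
          (\<forall>i. \<bar>(1 *\<^sub>R (\<chi> i. M k (g1 i) x) + - 1 *\<^sub>R (\<chi> i. M l (g1 i) x)) $ i\<bar> \<le> D x) \<and>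
          (\<forall>i. \<bar>(1 *\<^sub>R (\<chi> i j. M k (g2 i j) x) + - 1 *\<^sub>R (\<chi> i j. M l (g2 i j) x)) $ i $ i\<bar> \<le> D x)"
          using le_D[OF inF(1)] le_D[OF inF(2)] le_D[OF inF(3)] by simp
        have h: "Lpn ?n (ball 0 (2 * \<rho>)) (\<lambda>x. \<bar>M k g x - M l g x\<bar>) \<le> ennreal (2 ^ ?n * 2 * \<eta>)" if g: "g \<in> F" for g
        proof -
          have "Lpn ?n (ball 0 (2 * \<rho>)) (\<lambda>x. \<bar>M k g x - M l g x\<bar>) = Lpn ?n (ball 0 (2 * \<rho>)) (\<lambda>x. (M k g x - g x) + (g x - M l g x))"
            by (simp add: Lpn_def)
          also have "\<dots> \<le> ennreal (2 ^ ?n) * (Lpn ?n (ball 0 (2 * \<rho>)) (\<lambda>x. M k g x - g x) + Lpn ?n (ball 0 (2 * \<rho>)) (\<lambda>x. g x - M l g x))"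
            using M_meas[OF g] gm[OF g] by (intro Lpn_add) auto
          also have "Lpn ?n (ball 0 (2 * \<rho>)) (\<lambda>x. g x - M l g x) = Lpn ?n (ball 0 (2 * \<rho>)) (\<lambda>x. M l g x - g x)"
            by (simp add: Lpn_def abs_minus_commute)
          also have "ennreal (2 ^ ?n) * (Lpn ?n (ball 0 (2 * \<rho>)) (\<lambda>x. M k g x - g x) + Lpn ?n (ball 0 (2 * \<rho>)) (\<lambda>x. M l g x - g x)) \<le> ennreal (2 ^ ?n) * (ennreal \<eta> + ennreal \<eta>)"
            using k0[OF k g] k0[OF l g] by (intro mult_left_mono add_mono) auto
          also have "\<dots> = ennreal (2 ^ ?n * (\<eta> + \<eta>))"
            using eta by (simp only: ennreal_mult ennreal_plus less_imp_le add_nonneg_nonneg zero_le_power zero_le_numeral)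
          also have "2 ^ ?n * (\<eta> + \<eta>) = 2 ^ ?n * 2 * \<eta>" by simp
          finally show ?thesis .
        qed
        have "Lpn ?n (ball 0 (2 * \<rho>)) D \<le> ennreal C' * (\<Sum>g\<in>F. Lpn ?n (ball 0 (2 * \<rho>)) (\<lambda>x. \<bar>M k g x - M l g x\<bar>))"
          unfolding D_def using M_meas by (intro LS) auto
        also have "\<dots> \<le> ennreal C' * (\<Sum>g\<in>F. ennreal (2 ^ ?n * 2 * \<eta>))" using h by (intro mult_left_mono sum_mono) auto
        also have "(\<Sum>g\<in>F. ennreal (2 ^ ?n * 2 * \<eta>)) = ennreal (real (card F) * (2 ^ ?n * 2 * \<eta>))"
          using eta by (subst sum_ennreal) auto
        also have "ennreal C' * \<dots> = ennreal (C' * (real (card F) * (2 ^ ?n * 2 * \<eta>)))"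
          using C' by (simp only: ennreal_mult')
        also have "\<dots> \<le> ennreal (e ^ ?n)"
        proof (rule ennreal_leI)
          have "C' * (real (card F) * (2 ^ ?n * 2 * \<eta>)) \<le> (C' + 1) * (real (card F) * (2 ^ ?n * 2 * \<eta>))"
            using eta by (intro mult_right_mono) auto
          also have "\<dots> = ((C' + 1) * (real (card F) * (2 ^ ?n * 2))) * \<eta>" by (simp only: mult.assoc)
          also have "\<dots> = e ^ ?n" unfolding \<eta>_def by (rule cancel[OF den])
          finally show "C' * (real (card F) * (2 ^ ?n * 2 * \<eta>)) \<le> e ^ ?n" .
        qed
        finally show "Lpn ?n (ball 0 (2 * \<rho>)) D \<le> ennreal (e ^ ?n)" .
      qed
      also have "C * e \<le> (C + 1) * e" using e by (intro mult_right_mono) auto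
      also have "\<dots> = \<epsilon>" using C by (simp add: e_def)
      finally show ?thesis by simp
    qed
    then show ?thesis by blast
  qed
  define v where "v x = lim (\<lambda>k. M k u x)" for x
  have v: "(\<lambda>k. M k u x) \<longlonglongrightarrow> v x" for x
  proof -
    have "Cauchy (\<lambda>k. M k u x)"
    proof (rule metric_CauchyI)
      fix e :: real assume e: "0 < e"
      obtain k0 where "\<forall>k\<ge>k0. \<forall>l\<ge>k0. \<forall>y\<in>ball 0 (norm x + 1). \<bar>M k u y - M l u y\<bar> \<le> e / 2"
        using cauchy[of "e / 2" "norm x + 1"] e by auto
      then have "\<bar>M k u x - M l u x\<bar> \<le> e / 2" if "k \<ge> k0" "l \<ge> k0" for k l using that by simp
      then show "\<exists>N. \<forall>k\<ge>N. \<forall>l\<ge>N. dist (M k u x) (M l u x) < e"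
        using e by (intro exI[of _ k0]) (auto simp: dist_real_def intro: le_less_trans[of _ "e / 2"])
    qed
    then show ?thesis unfolding v_def by (simp add: Cauchy_convergent_iff convergent_LIMSEQ_iff)
  qed
  have unif: "\<exists>k0. \<forall>k\<ge>k0. \<forall>x\<in>ball 0 \<rho>. \<bar>M k u x - v x\<bar> \<le> \<epsilon>" if eps: "0 < \<epsilon>" for \<rho> \<epsilon>
  proof -
    obtain k0 where k0: "\<And>k l x. k \<ge> k0 \<Longrightarrow> l \<ge> k0 \<Longrightarrow> x \<in> ball 0 \<rho> \<Longrightarrow> \<bar>M k u x - M l u x\<bar> \<le> \<epsilon>"
      using cauchy[OF eps, of \<rho>] by blast
    have "\<bar>M k u x - v x\<bar> \<le> \<epsilon>" if "k \<ge> k0" "x \<in> ball 0 \<rho>" for k x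
    proof -
      have "(\<lambda>l. \<bar>M k u x - M l u x\<bar>) \<longlonglongrightarrow> \<bar>M k u x - v x\<bar>" by (intro tendsto_intros v)
      then show ?thesis by (rule LIMSEQ_le_const2) (use k0 that in blast)
    qed
    then show ?thesis by blast
  qed
  have vb: "\<bar>v x\<bar> \<le> Ub" for x
  proof -
    have "(\<lambda>k. \<bar>M k u x\<bar>) \<longlonglongrightarrow> \<bar>v x\<bar>" by (intro tendsto_intros v)
    then show ?thesis by (rule LIMSEQ_le_const2) (use M_le in blast)
  qed
  have vc: "continuous_on UNIV v"
  proof -
    have "continuous_on (ball 0 \<rho>) v" for \<rho>
    proof (rule uniform_limit_theorem[where F = sequentially])
      show "uniform_limit (ball 0 \<rho>) (\<lambda>k. M k u) v sequentially"
        unfolding uniform_limit_iff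
      proof (intro allI impI)
        fix e :: real assume e: "0 < e"
        obtain k0 where k0: "\<forall>k\<ge>k0. \<forall>x\<in>ball 0 \<rho>. \<bar>M k u x - v x\<bar> \<le> e / 2" using unif[of "e / 2" \<rho>] e by auto
        show "\<forall>\<^sub>F k in sequentially. \<forall>x\<in>ball 0 \<rho>. dist (M k u x) (v x) < e"
          using eventually_ge_at_top[of k0]
        proof eventually_elim
          case (elim k)
          show ?case
          proof
            fix x :: "('q, 'r) pt" assume "x \<in> ball 0 \<rho>"
            then have "\<bar>M k u x - v x\<bar> \<le> e / 2" using k0 elim by blast
            then show "dist (M k u x) (v x) < e" using e by (simp add: dist_real_def)
          qed
        qed
      qed
    qed (use M_cont[OF inF(1)] in auto)
    then have "isCont v x" for x
      using continuous_on_interior[of "ball 0 (norm x + 1)" v x] by simp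
    then show ?thesis by (simp add: continuous_at_imp_continuous_on)
  qed
  have vm: "v \<in> borel_measurable borel" by (rule borel_measurable_continuous_onI[OF vc])
  have zero: "Lpn ?n (ball 0 R) (\<lambda>x. v x - u x) = 0" for R
  proof -
    define V where "V = measure lborel (ball (0 :: ('q, 'r) pt) R)"
    have V: "emeasure lborel (ball (0 :: ('q, 'r) pt) R) = ennreal V" unfolding V_def
      by (intro emeasure_eq_ennreal_measure) (use emeasure_lborel_ball_finite[of "0 :: ('q, 'r) pt" R] in auto)
    have V0: "0 \<le> V" by (simp add: V_def)
    have small: "Lpn ?n (ball 0 R) (\<lambda>x. v x - u x) \<le> 0 + ennreal e" if e: "0 < e" for e
    proof -
      define s where "s = min 1 (e / (2 ^ ?n * (V + 1)))"
      have s: "0 < s" "s \<le> 1" "s \<le> e / (2 ^ ?n * (V + 1))" using e V0 by (auto simp: s_def simp del: card_sum)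
      have ev: "\<forall>\<^sub>F k in sequentially. \<forall>x\<in>ball 0 R. \<bar>M k u x - v x\<bar> \<le> s"
        using unif[OF s(1), of R] unfolding eventually_sequentially .
      obtain k where k: "\<forall>x\<in>ball 0 R. \<bar>M k u x - v x\<bar> \<le> s" "\<forall>g\<in>F. Lpn ?n (ball 0 R) (\<lambda>x. M k g x - g x) \<le> ennreal s"
        using eventually_happens'[OF sequentially_bot eventually_conj[OF ev lim[OF s(1), of R]]] by blast
      have "1 \<le> ?n" using n0 by linarith
      then have "s ^ ?n \<le> s ^ 1" using s by (intro power_decreasing) auto
      then have sn: "s ^ ?n \<le> s" by (simp only: power_one_right)
      have "Lpn ?n (ball 0 R) (\<lambda>x. v x - u x) = Lpn ?n (ball 0 R) (\<lambda>x. (v x - M k u x) + (M k u x - u x))" by simp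
      also have "\<dots> \<le> ennreal (2 ^ ?n) * (Lpn ?n (ball 0 R) (\<lambda>x. v x - M k u x) + Lpn ?n (ball 0 R) (\<lambda>x. M k u x - u x))"
        using vm M_meas[OF inF(1)] gm[OF inF(1)] by (intro Lpn_add) auto
      also have "\<dots> \<le> ennreal (2 ^ ?n) * (ennreal (s * V) + ennreal s)"
      proof (intro mult_left_mono add_mono)
        have "Lpn ?n (ball 0 R) (\<lambda>x. v x - M k u x) \<le> ennreal (s ^ ?n) * emeasure lborel (ball (0 :: ('q, 'r) pt) R)"
          using k(1) by (intro Lpn_le_const) (auto simp: abs_minus_commute)
        also have "\<dots> \<le> ennreal s * ennreal V" unfolding V using sn by (intro mult_right_mono ennreal_leI) auto
        also have "\<dots> = ennreal (s * V)" using s V0 by (simp add: ennreal_mult)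
        finally show "Lpn ?n (ball 0 R) (\<lambda>x. v x - M k u x) \<le> ennreal (s * V)" .
        show "Lpn ?n (ball 0 R) (\<lambda>x. M k u x - u x) \<le> ennreal s" using k(2) inF(1) by blast
      qed auto
      also have "\<dots> = ennreal (2 ^ ?n * (s * V + s))"
        using s V0 by (simp only: ennreal_mult ennreal_plus less_imp_le add_nonneg_nonneg mult_nonneg_nonneg zero_le_power zero_le_numeral)
      also have "2 ^ ?n * (s * V + s) = s * (2 ^ ?n * (V + 1))" by (simp add: algebra_simps del: card_sum)
      also have "ennreal (s * (2 ^ ?n * (V + 1))) \<le> ennreal e"
      proof (rule ennreal_leI)
        have "0 < 2 ^ ?n * (V + 1)" using V0 by simp
        then show "s * (2 ^ ?n * (V + 1)) \<le> e" using s(3) by (simp only: pos_le_divide_eq)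
      qed
      finally show ?thesis by simp
    qed
    have "Lpn ?n (ball 0 R) (\<lambda>x. v x - u x) \<le> 0"
      by (rule ennreal_le_epsilon) (rule small)
    then show ?thesis by simp
  qed
  have "AE x in lborel. v x = u x"
  proof -
    have "AE x in lborel. x \<in> ball 0 (real R) \<longrightarrow> v x = u x" for R
    proof -
      have "(\<lambda>x. ennreal (\<bar>v x - u x\<bar> ^ ?n) * indicator (ball 0 (real R)) x) \<in> borel_measurable lborel"
        using vm gm[OF inF(1)] by (intro Lpn_integrand_measurable) auto
      then have "AE x in lborel. ennreal (\<bar>v x - u x\<bar> ^ ?n) * indicator (ball 0 (real R)) x = 0"
        using zero[of "real R"] unfolding Lpn_def by (simp add: nn_integral_0_iff_AE)
      then show ?thesis
        by eventually_elim (auto simp: indicator_def ennreal_eq_0_iff power_le_zero_eq split: if_splits)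
    qed
    then have "AE x in lborel. \<forall>R. x \<in> ball 0 (real R) \<longrightarrow> v x = u x"
      unfolding AE_all_countable by (rule allI)
    then show ?thesis
    proof eventually_elim
      case (elim x)
      have "\<exists>R. norm x < real R" by (rule reals_Archimedean2)
      then show ?case using elim by simp
    qed
  qed
  moreover have "gsol v f"
    unfolding gsol_def
  proof (intro conjI allI impI vc f)
    fix R \<epsilon> :: real assume R: "0 < R" and eps: "0 < \<epsilon>"
    have "\<exists>b. \<forall>i j x. \<bar>a i j x\<bar> \<le> b"
    proof -
      obtain b where b: "\<And>i j x. \<bar>a i j x\<bar> \<le> b i j" using ab unfolding bounded_iff by (metis rangeI real_norm_def)
      have b0: "0 \<le> b i j" for i j using b[of i j 0] by linarith
      have "\<bar>a i j x\<bar> \<le> (\<Sum>p\<in>UNIV. b (fst p) (snd p))" for i j x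
        using b[of i j x] member_le_sum[of "(i, j)" UNIV "\<lambda>p. b (fst p) (snd p)"] b0 by simp
      then show ?thesis by blast
    qed
    then obtain b where b: "\<And>i j x. \<bar>a i j x\<bar> \<le> b" by blast
    have b0: "0 \<le> b" using b[of undefined undefined 0] by linarith
    let ?P = "UNIV :: (('q + 'r) \<times> ('q + 'r)) set"
    obtain C where C: "0 \<le> C" and LS: "\<And>h. (\<forall>p\<in>?P. h p \<in> borel_measurable borel) \<Longrightarrow>
       Lpn ?n (ball (0 :: ('q, 'r) pt) R) (\<lambda>x. \<Sum>p\<in>?P. h p x) \<le> ennreal C * (\<Sum>p\<in>?P. Lpn ?n (ball 0 R) (h p))"
      using Lpn_sum[OF _ n0, of "ball 0 R" ?P] by auto
    define \<eta> where "\<eta> = \<epsilon> / ((C + 1) * (real (card ?P) * (b ^ ?n + 1)))"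
    have cP: "0 < real (card ?P)" by (simp add: card_gt_0_iff del: card_prod card_sum)
    have bn: "0 \<le> b ^ ?n" using b0 by simp
    have den: "0 < (C + 1) * (real (card ?P) * (b ^ ?n + 1))" using C cP bn by (intro mult_pos_pos) auto
    have eta: "0 < \<eta>" unfolding \<eta>_def using eps den by (intro divide_pos_pos) auto
    have ev: "\<forall>\<^sub>F k in sequentially. \<forall>x\<in>ball 0 R. \<bar>M k u x - v x\<bar> \<le> \<epsilon>"
      using unif[OF eps, of R] unfolding eventually_sequentially .
    obtain k where k: "\<forall>x\<in>ball 0 R. \<bar>M k u x - v x\<bar> \<le> \<epsilon>" "\<forall>g\<in>F. Lpn ?n (ball 0 R) (\<lambda>x. M k g x - g x) \<le> ennreal \<eta>"
      using eventually_happens'[OF sequentially_bot eventually_conj[OF ev lim[OF eta, of R]]] by blast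
    define h where "h p x = a (fst p) (snd p) x * (M k (g2 (fst p) (snd p)) x - g2 (fst p) (snd p) x)" for p x
    have hm: "h p \<in> borel_measurable borel" for p
      unfolding h_def[abs_def] using M_meas[OF inF(3), of k] gm[OF inF(3)] borel_measurable_continuous_onI[OF a_cont]
      by (intro borel_measurable_times borel_measurable_diff) auto
    \<comment> \<open>Almost everywhere f is the sum of a i j times g2 i j, so the residual is a sum
      of a i j times mollification errors of \<open>g2\<close>. The coefficients stay outside the
      convolution and no commutator appears.\<close>
    have "Lpn ?n (ball 0 R) (\<lambda>x. Lop a (\<chi> i j. M k (g2 i j) x) x - f x) = Lpn ?n (ball 0 R) (\<lambda>x. \<Sum>p\<in>?P. h p x)"
      unfolding Lpn_def
    proof (rule nn_integral_cong_AE)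
      show "AE x in lborel. ennreal (\<bar>Lop a (\<chi> i j. M k (g2 i j) x) x - f x\<bar> ^ ?n) * indicator (ball 0 R) x =
         ennreal (\<bar>\<Sum>p\<in>?P. h p x\<bar> ^ ?n) * indicator (ball 0 R) x"
        using eq
      proof eventually_elim
        case (elim x)
        have "(\<Sum>p\<in>?P. h p x) = (\<Sum>i\<in>UNIV. \<Sum>j\<in>UNIV. h (i, j) x)"
          unfolding UNIV_Times_UNIV[symmetric] by (simp add: sum.cartesian_product)
        also have "\<dots> = Lop a (\<chi> i j. M k (g2 i j) x) x - (\<Sum>i\<in>UNIV. \<Sum>j\<in>UNIV. a i j x * g2 i j x)"
          by (simp add: h_def Lop_def right_diff_distrib sum_subtractf)
        finally show ?case using elim by simp
      qed
    qed
    also have "\<dots> \<le> ennreal C * (\<Sum>p\<in>?P. Lpn ?n (ball 0 R) (h p))" using hm by (intro LS) auto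
    also have "\<dots> \<le> ennreal C * (\<Sum>p\<in>?P. ennreal (b ^ ?n * \<eta>))"
    proof (intro mult_left_mono sum_mono)
      fix p
      have "Lpn ?n (ball 0 R) (h p) \<le> ennreal (b ^ ?n) * Lpn ?n (ball 0 R) (\<lambda>x. M k (g2 (fst p) (snd p)) x - g2 (fst p) (snd p) x)"
        unfolding h_def[abs_def] using M_meas[OF inF(3), of k] gm[OF inF(3)] b b0 by (intro Lpn_cmult_le borel_measurable_diff) auto
      also have "\<dots> \<le> ennreal (b ^ ?n) * ennreal \<eta>" using k(2) inF(3) by (intro mult_left_mono) auto
      also have "\<dots> = ennreal (b ^ ?n * \<eta>)" using bn by (simp only: ennreal_mult')
      finally show "Lpn ?n (ball 0 R) (h p) \<le> ennreal (b ^ ?n * \<eta>)" .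
    qed auto
    also have "(\<Sum>p\<in>?P. ennreal (b ^ ?n * \<eta>)) = ennreal (real (card ?P) * (b ^ ?n * \<eta>))"
      using eta bn by (subst sum_ennreal) (auto simp del: card_prod card_sum)
    also have "ennreal C * \<dots> = ennreal (C * (real (card ?P) * (b ^ ?n * \<eta>)))"
      using C by (simp only: ennreal_mult')
    also have "\<dots> \<le> ennreal \<epsilon>"
    proof (rule ennreal_leI)
      have "C * (real (card ?P) * (b ^ ?n * \<eta>)) \<le> (C + 1) * (real (card ?P) * ((b ^ ?n + 1) * \<eta>))"
        using C cP bn eta by (intro mult_mono mult_left_mono mult_right_mono mult_nonneg_nonneg) auto
      also have "\<dots> = ((C + 1) * (real (card ?P) * (b ^ ?n + 1))) * \<eta>" by (simp only: mult.assoc)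
      also have "\<dots> = \<epsilon>" unfolding \<eta>_def by (rule cancel[OF den])
      finally show "C * (real (card ?P) * (b ^ ?n * \<eta>)) \<le> \<epsilon>" .
    qed
    finally show "\<exists>U G H. C2_data U G H \<and> (\<forall>x\<in>ball 0 R. \<bar>U x - v x\<bar> \<le> \<epsilon>) \<and>
        (\<integral>\<^sup>+ x. ennreal (\<bar>Lop a (H x) x - f x\<bar> ^ ?n) * indicator (ball 0 R) x \<partial>lborel) \<le> ennreal \<epsilon>"
      using M_C2[of k] k(1) unfolding Lpn_def by blast
  qed
  ultimately show ?thesis using vb by blast
qed

end

section \<open>The partial Schauder estimate\<close>

theorem theorem2p1:
  fixes \<delta> \<nu> :: real
  assumes "0 < \<delta>" "\<delta> < 1" "0 < \<nu>" "\<nu> \<le> 1"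
  shows "\<exists>N::real. \<forall>(a :: ('q::finite + 'r::finite) \<Rightarrow> ('q + 'r) \<Rightarrow> ('q, 'r) pt \<Rightarrow> real)
            (f :: ('q, 'r) pt \<Rightarrow> real) (u :: ('q, 'r) pt \<Rightarrow> real).
     (\<forall>i j. a i j = a j i) \<longrightarrow>
     (\<forall>i j. a i j \<in> borel_measurable lborel \<and> bounded (range (a i j))
            \<and> continuous_on UNIV (a i j)) \<longrightarrow>
     (\<forall>i j x y. same_xpp x y \<longrightarrow> a i j x = a i j y) \<longrightarrow>
     (\<forall>x \<xi>. \<nu> * (norm \<xi>)\<^sup>2 \<le> (\<Sum>i\<in>UNIV. \<Sum>j\<in>UNIV. a i j x * \<xi> $ i * \<xi> $ j)
          \<and> (\<Sum>i\<in>UNIV. \<Sum>j\<in>UNIV. a i j x * \<xi> $ i * \<xi> $ j) \<le> (norm \<xi>)\<^sup>2 / \<nu>) \<longrightarrow>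
     C_delta_xp \<delta> f \<longrightarrow>
     bounded (range u) \<longrightarrow>
     strong_solution a f u \<longrightarrow>
     (\<exists>v. (AE x in lborel. v x = u x) \<and> C2_delta_xp \<delta> v \<and>
          holder2_xp \<delta> v \<le> ereal N * holder_xp \<delta> f)"
proof -
  obtain m :: nat and K \<mu> where par: "1 \<le> m" "1 \<le> K" "0 < \<mu>" "\<mu> \<le> 1" "2 * real m powr \<delta> / K \<le> 1 / 8"
     "real m powr (\<delta> - 1) \<le> 1 / 8" "2 * \<mu> powr \<delta> / (2 powr \<delta> - 1) \<le> 1 / 8"
    using bootstrap_parameters[OF assms(1,2)] by blast
  \<comment> \<open>\<open>m\<close>, \<open>K\<close> and \<open>\<mu>\<close> come from \<delta>
    alone, so this constant depends only on \<delta> and \<nu>.\<close>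
  define N1 where "N1 = 12 * K\<^sup>2 * (\<mu> / 2) powr (\<delta> - 2) / \<nu>"
  show ?thesis
  \<comment> \<open>Third differences are bounded with the constant 2 N1 F, and
    \<open>G2_holder\<close> doubles it because a mixed derivative combines two pure ones.\<close>
  proof (intro exI[of _ "4 * N1"] allI impI)
    fix a :: "'q + 'r \<Rightarrow> 'q + 'r \<Rightarrow> ('q, 'r) pt \<Rightarrow> real" and f u :: "('q, 'r) pt \<Rightarrow> real"
    assume ab: "\<forall>i j. a i j \<in> borel_measurable lborel \<and> bounded (range (a i j)) \<and> continuous_on UNIV (a i j)"
      and ax: "\<forall>i j x y. same_xpp x y \<longrightarrow> a i j x = a i j y"
      and ell: "\<forall>x \<xi>. \<nu> * (norm \<xi>)\<^sup>2 \<le> (\<Sum>i\<in>UNIV. \<Sum>j\<in>UNIV. a i j x * \<xi> $ i * \<xi> $ j)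
          \<and> (\<Sum>i\<in>UNIV. \<Sum>j\<in>UNIV. a i j x * \<xi> $ i * \<xi> $ j) \<le> (norm \<xi>)\<^sup>2 / \<nu>"
      and fC: "C_delta_xp \<delta> f" and ub: "bounded (range u)" and sol: "strong_solution a f u"
    interpret coeffs a \<nu>
      by unfold_locales (use assms ab ax ell in auto)
    have fc: "continuous_on UNIV f" using fC by (simp add: C_delta_xp_def C0_xp_def cont_bdd_def)
    obtain Ub where Ub: "\<And>x. \<bar>u x\<bar> \<le> Ub" using ub by (auto simp: bounded_iff)
    have quot: "ereal (\<bar>f x - f y\<bar> / norm (x - y) powr \<delta>) \<le> holder_xp \<delta> f" if "same_xpp x y" "x \<noteq> y" for x y
      unfolding holder_xp_def using that by (intro SUP_upper2[of "(x, y)"]) auto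
    \<comment> \<open>The index type is inhabited, so the supremum runs over a nonempty set of
      nonnegative quotients and cannot be minus infinity.\<close>
    obtain k :: 'q where True by blast
    have "ereal 0 \<le> holder_xp \<delta> f"
    proof (rule order_trans[OF _ quot[of "axis (Inl k) 1" 0]])
      show "same_xpp (axis (Inl k) 1 :: ('q, 'r) pt) 0" by (simp add: same_xpp_def axis_def)
    qed (auto simp: axis_eq_0_iff)
    moreover have "holder_xp \<delta> f < \<infinity>" using fC by (simp add: C_delta_xp_def)
    ultimately obtain F where F: "holder_xp \<delta> f = ereal F" "0 \<le> F" by (cases "holder_xp \<delta> f") auto
    have fF: "\<bar>f (x + h) - f x\<bar> \<le> F * norm h powr \<delta>" if "hor h" for x h
    proof (cases "h = 0")
      case False
      have "same_xpp (x + h) x" using that by (simp add: same_xpp_def hor_def)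
      then have "\<bar>f (x + h) - f x\<bar> / norm h powr \<delta> \<le> F" using quot[of "x + h" x] False F by simp
      moreover have "0 < norm h powr \<delta>" using False by simp
      ultimately show ?thesis by (simp add: pos_divide_le_eq)
    qed simp
    obtain v where v: "AE x in lborel. v x = u x" "gsol v f" "\<And>x. \<bar>v x\<bar> \<le> Ub"
      using strong_solution_gsol[OF sol fc Ub] ab by blast
    interpret third_diff v \<delta> "2 * N1 * F" Ub
    proof unfold_locales
      show "continuous_on UNIV v" using v(2) by (simp add: gsol_def)
      show "0 \<le> 2 * N1 * F" using F(2) assms(3) by (simp add: N1_def)
      show "\<bar>diff2 h v (x + k) - diff2 h v x\<bar> \<le> 2 * N1 * F * (norm h)\<^sup>2 * norm k powr \<delta>" if "hor h" "hor k" for h k x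
        by (rule third_difference_bound[OF v(2) _ F(2) assms(1,2) v(3) par N1_def that]) (rule fF)
    qed (use v(3) assms in auto)
    have "holder2_xp \<delta> v \<le> ereal (4 * N1) * holder_xp \<delta> f" using holder2_le unfolding F(1) by (simp add: mult.assoc)
    then show "\<exists>v. (AE x in lborel. v x = u x) \<and> C2_delta_xp \<delta> v \<and> holder2_xp \<delta> v \<le> ereal (4 * N1) * holder_xp \<delta> f"
      using v(1) C2_delta by blast
  qed
qed

end
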